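(* Let $R$ be a ring and $n$ a positive integer. Let $M_1,\dots,M_r,N_1,\dots,N_s$ be non-zero objects of $\mathcal{E}_n$ such that all the factor modules $U^{(i)}_k=M_k^{(i)}/M_k^{(i-1)}$ ($k=1,\dots,r$, $i=1,\dots,n$) and $V^{(i)}_l=N_l^{(i)}/N_l^{(i-1)}$ ($l=1,\dots,s$, $i=1,\dots,n$) are uniserial (possibly zero) right $R$-modules. For $i=1,\dots,n$ define $$X_i:=\{k\mid k=1,\dots,r,\ U^{(i)}_k\neq 0\}\quad\text{and}\quad Y_i:=\{l\mid l=1,\dots,s,\ V^{(i)}_l\neq 0\}.$$ Then $\bigoplus_{k=1}^r M_k\cong\bigoplus_{l=1}^s N_l$ in $\mathcal{E}_n$ if and only if there exist $2n$ bijections $\varphi_{i,a}:X_i\to Y_i$ ($i=1,\dots,n$, $a=m,e$) such that $[M_k]_{i,a}=[N_{\varphi_{i,a}(k)}]_{i,a}$ for every $i=1,\dots,n$, every $a=m,e$ and every $k\in X_i$.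
   Context: Rings are associative with identity and modules are right unitary modules. Fix a ring $R$ and a positive integer $n$. The category $\mathcal{E}_n$ has as objects right $R$-modules $M$ with a fixed chain of submodules $0=M^{(0)}\le M^{(1)}\le\dots\le M^{(n)}=M$ (denoted simply by $M$); a morphism $M\to N$ in $\mathcal{E}_n$ is a right $R$-module morphism $f:M\to N$ with $f(M^{(i)})\subseteq N^{(i)}$ for every $i=1,\dots,n$. This is an additive category (the direct sum has $(M\oplus N)^{(i)}=M^{(i)}\oplus N^{(i)}$, and the zero object is the zero module with its trivial chain). The module $M^{(i)}/M^{(i-1)}$ is the $i$-th factor module of $M$, and $f_i:M^{(i)}/M^{(i-1)}\to N^{(i)}/N^{(i-1)}$ denotes the right $R$-module morphism induced by $f$. A right $R$-module is uniserial if its lattice of submodules is linearly ordered under inclusion. For objects $M,N$ of $\mathcal{E}_n$ and $i=1,\dots,n$: $[M]_{i,m}=[N]_{i,m}$ (same $i$-th monogeny class) means that there exist morphisms $f:M\to N$ and $g:N\to M$ in $\mathcal{E}_n$ such that $f_i$ and $g_i$ are both injective; $[M]_{i,e}=[N]_{i,e}$ (same $i$-th epigeny class) means that there exist morphisms $f:M\to N$ and $g:N\to M$ in $\mathcal{E}_n$ such that $f_i$ and $g_i$ are both surjective. *)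

theory Defs
  imports "HOL-Algebra.AbelCoset" "HOL-Algebra.Module"
begin

text \<open>
  The library locale \<^locale>\<open>module\<close> is restricted to commutative rings, so right modules over an
  arbitrary ring are introduced here. They reuse the library record: \<open>a \<odot>\<^bsub>M\<^esub> x\<close> stands for
  the right action $x \cdot a$, whence the order of the factors in \<open>rsmult_assoc\<close>. The
  multiplicative fields inherited from the ring record play no role. The library notion
  \<^const>\<open>submodule\<close> does not mention commutativity and is used as it stands.
\<close>

locale right_module = R?: ring R + M?: abelian_group M
  for R :: "('a, 'x) ring_scheme" (structure) and M :: "('a, 'b, 'y) module_scheme" (structure) +
  assumes rsmult_closed:
      "\<lbrakk>a \<in> carrier R; x \<in> carrier M\<rbrakk> \<Longrightarrow> a \<odot>\<^bsub>M\<^esub> x \<in> carrier M"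
    and rsmult_distr_ring:
      "\<lbrakk>a \<in> carrier R; b \<in> carrier R; x \<in> carrier M\<rbrakk> \<Longrightarrow>
        (a \<oplus>\<^bsub>R\<^esub> b) \<odot>\<^bsub>M\<^esub> x = (a \<odot>\<^bsub>M\<^esub> x) \<oplus>\<^bsub>M\<^esub> (b \<odot>\<^bsub>M\<^esub> x)"
    and rsmult_distr_module:
      "\<lbrakk>a \<in> carrier R; x \<in> carrier M; y \<in> carrier M\<rbrakk> \<Longrightarrow>
        a \<odot>\<^bsub>M\<^esub> (x \<oplus>\<^bsub>M\<^esub> y) = (a \<odot>\<^bsub>M\<^esub> x) \<oplus>\<^bsub>M\<^esub> (a \<odot>\<^bsub>M\<^esub> y)"
    and rsmult_assoc:
      "\<lbrakk>a \<in> carrier R; b \<in> carrier R; x \<in> carrier M\<rbrakk> \<Longrightarrow>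
        (a \<otimes>\<^bsub>R\<^esub> b) \<odot>\<^bsub>M\<^esub> x = b \<odot>\<^bsub>M\<^esub> (a \<odot>\<^bsub>M\<^esub> x)"
    and rsmult_one:
      "x \<in> carrier M \<Longrightarrow> \<one>\<^bsub>R\<^esub> \<odot>\<^bsub>M\<^esub> x = x"

definition right_module_hom ::
  "('a, 'x) ring_scheme \<Rightarrow> ('a, 'b, 'y) module_scheme \<Rightarrow> ('a, 'c, 'z) module_scheme \<Rightarrow> ('b \<Rightarrow> 'c) set"
  where "right_module_hom R M N =
    {f \<in> hom (add_monoid M) (add_monoid N).
      \<forall>a\<in>carrier R. \<forall>x\<in>carrier M. f (a \<odot>\<^bsub>M\<^esub> x) = a \<odot>\<^bsub>N\<^esub> f x}"

definition uniserial :: "('a, 'x) ring_scheme \<Rightarrow> ('a, 'b, 'y) module_scheme \<Rightarrow> bool"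
  where "uniserial R M \<longleftrightarrow>
    (\<forall>A B. submodule A R M \<and> submodule B R M \<longrightarrow> A \<subseteq> B \<or> B \<subseteq> A)"

definition quotient_module :: "('a, 'b, 'y) module_scheme \<Rightarrow> 'b set \<Rightarrow> ('a, 'b set) module"
  where "quotient_module M K =
    \<lparr>carrier = a_rcosets\<^bsub>M\<^esub> K, mult = undefined, one = undefined, zero = K, add = set_add M,
     smult = (\<lambda>a C. \<Union>x\<in>C. K +>\<^bsub>M\<^esub> (a \<odot>\<^bsub>M\<^esub> x))\<rparr>"


text \<open>Objects of $\mathcal{E}_n$: only the values \<open>filt M 0, \<dots>, filt M n\<close> are relevant.\<close>

record ('a, 'b) filtered_module = "('a, 'b) module" +
  filt :: "nat \<Rightarrow> 'b set"

locale E_object = right_module R M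
  for R :: "('a, 'x) ring_scheme" (structure)
    and n :: nat
    and M :: "('a, 'b, 'y) filtered_module_scheme" (structure) +
  assumes filt_submodule: "i \<le> n \<Longrightarrow> submodule (filt M i) R M"
    and filt_mono: "i < n \<Longrightarrow> filt M i \<subseteq> filt M (Suc i)"
    and filt_0: "filt M 0 = {\<zero>\<^bsub>M\<^esub>}"
    and filt_n: "filt M n = carrier M"

definition E_hom ::
  "('a, 'x) ring_scheme \<Rightarrow> nat \<Rightarrow> ('a, 'b, 'y) filtered_module_scheme \<Rightarrow>
    ('a, 'c, 'z) filtered_module_scheme \<Rightarrow> ('b \<Rightarrow> 'c) set"
  where "E_hom R n M N = {f \<in> right_module_hom R M N. \<forall>i\<in>{1..n}. f ` filt M i \<subseteq> filt N i}"

definition E_iso ::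
  "('a, 'x) ring_scheme \<Rightarrow> nat \<Rightarrow> ('a, 'b, 'y) filtered_module_scheme \<Rightarrow>
    ('a, 'c, 'z) filtered_module_scheme \<Rightarrow> bool"
  where "E_iso R n M N \<longleftrightarrow>
    (\<exists>f\<in>E_hom R n M N. \<exists>g\<in>E_hom R n N M.
      (\<forall>x\<in>carrier M. g (f x) = x) \<and> (\<forall>y\<in>carrier N. f (g y) = y))"

text \<open>
  The direct sum of the finite family $M_1, \dots, M_r$, realised on the functions with domain
  $\{1, \dots, r\}$; for \<open>r = 0\<close> it is the zero object.
\<close>

definition E_dsum ::
  "nat \<Rightarrow> (nat \<Rightarrow> ('a, 'b, 'y) filtered_module_scheme) \<Rightarrow> ('a, nat \<Rightarrow> 'b) filtered_module"
  where "E_dsum r M =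
    \<lparr>carrier = (\<Pi>\<^sub>E k\<in>{1..r}. carrier (M k)), mult = undefined, one = undefined,
     zero = (\<lambda>k\<in>{1..r}. \<zero>\<^bsub>M k\<^esub>),
     add = (\<lambda>x y. \<lambda>k\<in>{1..r}. x k \<oplus>\<^bsub>M k\<^esub> y k),
     smult = (\<lambda>a x. \<lambda>k\<in>{1..r}. a \<odot>\<^bsub>M k\<^esub> x k),
     filt = (\<lambda>i. \<Pi>\<^sub>E k\<in>{1..r}. filt (M k) i)\<rparr>"

definition factor_module :: "('a, 'b, 'y) filtered_module_scheme \<Rightarrow> nat \<Rightarrow> ('a, 'b set) module"
  where "factor_module M i = quotient_module (M\<lparr>carrier := filt M i\<rparr>) (filt M (i - 1))"

text \<open>
  The induced map $f_i$, sending $x + M^{(i-1)}$ to $f(x) + N^{(i-1)}$: for a morphism \<open>f\<close>, all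
  members of the union coincide.
\<close>

definition induced_map ::
  "('a, 'c, 'z) filtered_module_scheme \<Rightarrow> nat \<Rightarrow> ('b \<Rightarrow> 'c) \<Rightarrow> 'b set \<Rightarrow> 'c set"
  where "induced_map N i f C = (\<Union>x\<in>C. filt N (i - 1) +>\<^bsub>N\<^esub> f x)"

definition factor_inj ::
  "('a, 'b, 'y) filtered_module_scheme \<Rightarrow> ('a, 'c, 'z) filtered_module_scheme \<Rightarrow> nat \<Rightarrow>
    ('b \<Rightarrow> 'c) \<Rightarrow> bool"
  where "factor_inj M N i f \<longleftrightarrow> inj_on (induced_map N i f) (carrier (factor_module M i))"

definition factor_surj ::
  "('a, 'b, 'y) filtered_module_scheme \<Rightarrow> ('a, 'c, 'z) filtered_module_scheme \<Rightarrow> nat \<Rightarrow>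
    ('b \<Rightarrow> 'c) \<Rightarrow> bool"
  where "factor_surj M N i f \<longleftrightarrow>
    induced_map N i f ` carrier (factor_module M i) = carrier (factor_module N i)"

definition same_monogeny_class ::
  "('a, 'x) ring_scheme \<Rightarrow> nat \<Rightarrow> nat \<Rightarrow> ('a, 'b, 'y) filtered_module_scheme \<Rightarrow>
    ('a, 'c, 'z) filtered_module_scheme \<Rightarrow> bool"
  where "same_monogeny_class R n i M N \<longleftrightarrow>
    (\<exists>f\<in>E_hom R n M N. \<exists>g\<in>E_hom R n N M. factor_inj M N i f \<and> factor_inj N M i g)"

definition same_epigeny_class ::
  "('a, 'x) ring_scheme \<Rightarrow> nat \<Rightarrow> nat \<Rightarrow> ('a, 'b, 'y) filtered_module_scheme \<Rightarrow>
    ('a, 'c, 'z) filtered_module_scheme \<Rightarrow> bool"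
  where "same_epigeny_class R n i M N \<longleftrightarrow>
    (\<exists>f\<in>E_hom R n M N. \<exists>g\<in>E_hom R n N M. factor_surj M N i f \<and> factor_surj N M i g)"

text \<open>The index sets $X_i$ (for $M_1, \dots, M_r$) and $Y_i$ (for $N_1, \dots, N_s$).\<close>

definition nonzero_factors ::
  "nat \<Rightarrow> (nat \<Rightarrow> ('a, 'b, 'y) filtered_module_scheme) \<Rightarrow> nat \<Rightarrow> nat set"
  where "nonzero_factors r M i =
    {k \<in> {1..r}. carrier (factor_module (M k) i) \<noteq> {\<zero>\<^bsub>factor_module (M k) i\<^esub>}}"

end

theory Submission
  imports Defs
begin

text \<open>
  Fix a layer $i$. For objects $A, B$ whose $i$-th factors are nonzero uniserial modules, the
  morphisms $f : A \to B$ with $f_i$ not injective are closed under addition, since two nonzero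
  submodules of a uniserial module meet; dually for $f_i$ not surjective. Moreover $g f$ induces an
  injective (surjective) map on the $i$-th factors if and only if both $f$ and $g$ do. So there are
  $2n$ \<^emph>\<open>completely prime\<close> ideals $P_{i,m}$ and $P_{i,e}$, an object counting as relevant for
  $P_{i,a}$ when its $i$-th factor is nonzero. By induction along the filtration, an endomorphism
  that lies outside all the relevant ideals is invertible. Two objects have the same class when
  there are morphisms in both directions outside the ideal.

  \<^bold>\<open>Isomorphism implies bijections.\<close> For a fixed ideal and a fixed class, let $A$ and $B$ index the
  members of the class among the $M_k$ and the $N_l$. The blocks of an isomorphism and of its
  inverse that belong to $B$ and $A$ compose to the identity matrix modulo $P$, since paths through
  other objects stay in $P$. For $P_{i,m}$ this yields $|A|$ independent nonzero submodules in a sum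
  of $|B|$ uniserial modules; for $P_{i,e}$ it yields the order dual. Both are excluded for
  $|A| > |B|$ by one exchange argument in modular lattices, \<open>card_coindependent_le\<close>.

  \<^bold>\<open>Bijections imply isomorphism.\<close> The ideals restricted to the endomorphism ring of one object may
  be comparable, and only the maximal ones can be avoided independently of each other; a maximal ideal
  that occurs several times is represented by its least index (\<open>principal\<close>). The decisive point is
  \<open>principal_sim\<close>: whether $P$ is principal on an object depends only on the $P$-class of
  the object. Indeed, endomorphisms of $A$ outside a maximal ideal are invertible modulo this ideal
  (\<open>divide\<close>), so
  that for $A$ and $B$ in one $P$-class some endomorphism of $B$ that factors through $A$ is
  congruent to the identity modulo $P$, hence modulo every larger ideal on $B$; therefore $A$ and $B$
  also share the class of the larger ideal, and maximality passes from $A$ to $B$.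
  By prime avoidance (\<open>separate\<close>) there is now a morphism from each summand to each summand on the
  other side that lies outside exactly those principal ideals whose bijections match the two. The
  sum $s$ of all these morphisms, in both directions, is an odd endomorphism of
  $M_1 \oplus \dots \oplus M_r \oplus N_1 \oplus \dots \oplus N_s$, and $s^2$ has invertible
  diagonal entries and radical off-diagonal entries. So $s^2$ is a unit (\<open>unit_of_components\<close>), hence
  so is $s$, and $s$ exchanges the two halves.

  The whole argument takes place in the endomorphism ring of that one object, with the orthogonal
  idempotents of the $r + s$ summands.
\<close>

section \<open>Counting in a modular lattice\<close>

text \<open>
  A modular lattice with greatest element on a carrier set. The order is a parameter, so that the
  order dual of a lattice is an instance of the same locale.
\<close>

locale modular_lattice_on =
  fixes L :: "'l set"
    and le :: "'l \<Rightarrow> 'l \<Rightarrow> bool" (infix "\<preceq>" 50)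
    and meet :: "'l \<Rightarrow> 'l \<Rightarrow> 'l" (infixl "\<triangle>" 70)
    and join :: "'l \<Rightarrow> 'l \<Rightarrow> 'l" (infixl "\<nabla>" 65)
    and top :: 'l
  assumes le_refl: "a \<in> L \<Longrightarrow> a \<preceq> a"
    and le_trans: "\<lbrakk>a \<in> L; b \<in> L; c \<in> L; a \<preceq> b; b \<preceq> c\<rbrakk> \<Longrightarrow> a \<preceq> c"
    and le_antisym: "\<lbrakk>a \<in> L; b \<in> L; a \<preceq> b; b \<preceq> a\<rbrakk> \<Longrightarrow> a = b"
    and meet_closed: "\<lbrakk>a \<in> L; b \<in> L\<rbrakk> \<Longrightarrow> a \<triangle> b \<in> L"
    and join_closed: "\<lbrakk>a \<in> L; b \<in> L\<rbrakk> \<Longrightarrow> a \<nabla> b \<in> L"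
    and meet_le1: "\<lbrakk>a \<in> L; b \<in> L\<rbrakk> \<Longrightarrow> a \<triangle> b \<preceq> a"
    and meet_le2: "\<lbrakk>a \<in> L; b \<in> L\<rbrakk> \<Longrightarrow> a \<triangle> b \<preceq> b"
    and meet_greatest: "\<lbrakk>a \<in> L; b \<in> L; c \<in> L; c \<preceq> a; c \<preceq> b\<rbrakk> \<Longrightarrow> c \<preceq> a \<triangle> b"
    and join_ge1: "\<lbrakk>a \<in> L; b \<in> L\<rbrakk> \<Longrightarrow> a \<preceq> a \<nabla> b"
    and join_ge2: "\<lbrakk>a \<in> L; b \<in> L\<rbrakk> \<Longrightarrow> b \<preceq> a \<nabla> b"
    and join_least: "\<lbrakk>a \<in> L; b \<in> L; c \<in> L; a \<preceq> c; b \<preceq> c\<rbrakk> \<Longrightarrow> a \<nabla> b \<preceq> c"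
    and modular: "\<lbrakk>a \<in> L; b \<in> L; c \<in> L; a \<preceq> c\<rbrakk> \<Longrightarrow> (a \<nabla> b) \<triangle> c \<preceq> a \<nabla> (b \<triangle> c)"
    and top_closed: "top \<in> L"
    and top_ge: "a \<in> L \<Longrightarrow> a \<preceq> top"
begin

lemma top_leD: "\<lbrakk>a \<in> L; top \<preceq> a\<rbrakk> \<Longrightarrow> a = top"
  using le_antisym top_closed top_ge by blast

lemma le_joinI1: "\<lbrakk>a \<in> L; b \<in> L; c \<in> L; c \<preceq> a\<rbrakk> \<Longrightarrow> c \<preceq> a \<nabla> b"
  using le_trans[of c a "a \<nabla> b"] join_closed join_ge1 by blast

lemma le_joinI2: "\<lbrakk>a \<in> L; b \<in> L; c \<in> L; c \<preceq> b\<rbrakk> \<Longrightarrow> c \<preceq> a \<nabla> b"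
  using le_trans[of c b "a \<nabla> b"] join_closed join_ge2 by blast

lemma meet_leI1: "\<lbrakk>a \<in> L; b \<in> L; c \<in> L; a \<preceq> c\<rbrakk> \<Longrightarrow> a \<triangle> b \<preceq> c"
  using le_trans[of "a \<triangle> b" a c] meet_closed meet_le1 by blast

lemmas lattice_simps = le_refl join_closed meet_closed le_joinI1 le_joinI2 join_least meet_leI1
  meet_greatest meet_le1 meet_le2 join_ge1 join_ge2 top_closed top_ge

text \<open>
  For the lattice of submodules: if a module is generated by \<open>z\<close> and the submodules \<open>v l\<close>, whose
  submodules form chains, then there are at most \<open>card B\<close> coindependent proper submodules
  above \<open>z\<close>. In the dual lattice this bounds the number of independent nonzero submodules. The proof
  removes one \<open>v m\<close> at a time, at the cost of at most one \<open>N p\<close>.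
\<close>

theorem card_coindependent_le:
  assumes "finite B" "finite A"
    and N: "\<And>k. k \<in> A \<Longrightarrow> N k \<in> L" and proper: "\<And>k. k \<in> A \<Longrightarrow> N k \<noteq> top"
    and coind: "\<And>k. k \<in> A \<Longrightarrow> \<exists>c\<in>L. (\<forall>j\<in>A - {k}. c \<preceq> N j) \<and> N k \<nabla> c = top"
    and v: "\<And>l. l \<in> B \<Longrightarrow> v l \<in> L"
    and chain: "\<And>l a b. \<lbrakk>l \<in> B; a \<in> L; b \<in> L; a \<preceq> v l; b \<preceq> v l\<rbrakk> \<Longrightarrow> a \<preceq> b \<or> b \<preceq> a"
    and z: "z \<in> L" "\<And>k. k \<in> A \<Longrightarrow> z \<preceq> N k"
    and cover: "\<And>x. \<lbrakk>x \<in> L; z \<preceq> x; \<And>l. l \<in> B \<Longrightarrow> v l \<preceq> x\<rbrakk> \<Longrightarrow> x = top"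
  shows "card A \<le> card B"
  using assms
proof (induction B arbitrary: A N z rule: finite_induct)
  case empty
  have "A = {}"
  proof (rule ccontr)
    assume "A \<noteq> {}"
    then obtain k where k: "k \<in> A" by blast
    show False using empty.prems(3)[OF k] empty.prems(2)[OF k] empty.prems(8)[OF k] empty.prems(9)[of "N k"] by auto
  qed
  then show ?case by simp
next
  case (insert m B A N z)
  note finA = insert.prems(1) and NL = insert.prems(2) and prp = insert.prems(3)
    and ci = insert.prems(4) and vL = insert.prems(5) and ch = insert.prems(6)
    and zL = insert.prems(7) and zN = insert.prems(8) and cov = insert.prems(9)
  have vm: "v m \<in> L" using vL by simp
  have cov': "x = top" if "x \<in> L" "z \<nabla> v m \<preceq> x" "\<And>l. l \<in> B \<Longrightarrow> v l \<preceq> x" for x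
  proof (rule cov[OF that(1)])
    show "z \<preceq> x"
      using le_trans[OF zL _ that(1) _ that(2)] zL vm join_closed join_ge1 by blast
    have "v m \<preceq> x"
      using le_trans[OF vm _ that(1) _ that(2)] zL vm join_closed join_ge2 by blast
    then show "\<And>l. l \<in> insert m B \<Longrightarrow> v l \<preceq> x" using that by blast
  qed
  show ?case
  proof (cases "\<forall>k\<in>A. N k \<nabla> v m \<noteq> top")
    case True
    have "card A \<le> card B"
    proof (rule insert.IH[where N = "\<lambda>k. N k \<nabla> v m"])
      show "\<exists>c\<in>L. (\<forall>j\<in>A - {k}. c \<preceq> N j \<nabla> v m) \<and> N k \<nabla> v m \<nabla> c = top" if k: "k \<in> A" for k
      proof -
        obtain c where c: "c \<in> L" "\<forall>j\<in>A - {k}. c \<preceq> N j" "N k \<nabla> c = top" using ci[OF k] by blast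
        have 1: "c \<preceq> N j \<nabla> v m" if "j \<in> A - {k}" for j
          using that c(1,2) NL[of j] vm by (intro le_joinI1) auto
        have "N k \<nabla> c \<preceq> N k \<nabla> v m \<nabla> c"
          using k c(1) NL vm by (simp add: lattice_simps)
        then have "N k \<nabla> v m \<nabla> c = top"
          using top_leD[of "N k \<nabla> v m \<nabla> c"] c(1,3) NL[OF k] vm join_closed by simp
        then show ?thesis using 1 c by blast
      qed
      show "z \<nabla> v m \<in> L" using zL vm join_closed by blast
      show "z \<nabla> v m \<preceq> N k \<nabla> v m" if "k \<in> A" for k
        using zN[OF that] NL[OF that] zL vm by (simp add: lattice_simps)
      show "x = top" if "x \<in> L" "z \<nabla> v m \<preceq> x" "\<And>l. l \<in> B \<Longrightarrow> v l \<preceq> x" for x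
        by (rule cov') (use that in auto)
      show "a \<preceq> b \<or> b \<preceq> a" if "l \<in> B" "a \<in> L" "b \<in> L" "a \<preceq> v l" "b \<preceq> v l" for l a b
        using ch[of l a b] that by blast
    qed (use True finA NL vm vL in \<open>auto intro: join_closed\<close>)
    then show ?thesis using insert.hyps by simp
  next
    case False
    then obtain p where p: "p \<in> A" "N p \<nabla> v m = top" by blast
    have Np: "N p \<in> L" using NL p by blast
    \<comment> \<open>The quotient by \<open>?N k\<close> is the cokernel of \<open>v m\<close> in the sum of the quotients by \<open>N k\<close> and \<open>N p\<close>.\<close>
    let ?N = "\<lambda>k. (N k \<triangle> N p) \<nabla> v m"
    have cl: "?N k \<in> L" "N k \<triangle> N p \<in> L" if "k \<in> A" for k
      using that NL Np vm by (auto intro: join_closed meet_closed)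
    have "card (A - {p}) \<le> card B"
    proof (rule insert.IH[where N = ?N])
      show "?N k \<noteq> top" if kA: "k \<in> A - {p}" for k
      proof
        assume t: "?N k = top"
        have k: "k \<in> A" and Nk: "N k \<in> L" using kA NL by auto
        let ?w = "v m \<triangle> N p"
        have wL: "?w \<in> L" using vm Np meet_closed by blast
        have "N p \<preceq> top \<triangle> N p" using Np by (simp add: le_refl meet_greatest top_closed top_ge)
        also have "top \<triangle> N p = ((N k \<triangle> N p) \<nabla> v m) \<triangle> N p" using t by simp
        finally have "N p \<preceq> ((N k \<triangle> N p) \<nabla> v m) \<triangle> N p" .
        moreover have "((N k \<triangle> N p) \<nabla> v m) \<triangle> N p \<preceq> (N k \<triangle> N p) \<nabla> ?w"
          using modular[of "N k \<triangle> N p" "v m" "N p"] cl(2)[OF k] vm Np Nk meet_le2 by blast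
        ultimately have Np_le: "N p \<preceq> (N k \<triangle> N p) \<nabla> ?w"
          using Np cl[OF k] wL by (meson meet_closed join_closed le_trans)
        have "(N k \<triangle> N p) \<nabla> ?w \<preceq> N k \<nabla> ?w"
          using Nk Np wL by (simp add: lattice_simps)
        then have Np_le': "N p \<preceq> N k \<nabla> ?w"
          using le_trans[OF Np _ _ Np_le] Nk wL cl(2)[OF k] join_closed by blast
        obtain c where c: "c \<in> L" "\<forall>j\<in>A - {k}. c \<preceq> N j" "N k \<nabla> c = top" using ci[OF k] by blast
        have "c \<preceq> N p" using c p kA by auto
        then have "c \<preceq> N k \<nabla> ?w" using le_trans[OF c(1) Np _ _ Np_le'] Nk wL join_closed by blast
        then have "N k \<nabla> c \<preceq> N k \<nabla> ?w"
          using join_least[of "N k" c "N k \<nabla> ?w"] c(1) Nk wL join_closed join_ge1 by blast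
        then have kw: "N k \<nabla> ?w = top"
          using top_leD[of "N k \<nabla> ?w"] c(3) Nk wL join_closed by simp
        let ?u = "v m \<triangle> N k"
        have uL: "?u \<in> L" using vm Nk meet_closed by blast
        from ch[of m ?w ?u] have "?w \<preceq> ?u \<or> ?u \<preceq> ?w"
          using wL uL vm Np Nk meet_le1 by blast
        then show False
        proof
          assume "?w \<preceq> ?u"
          then have "?w \<preceq> N k" using le_trans[OF wL uL Nk] vm Nk meet_le2 by blast
          then have "N k \<nabla> ?w \<preceq> N k" using Nk wL by (simp add: join_least le_refl)
          then show False using kw prp[OF k] Nk top_leD by simp
        next
          assume uw: "?u \<preceq> ?w"
          have "v m \<preceq> (?w \<nabla> N k) \<triangle> v m"
          proof -
            have "N k \<nabla> ?w \<preceq> ?w \<nabla> N k"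
              using Nk wL by (simp add: join_closed join_ge1 join_ge2 join_least)
            then have "?w \<nabla> N k = top" 
              using top_leD[of "?w \<nabla> N k"] kw Nk wL join_closed by simp
            then show ?thesis using vm by (simp add: le_refl meet_greatest top_closed top_ge)
          qed
          moreover have "(?w \<nabla> N k) \<triangle> v m \<preceq> ?w \<nabla> (N k \<triangle> v m)"
            using modular[of ?w "N k" "v m"] wL Nk vm meet_le1 Np by blast
          moreover have "?w \<nabla> (N k \<triangle> v m) \<preceq> ?w"
          proof -
            have "N k \<triangle> v m \<preceq> ?u"
              using Nk vm by (simp add: meet_closed meet_greatest meet_le1 meet_le2)
            then have "N k \<triangle> v m \<preceq> ?w" using le_trans[OF _ uL wL _ uw] Nk vm meet_closed by blast
            then show ?thesis using wL Nk vm by (simp add: join_least le_refl meet_closed)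
          qed
          ultimately have "v m \<preceq> ?w"
            using le_trans[OF vm, of "(?w \<nabla> N k) \<triangle> v m" "?w \<nabla> (N k \<triangle> v m)"]
              le_trans[OF vm, of "?w \<nabla> (N k \<triangle> v m)" ?w] wL Nk vm join_closed meet_closed by blast
          then have "v m \<preceq> N p" using le_trans[OF vm wL Np] vm Np meet_le2 by blast
          then have "N p \<nabla> v m \<preceq> N p" using Np vm by (simp add: join_least le_refl)
          then show False using p prp[of p] Np top_leD by simp
        qed
      qed
      show "\<exists>c\<in>L. (\<forall>j\<in>A - {p} - {k}. c \<preceq> ?N j) \<and> ?N k \<nabla> c = top" if kA: "k \<in> A - {p}" for k
      proof -
        have k: "k \<in> A" and Nk: "N k \<in> L" using kA NL by auto
        obtain c where c: "c \<in> L" "\<forall>j\<in>A - {k}. c \<preceq> N j" "N k \<nabla> c = top" using ci[OF k] by blast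
        have cp: "c \<preceq> N p" using c p kA by auto
        have 1: "c \<preceq> ?N j" if "j \<in> A - {p} - {k}" for j
        proof -
          have j: "j \<in> A" and "c \<preceq> N j" using that c by auto
          then have "c \<preceq> N j \<triangle> N p" using cp c NL Np by (simp add: meet_greatest)
          then show ?thesis using c(1) cl[OF j] vm by (simp add: lattice_simps)
        qed
        let ?z = "?N k \<nabla> c"
        have zL: "?z \<in> L" using c cl[OF k] by (simp add: join_closed)
        have "(c \<nabla> N k) \<triangle> N p \<preceq> c \<nabla> (N k \<triangle> N p)"
          using modular c Nk Np cp by blast
        moreover have "c \<nabla> N k = top"
        proof -
          have "N k \<nabla> c \<preceq> c \<nabla> N k" using Nk c(1) by (simp add: join_closed join_ge1 join_ge2 join_least)
          then show ?thesis using top_leD[of "c \<nabla> N k"] c(1,3) Nk join_closed by simp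
        qed
        ultimately have "top \<triangle> N p \<preceq> c \<nabla> (N k \<triangle> N p)" by simp
        moreover have "N p \<preceq> top \<triangle> N p" using Np by (simp add: le_refl meet_greatest top_closed top_ge)
        moreover have "c \<nabla> (N k \<triangle> N p) \<preceq> ?z"
        proof (rule join_least)
          show "c \<preceq> ?z" using c cl[OF k] by (simp add: join_ge2)
          show "N k \<triangle> N p \<preceq> ?z" using c(1) cl[OF k] vm zL by (simp add: lattice_simps)
        qed (use c cl[OF k] zL in auto)
        ultimately have pz: "N p \<preceq> ?z"
          using le_trans[OF Np, of "top \<triangle> N p" "c \<nabla> (N k \<triangle> N p)"]
            le_trans[OF Np, of "c \<nabla> (N k \<triangle> N p)" ?z] Np c(1) cl(2)[OF k] zL top_closed
            join_closed meet_closed by blast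
        have vz: "v m \<preceq> ?z" using c(1) cl[OF k] vm by (simp add: lattice_simps)
        have "N p \<nabla> v m \<preceq> ?z" using pz vz Np vm zL by (simp add: join_least)
        then have "?z = top" using p zL top_leD by simp
        then show ?thesis using 1 c by blast
      qed
      show "z \<nabla> v m \<in> L" using zL vm join_closed by blast
      show "z \<nabla> v m \<preceq> ?N k" if "k \<in> A - {p}" for k
      proof -
        have k: "k \<in> A" and Nk: "N k \<in> L" using that NL by auto
        have "z \<preceq> N k \<triangle> N p" using zN k p Nk Np zL by (simp add: meet_greatest)
        then show ?thesis
          using zL vm cl[OF k] by (simp add: lattice_simps)
      qed
      show "x = top" if "x \<in> L" "z \<nabla> v m \<preceq> x" "\<And>l. l \<in> B \<Longrightarrow> v l \<preceq> x" for x
        by (rule cov') (use that in auto)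
      show "a \<preceq> b \<or> b \<preceq> a" if "l \<in> B" "a \<in> L" "b \<in> L" "a \<preceq> v l" "b \<preceq> v l" for l a b
        using ch[of l a b] that by blast
    qed (use finA vL cl in auto)
    then show ?thesis using insert.hyps p finA
      by (metis (no_types, lifting) Suc_le_mono card.insert card_Suc_Diff1)
  qed
qed

end

section \<open>Systems of completely prime ideals\<close>

text \<open>
  A ring \<open>E\<close> with a finite complete family of orthogonal idempotents \<open>e x\<close> is viewed as a category:
  the morphisms from \<open>x\<close> to \<open>y\<close> are the elements of $e_y E e_x$. For each index \<open>j\<close> there is a
  completely prime ideal $P_j$, given by its complement: \<open>nz j x y h\<close> says that the morphism \<open>h\<close> from
  \<open>x\<close> to \<open>y\<close> is not in $P_j$. An ideal may contain the identity \<open>e x\<close>; it is then irrelevant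
  for \<open>x\<close>. The order of the indices serves only to choose representatives.
\<close>

locale prime_system = ring E for E :: "('e, 'x) ring_scheme" (structure) +
  fixes I :: "'i set" and e :: "'i \<Rightarrow> 'e"
    and J :: "'j::linorder set" and nz :: "'j \<Rightarrow> 'i \<Rightarrow> 'i \<Rightarrow> 'e \<Rightarrow> bool"
  assumes fin_I: "finite I" and fin_J: "finite J"
    and e_closed: "x \<in> I \<Longrightarrow> e x \<in> carrier E"
    and e_idem: "x \<in> I \<Longrightarrow> e x \<otimes> e x = e x"
    and e_orth: "\<lbrakk>x \<in> I; y \<in> I; x \<noteq> y\<rbrakk> \<Longrightarrow> e x \<otimes> e y = \<zero>"
    and e_sum: "(\<Oplus>x\<in>I. e x) = \<one>"
    and nz_zero: "\<lbrakk>j \<in> J; x \<in> I; y \<in> I\<rbrakk> \<Longrightarrow> \<not> nz j x y \<zero>"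
    and nz_addD: "\<lbrakk>j \<in> J; x \<in> I; y \<in> I;
      a \<in> carrier E; a \<otimes> e x = a; e y \<otimes> a = a; b \<in> carrier E; b \<otimes> e x = b; e y \<otimes> b = b;
      nz j x y (a \<oplus> b)\<rbrakk> \<Longrightarrow> nz j x y a \<or> nz j x y b"
    and nz_mult: "\<lbrakk>j \<in> J; x \<in> I; y \<in> I; z \<in> I;
      a \<in> carrier E; a \<otimes> e y = a; e z \<otimes> a = a; b \<in> carrier E; b \<otimes> e x = b; e y \<otimes> b = b\<rbrakk>
      \<Longrightarrow> nz j x z (a \<otimes> b) \<longleftrightarrow> nz j y z a \<and> nz j x y b"
    and corner_unit: "\<lbrakk>x \<in> I; h \<in> carrier E; h \<otimes> e x = h; e x \<otimes> h = h;
      \<And>j. j \<in> J \<Longrightarrow> nz j x x (e x) \<Longrightarrow> nz j x x h\<rbrakk>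
      \<Longrightarrow> \<exists>q\<in>carrier E. q \<otimes> e x = q \<and> e x \<otimes> q = q \<and> h \<otimes> q = e x \<and> q \<otimes> h = e x"
begin

text \<open>The morphisms from \<open>x\<close> to \<open>y\<close>.\<close>

definition hm :: "'i \<Rightarrow> 'i \<Rightarrow> 'e set"
  where "hm x y = {h \<in> carrier E. h \<otimes> e x = h \<and> e y \<otimes> h = h}"

text \<open>The ideal with index \<open>j\<close> is relevant for \<open>x\<close>.\<close>

definition rel :: "'j \<Rightarrow> 'i \<Rightarrow> bool"
  where "rel j x \<longleftrightarrow> j \<in> J \<and> nz j x x (e x)"

text \<open>The objects \<open>x\<close> and \<open>y\<close> have the same class with respect to $P_j$.\<close>

definition sim :: "'j \<Rightarrow> 'i \<Rightarrow> 'i \<Rightarrow> bool"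
  where "sim j x y \<longleftrightarrow> (\<exists>f\<in>hm x y. \<exists>g\<in>hm y x. nz j x y f \<and> nz j y x g)"

text \<open>On the endomorphism ring of \<open>x\<close>, the ideal $P_j$ is contained in $P_k$.\<close>

definition below :: "'i \<Rightarrow> 'j \<Rightarrow> 'j \<Rightarrow> bool"
  where "below x j k \<longleftrightarrow> (\<forall>h\<in>hm x x. nz k x x h \<longrightarrow> nz j x x h)"

text \<open>
  The ideal $P_j$ is maximal among the relevant ideals on the endomorphism ring of \<open>x\<close>, and \<open>j\<close> is
  the least index that defines this ideal.
\<close>

definition principal :: "'j \<Rightarrow> 'i \<Rightarrow> bool"
  where "principal j x \<longleftrightarrow> rel j x \<and> (\<forall>k. rel k x \<and> below x j k \<longrightarrow> below x k j \<and> j \<le> k)"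

lemma hmD: "h \<in> hm x y \<Longrightarrow> h \<in> carrier E" "h \<in> hm x y \<Longrightarrow> h \<otimes> e x = h" "h \<in> hm x y \<Longrightarrow> e y \<otimes> h = h"
  by (auto simp: hm_def)

lemma hm_e: "x \<in> I \<Longrightarrow> e x \<in> hm x x"
  by (simp add: hm_def e_closed e_idem)

lemma hm_zero: "\<lbrakk>x \<in> I; y \<in> I\<rbrakk> \<Longrightarrow> \<zero> \<in> hm x y"
  by (simp add: hm_def e_closed)

lemma hm_add: "\<lbrakk>x \<in> I; y \<in> I; a \<in> hm x y; b \<in> hm x y\<rbrakk> \<Longrightarrow> a \<oplus> b \<in> hm x y"
  by (simp add: hm_def e_closed l_distr r_distr)

lemma hm_minus: "\<lbrakk>x \<in> I; y \<in> I; a \<in> hm x y\<rbrakk> \<Longrightarrow> \<ominus> a \<in> hm x y"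
  by (simp add: hm_def e_closed l_minus r_minus)

lemma hm_mult: "\<lbrakk>x \<in> I; y \<in> I; z \<in> I; a \<in> hm y z; b \<in> hm x y\<rbrakk> \<Longrightarrow> a \<otimes> b \<in> hm x z"
  by (simp add: hm_def e_closed m_assoc) (simp add: m_assoc[symmetric] e_closed)

lemma hm_comp: "\<lbrakk>x \<in> I; y \<in> I; h \<in> carrier E\<rbrakk> \<Longrightarrow> e y \<otimes> h \<otimes> e x \<in> hm x y"
  by (simp add: hm_def e_closed m_assoc e_idem) (simp add: m_assoc[symmetric] e_closed e_idem)

lemma hm_finsum:
  assumes "finite A" "x \<in> I" "y \<in> I" "\<And>a. a \<in> A \<Longrightarrow> f a \<in> hm x y"
  shows "(\<Oplus>a\<in>A. f a) \<in> hm x y"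
  using assms
proof (induction A rule: finite_induct)
  case empty then show ?case by (simp add: hm_zero)
next
  case (insert a A)
  then have "(\<Oplus>a\<in>insert a A. f a) = f a \<oplus> (\<Oplus>a\<in>A. f a)"
    using hmD(1) by (intro finsum_insert) blast+
  then show ?case using insert by (simp add: hm_add)
qed

lemma hm_orth:
  assumes "x \<in> I" "y \<in> I" "z \<in> I" "w \<in> I" "a \<in> hm z w" "b \<in> hm x y" "y \<noteq> z"
  shows "a \<otimes> b = \<zero>"
proof -
  have "a \<otimes> b = (a \<otimes> e z) \<otimes> (e y \<otimes> b)" using assms by (simp add: hmD)
  also have "\<dots> = a \<otimes> ((e z \<otimes> e y) \<otimes> b)" using assms hmD(1) by (simp add: m_assoc e_closed)
  finally show ?thesis using assms hmD(1) by (simp add: e_orth)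
qed

lemma nz_add: "\<lbrakk>j \<in> J; x \<in> I; y \<in> I; a \<in> hm x y; b \<in> hm x y; \<not> nz j x y a; \<not> nz j x y b\<rbrakk>
  \<Longrightarrow> \<not> nz j x y (a \<oplus> b)"
  using nz_addD[of j x y a b] by (auto simp: hm_def)

lemma nz_comp: "\<lbrakk>j \<in> J; x \<in> I; y \<in> I; z \<in> I; a \<in> hm y z; b \<in> hm x y\<rbrakk>
  \<Longrightarrow> nz j x z (a \<otimes> b) \<longleftrightarrow> nz j y z a \<and> nz j x y b"
  using nz_mult[of j x y z a b] by (simp add: hm_def)

lemma nz_rel: assumes "j \<in> J" "x \<in> I" "y \<in> I" "a \<in> hm x y" "nz j x y a" shows "rel j x" "rel j y"
proof -
  show "rel j x" using nz_comp[of j x x y a "e x"] assms hm_e by (auto simp: rel_def hmD)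
  show "rel j y" using nz_comp[of j x y y "e y" a] assms hm_e by (auto simp: rel_def hmD)
qed

lemma nz_minus: assumes "j \<in> J" "x \<in> I" "y \<in> I" "a \<in> hm x y"
  shows "nz j x y (\<ominus> a) \<longleftrightarrow> nz j x y a"
proof -
  have 1: "nz j x y b" if "b \<in> hm x y" "nz j x y (\<ominus> b)" for b
  proof -
    have "\<ominus> b = (\<ominus> (e y)) \<otimes> b" using that assms by (simp add: l_minus e_closed hmD)
    then show ?thesis using that nz_comp[of j x y y "\<ominus> (e y)" b] assms hm_e hm_minus by auto
  qed
  show ?thesis using 1[of a] 1[of "\<ominus> a"] assms hm_minus hmD(1) by (auto simp: minus_minus)
qed

lemma nz_diff: "\<lbrakk>j \<in> J; x \<in> I; y \<in> I; a \<in> hm x y; b \<in> hm x y; \<not> nz j x y (a \<ominus> b)\<rbrakk>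
  \<Longrightarrow> nz j x y a \<longleftrightarrow> nz j x y b"
proof -
  assume a: "j \<in> J" "x \<in> I" "y \<in> I" "a \<in> hm x y" "b \<in> hm x y" "\<not> nz j x y (a \<ominus> b)"
  have d: "a \<ominus> b \<in> hm x y" using a by (simp add: minus_eq hm_add hm_minus)
  have E: "a \<in> carrier E" "b \<in> carrier E" using a hmD by auto
  have 1: "a = (a \<ominus> b) \<oplus> b" using E by algebra
  have 2: "b = (\<ominus> (a \<ominus> b)) \<oplus> a" using E by algebra
  show ?thesis
    using nz_add[OF a(1-3) d a(5)] nz_add[OF a(1-3) hm_minus[OF a(2,3) d] a(4)] a nz_minus[OF a(1-3) d] 1 2
    by auto
qed

lemma nz_finsum_not:
  assumes "finite A" "j \<in> J" "x \<in> I" "y \<in> I" "\<And>a. a \<in> A \<Longrightarrow> f a \<in> hm x y \<and> \<not> nz j x y (f a)"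
  shows "\<not> nz j x y (\<Oplus>a\<in>A. f a)"
  using assms
proof (induction A rule: finite_induct)
  case empty then show ?case by (simp add: nz_zero)
next
  case (insert a A)
  then have "(\<Oplus>a\<in>insert a A. f a) = f a \<oplus> (\<Oplus>a\<in>A. f a)"
    using hmD(1) by (intro finsum_insert) blast+
  then show ?case using insert by (simp add: nz_add hm_finsum)
qed

lemma nz_finsum_one:
  assumes "finite A" "j \<in> J" "x \<in> I" "y \<in> I" "\<And>a. a \<in> A \<Longrightarrow> f a \<in> hm x y" "p \<in> A"
    "\<And>a. a \<in> A - {p} \<Longrightarrow> \<not> nz j x y (f a)" "nz j x y (f p)"
  shows "nz j x y (\<Oplus>a\<in>A. f a)"
proof -
  let ?s = "\<Oplus>a\<in>A - {p}. f a"
  have fE: "\<And>a. a \<in> A \<Longrightarrow> f a \<in> carrier E" using assms hmD(1) by blast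
  have "(\<Oplus>a\<in>insert p (A - {p}). f a) = f p \<oplus> ?s"
    using assms fE by (intro finsum_insert) auto
  then have s: "(\<Oplus>a\<in>A. f a) = f p \<oplus> ?s" using assms by (simp add: insert_absorb)
  have sh: "?s \<in> hm x y" using assms by (intro hm_finsum) auto
  have "\<not> nz j x y ?s" using assms by (intro nz_finsum_not) auto
  moreover have "f p \<oplus> ?s \<ominus> f p = ?s"
  proof -
    have "f p \<in> carrier E" "?s \<in> carrier E" using fE assms(6) hmD(1)[OF sh] by auto
    then show ?thesis by algebra
  qed
  ultimately show ?thesis
    using nz_diff[of j x y "f p \<oplus> ?s" "f p"] assms sh s by (simp add: hm_add)
qed

lemma sim_sym: "sim j x y \<Longrightarrow> sim j y x" by (auto simp: sim_def)

lemma sim_rel: "\<lbrakk>j \<in> J; x \<in> I; y \<in> I; sim j x y\<rbrakk> \<Longrightarrow> rel j x \<and> rel j y"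
  using nz_rel by (fastforce simp: sim_def)

lemma sim_trans: assumes "j \<in> J" "x \<in> I" "y \<in> I" "z \<in> I" "sim j x y" "sim j y z" shows "sim j x z"
proof -
  obtain f g where 1: "f \<in> hm x y" "g \<in> hm y x" "nz j x y f" "nz j y x g" using assms by (auto simp: sim_def)
  obtain f' g' where 2: "f' \<in> hm y z" "g' \<in> hm z y" "nz j y z f'" "nz j z y g'" using assms by (auto simp: sim_def)
  have "f' \<otimes> f \<in> hm x z" "g \<otimes> g' \<in> hm z x" "nz j x z (f' \<otimes> f)" "nz j z x (g \<otimes> g')"
    using 1 2 assms by (auto simp: hm_mult nz_comp)
  then show ?thesis by (auto simp: sim_def)
qed

lemma sim_refl: "\<lbrakk>x \<in> I; rel j x\<rbrakk> \<Longrightarrow> sim j x x"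
  using hm_e by (auto simp: sim_def rel_def)

lemma unit_factor_square:
  assumes s: "s \<in> carrier E" and u: "s \<otimes> s \<in> Units E" shows "s \<in> Units E"
proof -
  let ?i = "inv (s \<otimes> s)"
  have i: "?i \<in> carrier E" using u by simp
  have r: "s \<otimes> (s \<otimes> ?i) = \<one>" using s i u by (simp add: m_assoc[symmetric])
  have l: "(?i \<otimes> s) \<otimes> s = \<one>" using s i u by (simp add: m_assoc)
  have "?i \<otimes> s = ?i \<otimes> s \<otimes> (s \<otimes> (s \<otimes> ?i))" using r s i by simp
  also have "\<dots> = ((?i \<otimes> s) \<otimes> s) \<otimes> (s \<otimes> ?i)" using s i by (simp add: m_assoc)
  also have "\<dots> = s \<otimes> ?i" using l s i by simp
  finally show ?thesis using l r s i by (auto simp: Units_def intro!: bexI[of _ "s \<otimes> ?i"])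
qed

lemma below_trans: "\<lbrakk>below x i j; below x j k\<rbrakk> \<Longrightarrow> below x i k" by (auto simp: below_def)

lemma principal_above:
  assumes "x \<in> I" "rel j x"
  shows "\<exists>k. principal k x \<and> below x j k"
proof -
  let ?S = "\<lambda>j. {k. rel k x \<and> below x j k}"
  have fin: "finite (?S k)" for k using fin_J by (rule finite_subset[rotated]) (auto simp: rel_def)
  have "rel j x \<Longrightarrow> \<exists>k. principal k x \<and> below x j k" for j
  proof (induction "card (?S j)" arbitrary: j rule: less_induct)
    case less
    show ?case
    proof (cases "\<forall>k\<in>?S j. below x k j")
      case True
      let ?k = "Min (?S j)"
      have ne: "?S j \<noteq> {}" using less.prems by (auto simp: below_def)
      then have k: "?k \<in> ?S j" using fin Min_in by blast
      have "principal ?k x"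
        unfolding principal_def
      proof (intro conjI allI impI)
        show "rel ?k x" using k by auto
        fix l assume l: "rel l x \<and> below x ?k l"
        then have lS: "l \<in> ?S j" using k below_trans by blast
        then have "below x l j" using True by blast
        then show "below x l ?k" using k below_trans by blast
        show "?k \<le> l" using lS fin by (simp add: Min_le)
      qed
      then show ?thesis using k by blast
    next
      case False
      then obtain k where k: "rel k x" "below x j k" "\<not> below x k j" by blast
      have "?S k \<subset> ?S j"
      proof
        show "?S k \<subseteq> ?S j" using k below_trans by blast
        have "j \<in> ?S j" "j \<notin> ?S k" using k less.prems by (auto simp: below_def)
        then show "?S k \<noteq> ?S j" by blast
      qed
      then have "card (?S k) < card (?S j)" using fin psubset_card_mono by blast
      then show ?thesis using less.hyps[of k] k below_trans by blast
    qed
  qed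
  then show ?thesis using assms by blast
qed

lemma principalD: "principal j x \<Longrightarrow> rel j x" "principal j x \<Longrightarrow> j \<in> J" "principal j x \<Longrightarrow> nz j x x (e x)"
  by (auto simp: principal_def rel_def)

lemma principal_incomparable: "\<lbrakk>principal j x; principal k x; below x j k\<rbrakk> \<Longrightarrow> j = k"
  by (meson antisym principal_def)

lemma corner_unit_principal:
  assumes "x \<in> I" "h \<in> hm x x" "\<And>j. principal j x \<Longrightarrow> nz j x x h"
  shows "\<exists>q\<in>hm x x. h \<otimes> q = e x \<and> q \<otimes> h = e x"
proof -
  have "nz j x x h" if "j \<in> J" "nz j x x (e x)" for j
  proof -
    have "rel j x" using that by (simp add: rel_def)
    then obtain k where "principal k x" "below x j k" using principal_above assms(1) by blast
    then show ?thesis using assms by (auto simp: below_def)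
  qed
  then obtain q where "q \<in> carrier E" "q \<otimes> e x = q" "e x \<otimes> q = q" "h \<otimes> q = e x" "q \<otimes> h = e x"
    using corner_unit[of x h] assms by (auto simp: hmD)
  then show ?thesis by (auto simp: hm_def)
qed

lemma separate_one:
  assumes x: "x \<in> I" and j: "principal j x"
  shows "\<exists>d\<in>hm x x. nz j x x d \<and> (\<forall>k. principal k x \<and> k \<noteq> j \<longrightarrow> \<not> nz k x x d)"
proof -
  have "\<exists>d\<in>hm x x. nz j x x d \<and> (\<forall>k\<in>K. \<not> nz k x x d)"
    if "finite K" "\<And>k. k \<in> K \<Longrightarrow> principal k x \<and> k \<noteq> j" for K
    using that
  proof (induction K rule: finite_induct)
    case empty then show ?case using hm_e[OF x] principalD(3)[OF j] by blast
  next
    case (insert k K)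
    then obtain d where d: "d \<in> hm x x" "nz j x x d" "\<forall>k\<in>K. \<not> nz k x x d" by auto
    have k: "principal k x" "k \<noteq> j" using insert by auto
    then have "\<not> below x k j" using principal_incomparable j by blast
    then obtain h where h: "h \<in> hm x x" "nz j x x h" "\<not> nz k x x h" by (auto simp: below_def)
    have "h \<otimes> d \<in> hm x x" using h d x by (simp add: hm_mult)
    moreover have "nz j x x (h \<otimes> d)" using h d x principalD(2)[OF j] by (simp add: nz_comp)
    moreover have "\<not> nz l x x (h \<otimes> d)" if "l \<in> insert k K" for l
      using that h d x insert.prems[OF that] nz_comp[of l x x x h d] principalD(2) by auto
    ultimately show ?case by blast
  qed
  moreover have "finite {k. principal k x \<and> k \<noteq> j}"
    using fin_J by (rule finite_subset[rotated]) (auto simp: principal_def rel_def)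
  ultimately show ?thesis
    by (metis (mono_tags, lifting) mem_Collect_eq)
qed

text \<open>Prime avoidance: prescribed membership in the principal ideals.\<close>

lemma separate:
  assumes x: "x \<in> I" and y: "y \<in> I" and S: "\<And>j. j \<in> S \<Longrightarrow> principal j x \<and> sim j x y"
  shows "\<exists>t\<in>hm x y. (\<forall>j. principal j x \<longrightarrow> (nz j x y t \<longleftrightarrow> j \<in> S)) \<and> (S = {} \<longrightarrow> t = \<zero>)"
proof -
  have finS: "finite S" using fin_J by (rule finite_subset[rotated]) (use S principalD(2) in blast)
  have "\<exists>a\<in>hm x y. nz j x y a \<and> (\<forall>k. principal k x \<and> k \<noteq> j \<longrightarrow> \<not> nz k x y a)" if j: "j \<in> S" for j
  proof -
    obtain f where f: "f \<in> hm x y" "nz j x y f" using S[OF j] by (auto simp: sim_def)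
    obtain d where d: "d \<in> hm x x" "nz j x x d" "\<forall>k. principal k x \<and> k \<noteq> j \<longrightarrow> \<not> nz k x x d"
      using separate_one[OF x] S[OF j] by blast
    have "f \<otimes> d \<in> hm x y" using f d x y by (simp add: hm_mult)
    moreover have "nz j x y (f \<otimes> d)" using f d x y principalD(2) S[OF j] by (auto simp: nz_comp)
    moreover have "\<forall>k. principal k x \<and> k \<noteq> j \<longrightarrow> \<not> nz k x y (f \<otimes> d)"
      using f d x y nz_comp[of _ x x y f d] principalD(2) by blast
    ultimately show ?thesis by blast
  qed
  then obtain a where a: "\<And>j. j \<in> S \<Longrightarrow> a j \<in> hm x y" "\<And>j. j \<in> S \<Longrightarrow> nz j x y (a j)"
    "\<And>j k. j \<in> S \<Longrightarrow> principal k x \<Longrightarrow> k \<noteq> j \<Longrightarrow> \<not> nz k x y (a j)" by metis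
  let ?t = "\<Oplus>j\<in>S. a j"
  have "nz j x y ?t \<longleftrightarrow> j \<in> S" if "principal j x" for j
  proof (cases "j \<in> S")
    case True
    then show ?thesis using nz_finsum_one[of S j x y a j] finS x y that a principalD(2) by auto
  next
    case False
    then show ?thesis using nz_finsum_not[of S j x y a] finS x y that a principalD(2) by blast
  qed
  moreover have "?t \<in> hm x y" using hm_finsum finS x y a by blast
  ultimately show ?thesis by (intro bexI[of _ ?t]) auto
qed

text \<open>
  Modulo a principal ideal, an endomorphism \<open>a\<close> outside the ideal has a right inverse: there are \<open>d\<close>
  outside this principal ideal and inside all others, and \<open>c\<close> inside this one and outside all
  others, so that \<open>a \<otimes> d \<oplus> c\<close> is a unit.
\<close>

lemma divide:
  assumes x: "x \<in> I" and j: "principal j x" and a: "a \<in> hm x x" "nz j x x a"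
  shows "\<exists>w\<in>hm x x. \<not> nz j x x (a \<otimes> w \<ominus> e x)"
proof -
  obtain d where d: "d \<in> hm x x" "nz j x x d" "\<forall>k. principal k x \<and> k \<noteq> j \<longrightarrow> \<not> nz k x x d"
    using separate_one[OF x j] by blast
  have "\<exists>c\<in>hm x x. (\<forall>k. principal k x \<longrightarrow> (nz k x x c \<longleftrightarrow> k \<in> {k. principal k x \<and> k \<noteq> j})) \<and> ({k. principal k x \<and> k \<noteq> j} = {} \<longrightarrow> c = \<zero>)"
    using separate[OF x x, of "{k. principal k x \<and> k \<noteq> j}"] sim_refl[OF x] principalD(1) by blast
  then obtain c where c: "c \<in> hm x x" "\<And>k. principal k x \<Longrightarrow> nz k x x c \<longleftrightarrow> k \<noteq> j" by auto
  have ad: "a \<otimes> d \<in> hm x x" using a d x by (simp add: hm_mult)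
  let ?b = "a \<otimes> d \<oplus> c"
  have bh: "?b \<in> hm x x" using ad c x by (simp add: hm_add)
  have Ec: "a \<in> carrier E" "d \<in> carrier E" "c \<in> carrier E" "a \<otimes> d \<in> carrier E" using a c d ad hmD by auto
  have d1: "?b \<ominus> c = a \<otimes> d" using Ec by algebra
  have d2: "?b \<ominus> a \<otimes> d = c" using Ec by algebra
  have "nz k x x ?b" if k: "principal k x" for k
  proof (cases "k = j")
    case True
    have "nz j x x (a \<otimes> d)" using a d x principalD(2)[OF j] by (simp add: nz_comp)
    then show ?thesis using True nz_diff[of j x x ?b "a \<otimes> d"] bh ad d2 c(2)[OF j] x principalD(2)[OF j] by simp
  next
    case False
    then have "\<not> nz k x x (a \<otimes> d)" using a d x k principalD(2)[OF k] by (simp add: nz_comp)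
    moreover have "nz k x x c" using False c k by simp
    ultimately show ?thesis using nz_diff[of k x x ?b c] bh d1 c(1) x principalD(2)[OF k] by simp
  qed
  then obtain q where q: "q \<in> hm x x" "?b \<otimes> q = e x" using corner_unit_principal[OF x bh] by blast
  have dq: "d \<otimes> q \<in> hm x x" using d q x by (simp add: hm_mult)
  have qE: "q \<in> carrier E" using q hmD by blast
  have "a \<otimes> (d \<otimes> q) \<ominus> e x = \<ominus> (c \<otimes> q)"
    unfolding q(2)[symmetric] using Ec qE by algebra
  moreover have "\<not> nz j x x (\<ominus> (c \<otimes> q))"
    using c q x j principalD(2)[OF j] by (simp add: nz_minus hm_mult nz_comp)
  ultimately have "\<not> nz j x x (a \<otimes> (d \<otimes> q) \<ominus> e x)" by metis
  then show ?thesis using dq by blast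
qed

text \<open>The ideals contained in $P_k$ are determined by the $P_k$-class.\<close>

lemma below_transfer:
  assumes "x \<in> I" "y \<in> I" "j \<in> J" "k \<in> J" "sim k x y" "below y j k"
  shows "below x j k"
  unfolding below_def
proof (intro ballI impI)
  fix h assume h: "h \<in> hm x x" "nz k x x h"
  obtain f g where fg: "f \<in> hm x y" "g \<in> hm y x" "nz k x y f" "nz k y x g" using assms by (auto simp: sim_def)
  have fh: "f \<otimes> h \<in> hm x y" using fg h assms by (simp add: hm_mult)
  have fhg: "f \<otimes> h \<otimes> g \<in> hm y y" using fh fg assms by (simp add: hm_mult)
  have "nz k y y (f \<otimes> h \<otimes> g)" using fg h fh assms by (simp add: nz_comp)
  then have "nz j y y (f \<otimes> h \<otimes> g)" using assms fhg by (auto simp: below_def)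
  then show "nz j x x h" using fg h fh assms by (simp add: nz_comp)
qed

text \<open>
  Being principal depends only on the class. Here \<open>?c\<close> is an endomorphism of \<open>y\<close> that factors
  through \<open>x\<close> and is congruent to \<open>e y\<close> modulo $P_j$. If $P_j \subseteq P_k$ on \<open>y\<close>, then \<open>?c\<close> is
  congruent to \<open>e y\<close> modulo $P_k$ as well, so \<open>x\<close> and \<open>y\<close> have the same $P_k$-class.
\<close>

lemma principal_sim:
  assumes x: "x \<in> I" and y: "y \<in> I" and j: "principal j x" and s: "sim j x y"
  shows "principal j y"
proof -
  have J: "j \<in> J" using j principalD by blast
  obtain f g where fg: "f \<in> hm x y" "g \<in> hm y x" "nz j x y f" "nz j y x g" using s by (auto simp: sim_def)
  have gf: "g \<otimes> f \<in> hm x x" "nz j x x (g \<otimes> f)" using fg x y J by (auto simp: hm_mult nz_comp)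
  then obtain w where w: "w \<in> hm x x" "\<not> nz j x x (g \<otimes> f \<otimes> w \<ominus> e x)" using divide[OF x j] by blast
  let ?c = "f \<otimes> w \<otimes> g"
  have fw: "f \<otimes> w \<in> hm x y" using fg w x y by (simp add: hm_mult)
  have ch: "?c \<in> hm y y" using fw fg x y by (simp add: hm_mult)
  have ey: "e y \<in> hm y y" using y hm_e by blast
  have dh: "?c \<ominus> e y \<in> hm y y" using ch ey y by (simp add: minus_eq hm_add hm_minus)
  have dx: "g \<otimes> f \<otimes> w \<ominus> e x \<in> hm x x"
    using gf w x hm_e[OF x] by (simp add: minus_eq hm_add hm_minus hm_mult)
  have E: "f \<in> carrier E" "g \<in> carrier E" "w \<in> carrier E" "e x \<in> carrier E" "e y \<in> carrier E"
    using fg w x y e_closed hmD by auto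
  have ge: "g \<otimes> e y = g" "e x \<otimes> g = g" using fg hmD by auto
  have "g \<otimes> (?c \<ominus> e y) = g \<otimes> f \<otimes> w \<otimes> g \<ominus> g \<otimes> e y" using E by algebra
  also have "\<dots> = g \<otimes> f \<otimes> w \<otimes> g \<ominus> e x \<otimes> g" using ge by simp
  also have "\<dots> = (g \<otimes> f \<otimes> w \<ominus> e x) \<otimes> g" using E by algebra
  finally have eq: "g \<otimes> (?c \<ominus> e y) = (g \<otimes> f \<otimes> w \<ominus> e x) \<otimes> g" .
  have "\<not> nz j y x ((g \<otimes> f \<otimes> w \<ominus> e x) \<otimes> g)" using w dx fg x y J by (simp add: nz_comp)
  then have nc: "\<not> nz j y y (?c \<ominus> e y)" using eq fg dh x y J nz_comp[of j y y x g "?c \<ominus> e y"] by simp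
  have "below y k j \<and> j \<le> k" if k: "rel k y" "below y j k" for k
  proof -
    have K: "k \<in> J" "nz k y y (e y)" using k by (auto simp: rel_def)
    have "\<not> nz k y y (?c \<ominus> e y)" using nc k dh by (auto simp: below_def)
    then have "nz k y y ?c" using nz_diff[OF K(1) y y ch ey] K by simp
    then have "nz k x y f" "nz k y x g"
      using nz_comp[of k y x y "f \<otimes> w" g] nz_comp[of k x x y f w] fw fg w x y K by auto
    then have sk: "sim k x y" using fg by (auto simp: sim_def)
    have "below x j k" using below_transfer[OF x y J K(1) sk] k by blast
    then have "below x k j" "j \<le> k" using j sim_rel[OF K(1) x y sk] by (auto simp: principal_def)
    then show ?thesis using below_transfer[OF y x K(1) J sim_sym[OF s]] by blast
  qed
  then show ?thesis using sim_rel[OF J x y s] by (auto simp: principal_def)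
qed

lemma finsum_diag:
  assumes a: "\<And>x. x \<in> I \<Longrightarrow> a x \<in> hm x x" and b: "\<And>x. x \<in> I \<Longrightarrow> b x \<in> hm x x"
  shows "(\<Oplus>x\<in>I. a x) \<otimes> (\<Oplus>x\<in>I. b x) = (\<Oplus>x\<in>I. a x \<otimes> b x)"
proof -
  have aE: "a \<in> I \<rightarrow> carrier E" and bE: "b \<in> I \<rightarrow> carrier E" using a b hmD(1) by blast+
  have aC: "\<And>x. x \<in> I \<Longrightarrow> a x \<in> carrier E" and bC: "\<And>x. x \<in> I \<Longrightarrow> b x \<in> carrier E"
    using a b hmD(1) by blast+
  have "(\<Oplus>x\<in>I. a x) \<otimes> (\<Oplus>x\<in>I. b x) = (\<Oplus>x\<in>I. a x \<otimes> (\<Oplus>x\<in>I. b x))"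
    using aE bE fin_I by (intro finsum_ldistr) (auto intro: finsum_closed)
  also have "\<dots> = (\<Oplus>x\<in>I. a x \<otimes> b x)"
  proof (rule finsum_cong'[OF refl])
    show "(\<lambda>x. a x \<otimes> b x) \<in> I \<rightarrow> carrier E" using aC bC by auto
    fix x assume x: "x \<in> I"
    have "a x \<otimes> (\<Oplus>y\<in>I. b y) = (\<Oplus>y\<in>I. a x \<otimes> b y)"
      using aE bE x fin_I by (intro finsum_rdistr) auto
    also have "\<dots> = (\<Oplus>y\<in>I. if x = y then a x \<otimes> b y else \<zero>)"
    proof (rule finsum_cong'[OF refl])
      show "(\<lambda>y. if x = y then a x \<otimes> b y else \<zero>) \<in> I \<rightarrow> carrier E" using aC bC x by auto
      show "a x \<otimes> b y = (if x = y then a x \<otimes> b y else \<zero>)" if "y \<in> I" for y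
        using hm_orth[OF that that x x a[OF x] b[OF that]] by auto
    qed
    also have "\<dots> = a x \<otimes> b x"
      using finsum_singleton[OF x fin_I, of "\<lambda>y. a x \<otimes> b y"] aE bE x by auto
    finally show "a x \<otimes> (\<Oplus>y\<in>I. b y) = a x \<otimes> b x" .
  qed
  finally show ?thesis .
qed

lemma expand_middle:
  assumes "a \<in> carrier E" "b \<in> carrier E" "B \<subseteq> I"
  shows "a \<otimes> (\<Oplus>y\<in>B. e y) \<otimes> b = (\<Oplus>y\<in>B. (a \<otimes> e y) \<otimes> (e y \<otimes> b))"
proof -
  have fB: "finite B" using assms fin_I finite_subset by blast
  have eE: "e \<in> B \<rightarrow> carrier E" using e_closed assms by blast
  have "a \<otimes> (\<Oplus>y\<in>B. e y) \<otimes> b = (\<Oplus>y\<in>B. a \<otimes> e y) \<otimes> b"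
    using assms fB eE by (simp add: finsum_rdistr)
  also have "\<dots> = (\<Oplus>y\<in>B. a \<otimes> e y \<otimes> b)"
    using assms fB eE by (intro finsum_ldistr) auto
  also have "\<dots> = (\<Oplus>y\<in>B. (a \<otimes> e y) \<otimes> (e y \<otimes> b))"
  proof (rule finsum_cong'[OF refl])
    show "(\<lambda>y. (a \<otimes> e y) \<otimes> (e y \<otimes> b)) \<in> B \<rightarrow> carrier E" using assms eE by auto
    fix y assume y: "y \<in> B"
    have yI: "y \<in> I" and ey: "e y \<in> carrier E" using y assms eE by auto
    have "(a \<otimes> e y) \<otimes> (e y \<otimes> b) = a \<otimes> (e y \<otimes> e y) \<otimes> b"
      using assms ey by (simp add: m_assoc)
    then show "a \<otimes> e y \<otimes> b = (a \<otimes> e y) \<otimes> (e y \<otimes> b)" using e_idem[OF yI] by simp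
  qed
  finally show ?thesis .
qed

lemma expand_mult:
  assumes "a \<in> carrier E" "b \<in> carrier E"
  shows "a \<otimes> b = (\<Oplus>y\<in>I. (a \<otimes> e y) \<otimes> (e y \<otimes> b))"
  using expand_middle[OF assms subset_refl] assms by (simp add: e_sum)

text \<open>
  Elements of $E e_x$ all of whose left multiples, cut down to the endomorphism ring of \<open>x\<close>, lie in
  every principal ideal there. These form the column of the Jacobson radical that belongs
  to \<open>x\<close>.
\<close>

definition radical_column :: "'i \<Rightarrow> 'e \<Rightarrow> bool"
  where "radical_column x r \<longleftrightarrow> r \<in> carrier E \<and> r \<otimes> e x = r \<and>
    (\<forall>g\<in>carrier E. \<forall>j. principal j x \<longrightarrow> \<not> nz j x x (e x \<otimes> (g \<otimes> r)))"

text \<open>This is the principle that $1 + a b$ is a unit if $1 + b a$ is one, for \<open>a = w \<otimes> r\<close> and \<open>b = e x\<close>.\<close>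

lemma one_plus_radical_unit:
  assumes x: "x \<in> I" and r: "radical_column x r" and w: "w \<in> carrier E"
  shows "\<one> \<oplus> w \<otimes> r \<in> Units E"
proof -
  define r' where "r' = w \<otimes> r"
  have rE: "r \<in> carrier E" "r \<otimes> e x = r" using r by (auto simp: radical_column_def)
  have ex: "e x \<in> carrier E" "e x \<in> hm x x" using x e_closed hm_e by auto
  have r'E: "r' \<in> carrier E" "r' \<otimes> e x = r'" using rE w ex by (auto simp: r'_def m_assoc)
  have h1: "e x \<otimes> r' \<in> hm x x" using hm_comp[OF x x r'E(1)] r'E ex by (simp add: m_assoc)
  let ?c = "e x \<oplus> e x \<otimes> r'"
  have c: "?c \<in> hm x x" using h1 ex x by (simp add: hm_add)
  have "nz j x x ?c" if j: "principal j x" for j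
  proof -
    have "\<not> nz j x x (e x \<otimes> r')" using r w j by (auto simp: radical_column_def r'_def)
    moreover have "?c \<ominus> e x = e x \<otimes> r'" using ex(1) r'E(1) by algebra
    ultimately show ?thesis
      using nz_diff[of j x x ?c "e x"] c ex x j principalD by simp
  qed
  then obtain q where q: "q \<in> hm x x" "?c \<otimes> q = e x" "q \<otimes> ?c = e x"
    using corner_unit_principal[OF x c] by blast
  have qE: "q \<in> carrier E" "q \<otimes> e x = q" "e x \<otimes> q = q" using q hmD by auto
  have "(\<one> \<oplus> r') \<otimes> (\<one> \<ominus> r' \<otimes> q) = \<one> \<oplus> r' \<ominus> (r' \<otimes> q \<oplus> r' \<otimes> r' \<otimes> q)"
    using r'E(1) qE(1) by (simp add: minus_eq l_distr r_distr r_minus l_minus m_assoc minus_add a_ac)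
  also have "r' \<otimes> q \<oplus> r' \<otimes> r' \<otimes> q = r' \<otimes> (e x \<otimes> q) \<oplus> (r' \<otimes> e x) \<otimes> r' \<otimes> q"
    using r'E qE by simp
  also have "\<dots> = r' \<otimes> (?c \<otimes> q)" using r'E(1) qE(1) ex(1) by algebra
  also have "\<dots> = r'" using q r'E by simp
  also have "\<one> \<oplus> r' \<ominus> r' = \<one>" using r'E(1) by algebra
  finally have 1: "(\<one> \<oplus> r') \<otimes> (\<one> \<ominus> r' \<otimes> q) = \<one>" .
  have "(\<one> \<ominus> r' \<otimes> q) \<otimes> (\<one> \<oplus> r') = \<one> \<oplus> r' \<ominus> (r' \<otimes> q \<oplus> r' \<otimes> q \<otimes> r')"
    using r'E(1) qE(1) by (simp add: minus_eq l_distr r_distr r_minus l_minus m_assoc minus_add a_ac)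
  also have "r' \<otimes> q \<oplus> r' \<otimes> q \<otimes> r' = r' \<otimes> (q \<otimes> e x) \<oplus> r' \<otimes> (q \<otimes> e x) \<otimes> r'"
    using r'E qE by simp
  also have "\<dots> = r' \<otimes> (q \<otimes> ?c)" using r'E(1) qE(1) ex(1) by algebra
  also have "\<dots> = r'" using q r'E by simp
  also have "\<one> \<oplus> r' \<ominus> r' = \<one>" using r'E(1) by algebra
  finally have 2: "(\<one> \<ominus> r' \<otimes> q) \<otimes> (\<one> \<oplus> r') = \<one>" .
  show ?thesis unfolding r'_def[symmetric] Units_def
    using 1 2 r'E(1) qE(1) by (auto intro!: bexI[of _ "\<one> \<ominus> r' \<otimes> q"])
qed

text \<open>
  A matrix with invertible diagonal entries and radical entries elsewhere is invertible: after
  normalisation of the diagonal it is \<open>\<one>\<close> plus a sum of radical columns, which are split off one by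
  one.
\<close>

lemma unit_of_components:
  assumes h: "h \<in> carrier E"
    and nzh: "\<And>x y j. \<lbrakk>x \<in> I; y \<in> I; principal j x\<rbrakk> \<Longrightarrow> nz j x y (e y \<otimes> h \<otimes> e x) \<longleftrightarrow> y = x"
  shows "h \<in> Units E"
proof -
  have "\<exists>d. d \<in> hm x x \<and> (e x \<otimes> h \<otimes> e x) \<otimes> d = e x \<and> d \<otimes> (e x \<otimes> h \<otimes> e x) = e x" if x: "x \<in> I" for x
    using corner_unit_principal[OF x hm_comp[OF x x h]] nzh[OF x x] by blast
  then obtain d where d: "\<And>x. x \<in> I \<Longrightarrow> d x \<in> hm x x"
    "\<And>x. x \<in> I \<Longrightarrow> (e x \<otimes> h \<otimes> e x) \<otimes> d x = e x"
    "\<And>x. x \<in> I \<Longrightarrow> d x \<otimes> (e x \<otimes> h \<otimes> e x) = e x" by metis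
  have dE: "\<And>x. x \<in> I \<Longrightarrow> d x \<in> carrier E" using d(1) hmD(1) by blast
  define r where "r x = h \<otimes> d x \<ominus> e x" for x
  have rE: "\<And>x. x \<in> I \<Longrightarrow> r x \<in> carrier E" using h dE e_closed by (simp add: r_def)
  have rc: "radical_column x (r x)" if x: "x \<in> I" for x
    unfolding radical_column_def
  proof (intro conjI ballI allI impI)
    have ex: "e x \<in> carrier E" "e x \<otimes> e x = e x" using x e_closed e_idem by auto
    have dx: "d x \<in> carrier E" "d x \<otimes> e x = d x" "e x \<otimes> d x = d x" using d(1)[OF x] hmD by auto
    show "r x \<in> carrier E" using rE x by blast
    have "r x \<otimes> e x = h \<otimes> (d x \<otimes> e x) \<ominus> e x \<otimes> e x" unfolding r_def using h dx(1) ex(1) by algebra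
    then show "r x \<otimes> e x = r x" using dx ex by (simp add: r_def)
    fix g j assume g: "g \<in> carrier E" and j: "principal j x"
    have J: "j \<in> J" using j principalD by blast
    have er: "e y \<otimes> r x \<in> hm x y \<and> \<not> nz j x y (e y \<otimes> r x)" if y: "y \<in> I" for y
    proof -
      have ey: "e y \<in> carrier E" using y e_closed by blast
      have hc: "e y \<otimes> h \<otimes> e x \<in> hm x y" using hm_comp x y h by blast
      have "e y \<otimes> r x = e y \<otimes> h \<otimes> (e x \<otimes> d x) \<ominus> e y \<otimes> e x"
        unfolding r_def dx(3) using h dx(1) ex(1) ey by algebra
      then have eq: "e y \<otimes> r x = (e y \<otimes> h \<otimes> e x) \<otimes> d x \<ominus> e y \<otimes> e x"
        using h dx(1) ex(1) ey by (simp add: m_assoc)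
      show ?thesis
      proof (cases "y = x")
        case True
        then have "e y \<otimes> r x = \<zero>" using eq d(2)[OF x] ex by (simp add: r_neg minus_eq)
        then show ?thesis using hm_zero nz_zero x y J by simp
      next
        case False
        then have "e y \<otimes> r x = (e y \<otimes> h \<otimes> e x) \<otimes> d x"
          using eq e_orth[OF y x] h dx(1) ex(1) ey by (simp add: minus_eq)
        moreover have "\<not> nz j x y ((e y \<otimes> h \<otimes> e x) \<otimes> d x)"
          using nz_comp[OF J x x y hc d(1)[OF x]] nzh[OF x y j] False by simp
        ultimately show ?thesis using hm_mult[OF x x y hc d(1)[OF x]] by simp
      qed
    qed
    have "e x \<otimes> (g \<otimes> r x) = (e x \<otimes> g) \<otimes> r x" using g ex rE[OF x] by (simp add: m_assoc)
    also have "\<dots> = (\<Oplus>y\<in>I. (e x \<otimes> g \<otimes> e y) \<otimes> (e y \<otimes> r x))"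
      using expand_mult[of "e x \<otimes> g" "r x"] g ex(1) rE[OF x] by (simp add: m_closed)
    finally have eq: "e x \<otimes> (g \<otimes> r x) = (\<Oplus>y\<in>I. (e x \<otimes> g \<otimes> e y) \<otimes> (e y \<otimes> r x))" .
    show "\<not> nz j x x (e x \<otimes> (g \<otimes> r x))"
      unfolding eq
    proof (rule nz_finsum_not[OF fin_I J x x])
      fix y assume y: "y \<in> I"
      have "e x \<otimes> g \<otimes> e y \<in> hm y x" using hm_comp x y g by blast
      then show "(e x \<otimes> g \<otimes> e y) \<otimes> (e y \<otimes> r x) \<in> hm x x \<and>
          \<not> nz j x x ((e x \<otimes> g \<otimes> e y) \<otimes> (e y \<otimes> r x))"
        using er[OF y] x y J by (simp add: hm_mult nz_comp)
    qed
  qed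
  have units: "\<one> \<oplus> (\<Oplus>x\<in>S. r x) \<in> Units E" if "finite S" "S \<subseteq> I" for S
    using that
  proof (induction S rule: finite_induct)
    case empty then show ?case by simp
  next
    case (insert x S)
    let ?u = "\<one> \<oplus> (\<Oplus>x\<in>S. r x)"
    have u: "?u \<in> Units E" using insert by simp
    have x: "x \<in> I" using insert by simp
    have rS: "r \<in> S \<rightarrow> carrier E" using rE insert.prems by blast
    then have SE: "(\<Oplus>x\<in>S. r x) \<in> carrier E" by (rule finsum_closed)
    have "(\<Oplus>x\<in>insert x S. r x) = r x \<oplus> (\<Oplus>x\<in>S. r x)"
      using insert.hyps rS rE[OF x] by (intro finsum_insert)
    then have "\<one> \<oplus> (\<Oplus>x\<in>insert x S. r x) = ?u \<oplus> r x"
      using SE rE[OF x] by (simp add: a_ac)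
    also have "\<dots> = ?u \<oplus> (?u \<otimes> inv ?u) \<otimes> r x" using u rE[OF x] by simp
    also have "\<dots> = ?u \<otimes> (\<one> \<oplus> inv ?u \<otimes> r x)"
      using Units_closed[OF u] Units_inv_closed[OF u] rE[OF x] by (simp add: r_distr m_assoc del: Units_r_inv)
    also have "\<dots> \<in> Units E"
      using u one_plus_radical_unit[OF x rc[OF x]] by simp
    finally show ?case .
  qed
  let ?D = "\<Oplus>x\<in>I. d x"
  let ?D' = "\<Oplus>x\<in>I. e x \<otimes> h \<otimes> e x"
  have ce: "\<And>x. x \<in> I \<Longrightarrow> e x \<otimes> h \<otimes> e x \<in> hm x x" using hm_comp h by blast
  have dI: "d \<in> I \<rightarrow> carrier E" and eI: "e \<in> I \<rightarrow> carrier E" and rI: "r \<in> I \<rightarrow> carrier E"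
    using dE e_closed rE by auto
  have cI: "(\<lambda>x. e x \<otimes> h \<otimes> e x) \<in> I \<rightarrow> carrier E" using eI h by auto
  have "?D \<otimes> ?D' = (\<Oplus>x\<in>I. d x \<otimes> (e x \<otimes> h \<otimes> e x))" using finsum_diag[OF d(1) ce] .
  also have "\<dots> = (\<Oplus>x\<in>I. e x)" using eI d(3) by (intro finsum_cong') auto
  finally have DD': "?D \<otimes> ?D' = \<one>" by (simp add: e_sum)
  have "?D' \<otimes> ?D = (\<Oplus>x\<in>I. (e x \<otimes> h \<otimes> e x) \<otimes> d x)" using finsum_diag[OF ce d(1)] .
  also have "\<dots> = (\<Oplus>x\<in>I. e x)" using eI d(2) by (intro finsum_cong') auto
  finally have D'D: "?D' \<otimes> ?D = \<one>" by (simp add: e_sum)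
  have DE: "?D \<in> carrier E" "?D' \<in> carrier E" using dI cI by (auto intro: finsum_closed)
  have D'U: "?D' \<in> Units E" using DD' D'D DE by (auto simp: Units_def)
  have "\<one> \<oplus> (\<Oplus>x\<in>I. r x) = (\<Oplus>x\<in>I. e x \<oplus> r x)"
    using eI rI by (simp add: finsum_addf e_sum)
  also have "\<dots> = (\<Oplus>x\<in>I. h \<otimes> d x)"
  proof (rule finsum_cong'[OF refl])
    show "(\<lambda>x. h \<otimes> d x) \<in> I \<rightarrow> carrier E" using h dE by auto
    fix x assume x: "x \<in> I"
    show "e x \<oplus> r x = h \<otimes> d x" unfolding r_def using h dE[OF x] e_closed[OF x] by algebra
  qed
  also have "\<dots> = h \<otimes> ?D" using h dI fin_I by (simp add: finsum_rdistr)
  finally have hD: "h \<otimes> ?D \<in> Units E" using units[OF fin_I] by simp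
  have "h = (h \<otimes> ?D) \<otimes> ?D'" using h DE DD' by (simp add: m_assoc)
  then show ?thesis using hD D'U Units_m_closed by metis
qed

text \<open>
  For each index \<open>j\<close>, let an involution of the relevant objects that preserves $P_j$-classes be
  given. Then there is a unit whose only nonzero blocks go from objects to their images under one
  of the involutions.
\<close>

theorem unit_from_involutions:
  assumes inv: "\<And>j x. \<lbrakk>x \<in> I; rel j x\<rbrakk> \<Longrightarrow> \<pi> j x \<in> I \<and> sim j x (\<pi> j x) \<and> \<pi> j (\<pi> j x) = x"
  shows "\<exists>s\<in>Units E. \<forall>x\<in>I. \<forall>y\<in>I. (\<forall>j. rel j x \<longrightarrow> \<pi> j x \<noteq> y) \<longrightarrow> e y \<otimes> s \<otimes> e x = \<zero>"
proof -
  define S where "S x y = {j. principal j x \<and> \<pi> j x = y}" for x y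
  have "\<exists>t. t \<in> hm x y \<and> (\<forall>j. principal j x \<longrightarrow> (nz j x y t \<longleftrightarrow> j \<in> S x y)) \<and> (S x y = {} \<longrightarrow> t = \<zero>)"
    if "x \<in> I" "y \<in> I" for x y
    using separate[OF that, of "S x y"] inv[OF that(1)] principalD(1) by (auto simp: S_def)
  then obtain t where t: "\<And>x y. x \<in> I \<Longrightarrow> y \<in> I \<Longrightarrow> t x y \<in> hm x y"
    "\<And>x y j. x \<in> I \<Longrightarrow> y \<in> I \<Longrightarrow> principal j x \<Longrightarrow> nz j x y (t x y) \<longleftrightarrow> j \<in> S x y"
    "\<And>x y. x \<in> I \<Longrightarrow> y \<in> I \<Longrightarrow> S x y = {} \<Longrightarrow> t x y = \<zero>" by metis
  have tE: "\<And>x y. x \<in> I \<Longrightarrow> y \<in> I \<Longrightarrow> t x y \<in> carrier E" using t(1) hmD(1) by blast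
  define c where "c x = (\<Oplus>y\<in>I. t x y)" for x
  define s where "s = (\<Oplus>x\<in>I. c x)"
  have cE: "c x \<in> carrier E" if "x \<in> I" for x
    unfolding c_def using tE that by (intro finsum_closed) auto
  have sE: "s \<in> carrier E" unfolding s_def using cE by (intro finsum_closed) auto
  have sx: "s \<otimes> e x = c x" if x: "x \<in> I" for x
  proof -
    have "s \<otimes> e x = (\<Oplus>z\<in>I. c z \<otimes> e x)"
      unfolding s_def using cE e_closed[OF x] fin_I by (intro finsum_ldistr) auto
    also have "\<dots> = (\<Oplus>z\<in>I. if x = z then c z else \<zero>)"
    proof (rule finsum_cong'[OF refl])
      show "(\<lambda>z. if x = z then c z else \<zero>) \<in> I \<rightarrow> carrier E" using cE by auto
      fix z assume z: "z \<in> I"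
      have "c z \<otimes> e x = (\<Oplus>y\<in>I. t z y \<otimes> e x)"
        unfolding c_def using tE z e_closed[OF x] fin_I by (intro finsum_ldistr) auto
      also have "\<dots> = (\<Oplus>y\<in>I. if x = z then t z y else \<zero>)"
      proof (rule finsum_cong'[OF refl])
        show "(\<lambda>y. if x = z then t z y else \<zero>) \<in> I \<rightarrow> carrier E" using tE z by auto
        show "t z y \<otimes> e x = (if x = z then t z y else \<zero>)" if y: "y \<in> I" for y
          using hm_orth[OF x x z y t(1)[OF z y] hm_e[OF x]] hmD(2)[OF t(1)[OF z y]] by auto
      qed
      finally show "c z \<otimes> e x = (if x = z then c z else \<zero>)" by (simp add: c_def)
    qed
    also have "\<dots> = c x" using finsum_singleton[OF x fin_I, of c] cE by auto
    finally show ?thesis .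
  qed
  have comp: "e y \<otimes> s \<otimes> e x = t x y" if x: "x \<in> I" and y: "y \<in> I" for x y
  proof -
    have "e y \<otimes> s \<otimes> e x = e y \<otimes> c x" using sx x y sE e_closed by (simp add: m_assoc)
    also have "\<dots> = (\<Oplus>z\<in>I. e y \<otimes> t x z)"
      unfolding c_def using tE x e_closed[OF y] fin_I by (intro finsum_rdistr) auto
    also have "\<dots> = (\<Oplus>z\<in>I. if y = z then t x z else \<zero>)"
    proof (rule finsum_cong'[OF refl])
      show "(\<lambda>z. if y = z then t x z else \<zero>) \<in> I \<rightarrow> carrier E" using tE x by auto
      show "e y \<otimes> t x z = (if y = z then t x z else \<zero>)" if z: "z \<in> I" for z
        using hm_orth[OF x z y y hm_e[OF y] t(1)[OF x z]] hmD(3)[OF t(1)[OF x z]] by auto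
    qed
    also have "\<dots> = t x y" using finsum_singleton[OF y fin_I, of "t x"] tE x by auto
    finally show ?thesis .
  qed
  have "s \<otimes> s \<in> Units E"
  proof (rule unit_of_components)
    show "s \<otimes> s \<in> carrier E" using sE by simp
    fix x y j assume x: "x \<in> I" and y: "y \<in> I" and j: "principal j x"
    have J: "j \<in> J" using j principalD by blast
    have E: "e x \<in> carrier E" "e y \<in> carrier E" using x y e_closed by auto
    have "e y \<otimes> (s \<otimes> s) \<otimes> e x = (e y \<otimes> s) \<otimes> (s \<otimes> e x)" using E sE by (simp add: m_assoc)
    also have "\<dots> = (\<Oplus>z\<in>I. (e y \<otimes> s \<otimes> e z) \<otimes> (e z \<otimes> (s \<otimes> e x)))"
      using expand_mult[of "e y \<otimes> s" "s \<otimes> e x"] E sE by (simp add: m_closed)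
    also have "\<dots> = (\<Oplus>z\<in>I. t z y \<otimes> t x z)"
    proof (rule finsum_cong'[OF refl])
      show "(\<lambda>z. t z y \<otimes> t x z) \<in> I \<rightarrow> carrier E" using tE x y by auto
      fix z assume z: "z \<in> I"
      have "e z \<otimes> (s \<otimes> e x) = e z \<otimes> s \<otimes> e x" using E sE e_closed[OF z] by (simp add: m_assoc)
      then show "(e y \<otimes> s \<otimes> e z) \<otimes> (e z \<otimes> (s \<otimes> e x)) = t z y \<otimes> t x z"
        using comp x y z by simp
    qed
    finally have eq: "e y \<otimes> (s \<otimes> s) \<otimes> e x = (\<Oplus>z\<in>I. t z y \<otimes> t x z)" .
    have th: "t z y \<otimes> t x z \<in> hm x y" if "z \<in> I" for z using hm_mult t(1) x y that by blast
    let ?p = "\<pi> j x"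
    have p: "?p \<in> I" "sim j x ?p" "\<pi> j ?p = x" using inv[OF x principalD(1)[OF j]] by auto
    have jp: "principal j ?p" using principal_sim[OF x p(1) j p(2)] .
    have 1: "\<not> nz j x y (t z y \<otimes> t x z)" if z: "z \<in> I" "z \<noteq> ?p" for z
      using that t(2)[OF x z(1) j] nz_comp[OF J x z(1) y t(1) t(1)] x y by (auto simp: S_def)
    have 2: "nz j x y (t ?p y \<otimes> t x ?p) \<longleftrightarrow> y = x"
      using t(2)[OF x p(1) j] t(2)[OF p(1) y jp] j jp p nz_comp[OF J x p(1) y t(1) t(1)] x y
      by (auto simp: S_def)
    show "nz j x y (e y \<otimes> (s \<otimes> s) \<otimes> e x) \<longleftrightarrow> y = x"
    proof (cases "y = x")
      case True
      then show ?thesis unfolding eq using nz_finsum_one[OF fin_I J x y th p(1)] 1 2 by auto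
    next
      case False
      have "t z y \<otimes> t x z \<in> hm x y \<and> \<not> nz j x y (t z y \<otimes> t x z)" if z: "z \<in> I" for z
        using th[OF z] 1[OF z] 2 False by (cases "z = ?p") auto
      then have "\<not> nz j x y (\<Oplus>z\<in>I. t z y \<otimes> t x z)" by (rule nz_finsum_not[OF fin_I J x y])
      then show ?thesis unfolding eq using False by simp
    qed
  qed
  then have sU: "s \<in> Units E" using sE unit_factor_square by blast
  moreover have "e y \<otimes> s \<otimes> e x = \<zero>" if "x \<in> I" "y \<in> I" "\<forall>j. rel j x \<longrightarrow> \<pi> j x \<noteq> y" for x y
    using comp[OF that(1,2)] t(3)[OF that(1,2)] that principalD(1) by (auto simp: S_def)
  ultimately show ?thesis by blast
qed

text \<open>
  The hypothesis \<open>dim\<close> is a dimension bound: if the identity matrix of a set \<open>A\<close> of relevant objects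
  factors through \<open>B\<close> modulo $P_j$, then \<open>A\<close> has at most as many members as \<open>B\<close>. It is applied to
  the members of one class in the two colours, with an involution \<open>s\<close> that exchanges the colours.
\<close>

lemma class_card_le:
  assumes s: "s \<in> carrier E" "s \<otimes> s = \<one>"
    and odd: "\<And>x y. \<lbrakk>x \<in> I; y \<in> I; c x = c y\<rbrakk> \<Longrightarrow> e y \<otimes> s \<otimes> e x = \<zero>"
    and dim: "\<And>A B p q. \<lbrakk>A \<subseteq> I; B \<subseteq> I; p \<in> carrier E; q \<in> carrier E; \<And>k. k \<in> A \<Longrightarrow> rel j k;
      \<And>k k'. \<lbrakk>k \<in> A; k' \<in> A\<rbrakk> \<Longrightarrow>
        \<not> nz j k' k (e k \<otimes> p \<otimes> (\<Oplus>l\<in>B. e l) \<otimes> (q \<otimes> e k') \<ominus> (if k = k' then e k else \<zero>))\<rbrakk>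
      \<Longrightarrow> card A \<le> card B"
    and j: "j \<in> J" and z: "z \<in> I"
  shows "card {x \<in> I. sim j z x \<and> c x = b} \<le> card {x \<in> I. sim j z x \<and> c x = (\<not> b)}"
proof (rule dim[of _ _ s s])
  let ?A = "{x \<in> I. sim j z x \<and> c x = b}"
  let ?B = "{x \<in> I. sim j z x \<and> c x = (\<not> b)}"
  show "rel j k" if "k \<in> ?A" for k using sim_rel[OF j z] that by blast
  fix k k' assume k: "k \<in> ?A" and k': "k' \<in> ?A"
  have kI: "k \<in> I" "k' \<in> I" using k k' by auto
  have E: "e k \<in> carrier E" "e k' \<in> carrier E" using kI e_closed by auto
  define X where "X l = (e k \<otimes> s \<otimes> e l) \<otimes> (e l \<otimes> (s \<otimes> e k'))" for l
  have Xl: "X l = (e k \<otimes> s \<otimes> e l) \<otimes> (e l \<otimes> s \<otimes> e k')" if "l \<in> I" for l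
    unfolding X_def using E s e_closed[OF that] by (simp add: m_assoc)
  have XE: "X l \<in> carrier E" if "l \<in> I" for l unfolding X_def using E s e_closed[OF that] by simp
  have sB: "e k \<otimes> s \<otimes> (\<Oplus>l\<in>?B. e l) \<otimes> (s \<otimes> e k') = (\<Oplus>l\<in>?B. X l)"
    unfolding X_def using E s by (intro expand_middle) auto
  have "(\<Oplus>l\<in>I. X l) = (e k \<otimes> s) \<otimes> (s \<otimes> e k')"
    unfolding X_def using E s expand_mult[of "e k \<otimes> s" "s \<otimes> e k'"] by simp
  also have "\<dots> = e k \<otimes> (s \<otimes> s) \<otimes> e k'" using E s(1) by (simp add: m_assoc)
  also have "\<dots> = (if k = k' then e k else \<zero>)" using E s(2) kI e_idem e_orth by simp
  finally have sI: "(\<Oplus>l\<in>I. X l) = (if k = k' then e k else \<zero>)" .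
  have "(\<Oplus>l\<in>?B \<union> (I - ?B). X l) = (\<Oplus>l\<in>?B. X l) \<oplus> (\<Oplus>l\<in>I - ?B. X l)"
    using XE fin_I by (intro finsum_Un_disjoint) auto
  then have split: "(\<Oplus>l\<in>I. X l) = (\<Oplus>l\<in>?B. X l) \<oplus> (\<Oplus>l\<in>I - ?B. X l)"
    by (simp add: Un_absorb1)
  have c: "(\<Oplus>l\<in>?B. X l) \<in> carrier E" "(\<Oplus>l\<in>I - ?B. X l) \<in> carrier E"
    using XE by (auto intro!: finsum_closed)
  have "a \<ominus> (a \<oplus> b) = \<ominus> b" if "a \<in> carrier E" "b \<in> carrier E" for a b
    using that by algebra
  then have "(\<Oplus>l\<in>?B. X l) \<ominus> (\<Oplus>l\<in>I. X l) = \<ominus> (\<Oplus>l\<in>I - ?B. X l)"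
    unfolding split using c by blast
  then have eq: "e k \<otimes> s \<otimes> (\<Oplus>l\<in>?B. e l) \<otimes> (s \<otimes> e k') \<ominus> (if k = k' then e k else \<zero>)
      = \<ominus> (\<Oplus>l\<in>I - ?B. X l)" using sB sI by simp
  have nX: "X l \<in> hm k' k \<and> \<not> nz j k' k (X l)" if l: "l \<in> I - ?B" for l
  proof -
    have lI: "l \<in> I" using l by simp
    have 1: "e k \<otimes> s \<otimes> e l \<in> hm l k" "e l \<otimes> s \<otimes> e k' \<in> hm k' l" using hm_comp lI kI s by auto
    have "\<not> nz j k' k (X l)"
    proof (cases "c l = b")
      case True
      then have "e l \<otimes> s \<otimes> e k' = \<zero>" using odd[OF kI(2) lI] k' by simp
      then show ?thesis using Xl[OF lI] 1 nz_zero[OF j kI(2,1)] hmD(1) by simp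
    next
      case False
      then have ns: "\<not> sim j z l" using l by auto
      show ?thesis
      proof
        assume "nz j k' k (X l)"
        then have n: "nz j l k (e k \<otimes> s \<otimes> e l)" "nz j k' l (e l \<otimes> s \<otimes> e k')"
          using Xl[OF lI] nz_comp[OF j kI(2) lI kI(1) 1] by auto
        have "sim j k' k" using sim_trans[OF j kI(2) z kI(1)] sim_sym k k' by blast
        then obtain a where a: "a \<in> hm k k'" "nz j k k' a" by (auto simp: sim_def)
        have "a \<otimes> (e k \<otimes> s \<otimes> e l) \<in> hm l k'" "nz j l k' (a \<otimes> (e k \<otimes> s \<otimes> e l))"
          using a n 1 j lI kI by (auto simp: hm_mult nz_comp)
        then have "sim j k' l" using n 1 by (auto simp: sim_def)
        then show False using ns sim_trans[OF j z kI(2) lI] k' by blast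
      qed
    qed
    then show ?thesis using Xl[OF lI] hm_mult[OF kI(2) lI kI(1) 1] by simp
  qed
  have "\<not> nz j k' k (\<Oplus>l\<in>I - ?B. X l)" using nz_finsum_not[OF _ j kI(2,1)] nX fin_I by blast
  moreover have "(\<Oplus>l\<in>I - ?B. X l) \<in> hm k' k" using hm_finsum[OF _ kI(2,1)] nX fin_I by blast
  ultimately show "\<not> nz j k' k (e k \<otimes> s \<otimes> (\<Oplus>l\<in>?B. e l) \<otimes> (s \<otimes> e k') \<ominus> (if k = k' then e k else \<zero>))"
    unfolding eq using nz_minus j kI by simp
qed (use s in auto)

end

lemma bij_betw_respecting_classes:
  assumes "finite X" "finite Y"
    and refl: "\<And>x. x \<in> X \<union> Y \<Longrightarrow> R x x"
    and sym: "\<And>x y. \<lbrakk>x \<in> X \<union> Y; y \<in> X \<union> Y; R x y\<rbrakk> \<Longrightarrow> R y x"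
    and trans: "\<And>x y z. \<lbrakk>x \<in> X \<union> Y; y \<in> X \<union> Y; z \<in> X \<union> Y; R x y; R y z\<rbrakk> \<Longrightarrow> R x z"
    and card: "\<And>z. z \<in> X \<union> Y \<Longrightarrow> card {x \<in> X. R z x} = card {y \<in> Y. R z y}"
  shows "\<exists>\<phi>. bij_betw \<phi> X Y \<and> (\<forall>x\<in>X. R x (\<phi> x))"
  using assms
proof (induction X arbitrary: Y rule: finite_induct)
  case empty
  have "Y = {}"
  proof (rule ccontr)
    assume "Y \<noteq> {}"
    then obtain y where y: "y \<in> Y" by blast
    then have "y \<in> {y' \<in> Y. R y y'}" using empty.prems(2) by blast
    then show False using empty.prems(1) empty.prems(5)[of y] y by auto
  qed
  then show ?case by (auto simp: bij_betw_def)
next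
  case (insert x X Y)
  note finY = insert.prems(1) and refl = insert.prems(2) and sym = insert.prems(3)
    and tr = insert.prems(4) and cd = insert.prems(5)
  have "x \<in> {x' \<in> insert x X. R x x'}" using refl by blast
  then have "card {x' \<in> insert x X. R x x'} \<noteq> 0" using insert.hyps by (auto simp: card_eq_0_iff)
  then have "{y \<in> Y. R x y} \<noteq> {}" using cd[of x] by (metis UnI1 card.empty insertI1)
  then obtain y where y: "y \<in> Y" "R x y" by blast
  have Rxy: "R z x \<longleftrightarrow> R z y" if z: "z \<in> insert x X \<union> Y" for z
    using tr[of z x y] tr[of z y x] sym[of x y] y z by blast
  have "\<exists>\<phi>. bij_betw \<phi> X (Y - {y}) \<and> (\<forall>x\<in>X. R x (\<phi> x))"
  proof (rule insert.IH)
    show "finite (Y - {y})" using finY by simp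
    show "card {x \<in> X. R z x} = card {w \<in> Y - {y}. R z w}" if z: "z \<in> X \<union> (Y - {y})" for z
    proof -
      have zz: "z \<in> insert x X \<union> Y" using z by auto
      have eq: "card {x' \<in> insert x X. R z x'} = card {w \<in> Y. R z w}" using cd[OF zz] .
      show ?thesis
      proof (cases "R z x")
        case True
        have "{x' \<in> insert x X. R z x'} = insert x {x' \<in> X. R z x'}" using True by auto
        moreover have "{w \<in> Y. R z w} = insert y {w \<in> Y - {y}. R z w}" using True Rxy[OF zz] y by auto
        ultimately show ?thesis using eq insert.hyps finY by simp
      next
        case False
        have "{x' \<in> insert x X. R z x'} = {x' \<in> X. R z x'}" using False by auto
        moreover have "{w \<in> Y. R z w} = {w \<in> Y - {y}. R z w}" using False Rxy[OF zz] by auto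
        ultimately show ?thesis using eq by simp
      qed
    qed
  qed (use refl sym tr in blast)+
  then obtain \<phi> where \<phi>: "bij_betw \<phi> X (Y - {y})" "\<forall>x\<in>X. R x (\<phi> x)" by blast
  let ?\<psi> = "\<phi>(x := y)"
  have "bij_betw ?\<psi> X (Y - {y})" using \<phi>(1) insert.hyps(2) by (metis bij_betw_cong fun_upd_other)
  then have "bij_betw ?\<psi> (insert x X) (insert y (Y - {y}))"
    using notIn_Un_bij_betw[of x X ?\<psi> "Y - {y}"] insert.hyps(2) by simp
  then have "bij_betw ?\<psi> (insert x X) Y" using y by (simp add: insert_absorb)
  moreover have "\<forall>x'\<in>insert x X. R x' (?\<psi> x')" using \<phi>(2) y insert.hyps(2) by auto
  ultimately show ?case by blast
qed

section \<open>Right modules, filtrations and endomorphism rings\<close>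

context right_module
begin

lemma neg_zero: "\<ominus>\<^bsub>M\<^esub> \<zero>\<^bsub>M\<^esub> = \<zero>\<^bsub>M\<^esub>"
  using M.minus_equality[of "\<zero>\<^bsub>M\<^esub>" "\<zero>\<^bsub>M\<^esub>"] by simp

lemma eq_of_diff_zero:
  assumes "x \<in> carrier M" "y \<in> carrier M" "x \<ominus>\<^bsub>M\<^esub> y = \<zero>\<^bsub>M\<^esub>"
  shows "x = y"
proof -
  have "x = (x \<ominus>\<^bsub>M\<^esub> y) \<oplus>\<^bsub>M\<^esub> y" using assms(1,2) by (simp add: M.minus_eq M.a_assoc M.l_neg)
  then show ?thesis using assms by simp
qed

lemma smult_zero_right: "a \<in> carrier R \<Longrightarrow> a \<odot>\<^bsub>M\<^esub> \<zero>\<^bsub>M\<^esub> = \<zero>\<^bsub>M\<^esub>"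
proof -
  assume a: "a \<in> carrier R"
  have "a \<odot>\<^bsub>M\<^esub> (\<zero>\<^bsub>M\<^esub> \<oplus>\<^bsub>M\<^esub> \<zero>\<^bsub>M\<^esub>) = a \<odot>\<^bsub>M\<^esub> \<zero>\<^bsub>M\<^esub> \<oplus>\<^bsub>M\<^esub> a \<odot>\<^bsub>M\<^esub> \<zero>\<^bsub>M\<^esub>"
    using a by (intro rsmult_distr_module) auto
  then have "a \<odot>\<^bsub>M\<^esub> \<zero>\<^bsub>M\<^esub> = a \<odot>\<^bsub>M\<^esub> \<zero>\<^bsub>M\<^esub> \<oplus>\<^bsub>M\<^esub> a \<odot>\<^bsub>M\<^esub> \<zero>\<^bsub>M\<^esub>" by simp
  then show ?thesis
    using M.add.l_cancel_one'[of "a \<odot>\<^bsub>M\<^esub> \<zero>\<^bsub>M\<^esub>" "a \<odot>\<^bsub>M\<^esub> \<zero>\<^bsub>M\<^esub>"] a rsmult_closed by simp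
qed

lemma smult_zero_left: "x \<in> carrier M \<Longrightarrow> \<zero>\<^bsub>R\<^esub> \<odot>\<^bsub>M\<^esub> x = \<zero>\<^bsub>M\<^esub>"
proof -
  assume x: "x \<in> carrier M"
  have "(\<zero>\<^bsub>R\<^esub> \<oplus>\<^bsub>R\<^esub> \<zero>\<^bsub>R\<^esub>) \<odot>\<^bsub>M\<^esub> x = \<zero>\<^bsub>R\<^esub> \<odot>\<^bsub>M\<^esub> x \<oplus>\<^bsub>M\<^esub> \<zero>\<^bsub>R\<^esub> \<odot>\<^bsub>M\<^esub> x"
    using x by (intro rsmult_distr_ring) auto
  then have "\<zero>\<^bsub>R\<^esub> \<odot>\<^bsub>M\<^esub> x = \<zero>\<^bsub>R\<^esub> \<odot>\<^bsub>M\<^esub> x \<oplus>\<^bsub>M\<^esub> \<zero>\<^bsub>R\<^esub> \<odot>\<^bsub>M\<^esub> x" by simp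
  then show ?thesis
    using M.add.l_cancel_one'[of "\<zero>\<^bsub>R\<^esub> \<odot>\<^bsub>M\<^esub> x" "\<zero>\<^bsub>R\<^esub> \<odot>\<^bsub>M\<^esub> x"] x rsmult_closed by simp
qed

lemma smult_neg_one: "x \<in> carrier M \<Longrightarrow> (\<ominus>\<^bsub>R\<^esub> \<one>\<^bsub>R\<^esub>) \<odot>\<^bsub>M\<^esub> x = \<ominus>\<^bsub>M\<^esub> x"
proof -
  assume x: "x \<in> carrier M"
  have "(\<ominus>\<^bsub>R\<^esub> \<one>\<^bsub>R\<^esub>) \<odot>\<^bsub>M\<^esub> x \<oplus>\<^bsub>M\<^esub> \<one>\<^bsub>R\<^esub> \<odot>\<^bsub>M\<^esub> x = ((\<ominus>\<^bsub>R\<^esub> \<one>\<^bsub>R\<^esub>) \<oplus>\<^bsub>R\<^esub> \<one>\<^bsub>R\<^esub>) \<odot>\<^bsub>M\<^esub> x"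
    using x by (simp add: rsmult_distr_ring)
  also have "\<dots> = \<zero>\<^bsub>M\<^esub>" using x by (simp add: R.l_neg smult_zero_left)
  finally show ?thesis
    using x M.minus_equality[of "(\<ominus>\<^bsub>R\<^esub> \<one>\<^bsub>R\<^esub>) \<odot>\<^bsub>M\<^esub> x" x] by (simp add: rsmult_one rsmult_closed)
qed

lemma smult_minus: "\<lbrakk>a \<in> carrier R; x \<in> carrier M\<rbrakk> \<Longrightarrow> a \<odot>\<^bsub>M\<^esub> (\<ominus>\<^bsub>M\<^esub> x) = \<ominus>\<^bsub>M\<^esub> (a \<odot>\<^bsub>M\<^esub> x)"
proof -
  assume a: "a \<in> carrier R" and x: "x \<in> carrier M"
  have "a \<odot>\<^bsub>M\<^esub> (\<ominus>\<^bsub>M\<^esub> x) \<oplus>\<^bsub>M\<^esub> a \<odot>\<^bsub>M\<^esub> x = a \<odot>\<^bsub>M\<^esub> (\<ominus>\<^bsub>M\<^esub> x \<oplus>\<^bsub>M\<^esub> x)"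
    using a x by (simp add: rsmult_distr_module)
  also have "\<dots> = \<zero>\<^bsub>M\<^esub>" using a x by (simp add: M.l_neg smult_zero_right)
  finally show ?thesis
    using a x M.minus_equality[of "a \<odot>\<^bsub>M\<^esub> (\<ominus>\<^bsub>M\<^esub> x)" "a \<odot>\<^bsub>M\<^esub> x"] by (simp add: rsmult_closed)
qed

lemma smult_diff: "\<lbrakk>a \<in> carrier R; x \<in> carrier M; y \<in> carrier M\<rbrakk>
  \<Longrightarrow> a \<odot>\<^bsub>M\<^esub> (x \<ominus>\<^bsub>M\<^esub> y) = a \<odot>\<^bsub>M\<^esub> x \<ominus>\<^bsub>M\<^esub> a \<odot>\<^bsub>M\<^esub> y"
  by (simp add: M.minus_eq rsmult_distr_module smult_minus)

lemma submoduleD: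
  assumes "submodule X R M"
  shows "X \<subseteq> carrier M" "\<zero>\<^bsub>M\<^esub> \<in> X" "\<And>x y. \<lbrakk>x \<in> X; y \<in> X\<rbrakk> \<Longrightarrow> x \<oplus>\<^bsub>M\<^esub> y \<in> X"
    "\<And>x. x \<in> X \<Longrightarrow> \<ominus>\<^bsub>M\<^esub> x \<in> X" "\<And>x y. \<lbrakk>x \<in> X; y \<in> X\<rbrakk> \<Longrightarrow> x \<ominus>\<^bsub>M\<^esub> y \<in> X"
    "\<And>a x. \<lbrakk>a \<in> carrier R; x \<in> X\<rbrakk> \<Longrightarrow> a \<odot>\<^bsub>M\<^esub> x \<in> X"
proof -
  interpret X: submodule X R M by fact
  show 1: "X \<subseteq> carrier M" using X.subset by simp
  show "\<zero>\<^bsub>M\<^esub> \<in> X" using X.one_closed by simp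
  show 2: "\<And>x y. \<lbrakk>x \<in> X; y \<in> X\<rbrakk> \<Longrightarrow> x \<oplus>\<^bsub>M\<^esub> y \<in> X" using X.m_closed by simp
  show 3: "\<And>a x. \<lbrakk>a \<in> carrier R; x \<in> X\<rbrakk> \<Longrightarrow> a \<odot>\<^bsub>M\<^esub> x \<in> X" using X.smult_closed by simp
  show 4: "\<ominus>\<^bsub>M\<^esub> x \<in> X" if x: "x \<in> X" for x
  proof -
    have "x \<in> carrier M" using 1 x by blast
    moreover have "(\<ominus>\<^bsub>R\<^esub> \<one>\<^bsub>R\<^esub>) \<odot>\<^bsub>M\<^esub> x \<in> X" using 3 x by simp
    ultimately show ?thesis using smult_neg_one by simp
  qed
  show "x \<ominus>\<^bsub>M\<^esub> y \<in> X" if "x \<in> X" "y \<in> X" for x y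
    using 2 4 that by (simp add: M.minus_eq)
qed

lemma right_submoduleI:
  assumes "X \<subseteq> carrier M" "\<zero>\<^bsub>M\<^esub> \<in> X" "\<And>x y. \<lbrakk>x \<in> X; y \<in> X\<rbrakk> \<Longrightarrow> x \<oplus>\<^bsub>M\<^esub> y \<in> X"
    "\<And>a x. \<lbrakk>a \<in> carrier R; x \<in> X\<rbrakk> \<Longrightarrow> a \<odot>\<^bsub>M\<^esub> x \<in> X"
  shows "submodule X R M"
proof -
  have "subgroup X (add_monoid M)"
  proof (rule M.add.subgroupI)
    show "X \<noteq> {}" using assms(2) by blast
    show "\<ominus>\<^bsub>M\<^esub> x \<in> X" if x: "x \<in> X" for x
    proof -
      have "x \<in> carrier M" using assms(1) x by blast
      moreover have "(\<ominus>\<^bsub>R\<^esub> \<one>\<^bsub>R\<^esub>) \<odot>\<^bsub>M\<^esub> x \<in> X" using assms(4) x by simp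
      ultimately show ?thesis using smult_neg_one by simp
    qed
  qed (use assms in auto)
  then show ?thesis using assms(4) by (simp add: submodule_def submodule_axioms_def)
qed

end

lemma right_module_homD:
  assumes "right_module R M" "right_module R N" "f \<in> right_module_hom R M N"
  shows "x \<in> carrier M \<Longrightarrow> f x \<in> carrier N"
    "\<lbrakk>x \<in> carrier M; y \<in> carrier M\<rbrakk> \<Longrightarrow> f (x \<oplus>\<^bsub>M\<^esub> y) = f x \<oplus>\<^bsub>N\<^esub> f y"
    "\<lbrakk>a \<in> carrier R; x \<in> carrier M\<rbrakk> \<Longrightarrow> f (a \<odot>\<^bsub>M\<^esub> x) = a \<odot>\<^bsub>N\<^esub> f x"
    "f \<zero>\<^bsub>M\<^esub> = \<zero>\<^bsub>N\<^esub>"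
    "x \<in> carrier M \<Longrightarrow> f (\<ominus>\<^bsub>M\<^esub> x) = \<ominus>\<^bsub>N\<^esub> f x"
    "\<lbrakk>x \<in> carrier M; y \<in> carrier M\<rbrakk> \<Longrightarrow> f (x \<ominus>\<^bsub>M\<^esub> y) = f x \<ominus>\<^bsub>N\<^esub> f y"
proof -
  interpret M: right_module R M by fact
  interpret N: right_module R N by fact
  have f: "f \<in> hom (add_monoid M) (add_monoid N)"
    "\<forall>a\<in>carrier R. \<forall>x\<in>carrier M. f (a \<odot>\<^bsub>M\<^esub> x) = a \<odot>\<^bsub>N\<^esub> f x"
    using assms(3) by (auto simp: right_module_hom_def)
  show 1: "f x \<in> carrier N" if "x \<in> carrier M" for x using f(1) that by (auto simp: hom_def)
  show 2: "f (x \<oplus>\<^bsub>M\<^esub> y) = f x \<oplus>\<^bsub>N\<^esub> f y" if "x \<in> carrier M" "y \<in> carrier M" for x y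
    using f(1) that by (auto simp: hom_def)
  show 3: "f (a \<odot>\<^bsub>M\<^esub> x) = a \<odot>\<^bsub>N\<^esub> f x" if "a \<in> carrier R" "x \<in> carrier M" for a x using f(2) that by blast
  show "f \<zero>\<^bsub>M\<^esub> = \<zero>\<^bsub>N\<^esub>"
    using 3[of "\<zero>\<^bsub>R\<^esub>" "\<zero>\<^bsub>M\<^esub>"] 1[of "\<zero>\<^bsub>M\<^esub>"] by (simp add: M.smult_zero_left N.smult_zero_left)
  show 4: "f (\<ominus>\<^bsub>M\<^esub> x) = \<ominus>\<^bsub>N\<^esub> f x" if "x \<in> carrier M" for x
    using 3[of "\<ominus>\<^bsub>R\<^esub> \<one>\<^bsub>R\<^esub>" x] that 1[OF that] by (simp add: M.smult_neg_one N.smult_neg_one)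
  show "f (x \<ominus>\<^bsub>M\<^esub> y) = f x \<ominus>\<^bsub>N\<^esub> f y" if "x \<in> carrier M" "y \<in> carrier M" for x y
    using 2 4 that by (simp add: a_minus_def)
qed

context E_object
begin

lemma filt_closed:
  assumes "k \<le> n"
  shows "x \<in> filt M k \<Longrightarrow> x \<in> carrier M" "\<zero>\<^bsub>M\<^esub> \<in> filt M k"
    "\<lbrakk>x \<in> filt M k; y \<in> filt M k\<rbrakk> \<Longrightarrow> x \<oplus>\<^bsub>M\<^esub> y \<in> filt M k"
    "x \<in> filt M k \<Longrightarrow> \<ominus>\<^bsub>M\<^esub> x \<in> filt M k"
    "\<lbrakk>x \<in> filt M k; y \<in> filt M k\<rbrakk> \<Longrightarrow> x \<ominus>\<^bsub>M\<^esub> y \<in> filt M k"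
    "\<lbrakk>a \<in> carrier R; x \<in> filt M k\<rbrakk> \<Longrightarrow> a \<odot>\<^bsub>M\<^esub> x \<in> filt M k"
  using submoduleD[OF filt_submodule[OF assms]] by auto

lemma filt_le: "\<lbrakk>j \<le> k; k \<le> n\<rbrakk> \<Longrightarrow> filt M j \<subseteq> filt M k"
proof (induction k rule: dec_induct)
  case (step k)
  then show ?case using filt_mono[of k] by auto
qed simp

text \<open>Congruence modulo the \<open>k\<close>-th submodule of the filtration.\<close>

definition eqmod :: "nat \<Rightarrow> 'b \<Rightarrow> 'b \<Rightarrow> bool"
  where "eqmod k x y \<longleftrightarrow> x \<in> carrier M \<and> y \<in> carrier M \<and> x \<ominus>\<^bsub>M\<^esub> y \<in> filt M k"

lemma eqmodD: "eqmod k x y \<Longrightarrow> x \<in> carrier M" "eqmod k x y \<Longrightarrow> y \<in> carrier M" by (auto simp: eqmod_def)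

lemma eqmod_refl: "\<lbrakk>k \<le> n; x \<in> carrier M\<rbrakk> \<Longrightarrow> eqmod k x x"
  using filt_closed(2)[of k] by (simp add: eqmod_def M.r_neg M.minus_eq)

lemma eqmod_sym: assumes "k \<le> n" "eqmod k x y" shows "eqmod k y x"
proof -
  have c: "x \<in> carrier M" "y \<in> carrier M" using assms eqmodD by auto
  have "y \<ominus>\<^bsub>M\<^esub> x = \<ominus>\<^bsub>M\<^esub> (x \<ominus>\<^bsub>M\<^esub> y)" using c by (simp add: M.minus_eq M.minus_add M.a_comm)
  then show ?thesis using assms c filt_closed(4)[OF assms(1)] by (simp add: eqmod_def)
qed

lemma eqmod_add: assumes "k \<le> n" "eqmod k x y" "eqmod k x' y'" shows "eqmod k (x \<oplus>\<^bsub>M\<^esub> x') (y \<oplus>\<^bsub>M\<^esub> y')"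
proof -
  have c: "x \<in> carrier M" "y \<in> carrier M" "x' \<in> carrier M" "y' \<in> carrier M" using assms eqmodD by auto
  have "(x \<oplus>\<^bsub>M\<^esub> x') \<ominus>\<^bsub>M\<^esub> (y \<oplus>\<^bsub>M\<^esub> y') = (x \<ominus>\<^bsub>M\<^esub> y) \<oplus>\<^bsub>M\<^esub> (x' \<ominus>\<^bsub>M\<^esub> y')"
    using c by (simp add: M.minus_eq M.minus_add M.a_ac)
  then show ?thesis using assms c filt_closed(3)[OF assms(1)] by (simp add: eqmod_def)
qed

lemma eqmod_trans: assumes "k \<le> n" "eqmod k x y" "eqmod k y z" shows "eqmod k x z"
proof -
  have c: "x \<in> carrier M" "y \<in> carrier M" "z \<in> carrier M" using assms eqmodD by auto
  have "x \<ominus>\<^bsub>M\<^esub> z = (x \<ominus>\<^bsub>M\<^esub> y) \<oplus>\<^bsub>M\<^esub> (y \<ominus>\<^bsub>M\<^esub> z)"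
    using c by (simp add: M.minus_eq M.a_assoc M.r_neg1)
  then show ?thesis using assms c filt_closed(3)[OF assms(1)] by (simp add: eqmod_def)
qed

lemma eqmod_neg: assumes "k \<le> n" "eqmod k x y" shows "eqmod k (\<ominus>\<^bsub>M\<^esub> x) (\<ominus>\<^bsub>M\<^esub> y)"
proof -
  have c: "x \<in> carrier M" "y \<in> carrier M" using assms eqmodD by auto
  have "\<ominus>\<^bsub>M\<^esub> x \<ominus>\<^bsub>M\<^esub> \<ominus>\<^bsub>M\<^esub> y = \<ominus>\<^bsub>M\<^esub> (x \<ominus>\<^bsub>M\<^esub> y)" using c by (simp add: M.minus_eq M.minus_add)
  then show ?thesis using assms c filt_closed(4)[OF assms(1)] by (simp add: eqmod_def)
qed

lemma eqmod_smult: assumes "k \<le> n" "a \<in> carrier R" "eqmod k x y" shows "eqmod k (a \<odot>\<^bsub>M\<^esub> x) (a \<odot>\<^bsub>M\<^esub> y)"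
  using assms filt_closed(6)[OF assms(1,2)] by (auto simp: eqmod_def rsmult_closed smult_diff[symmetric])

lemma eqmod_zero: "k \<le> n \<Longrightarrow> eqmod k x \<zero>\<^bsub>M\<^esub> \<longleftrightarrow> x \<in> filt M k"
  using filt_closed(1)[of k x] by (auto simp: eqmod_def M.minus_eq neg_zero)

lemma eqmod_mem: assumes "k \<le> n" "eqmod k x y" shows "x \<in> filt M k \<longleftrightarrow> y \<in> filt M k"
  using eqmod_trans[OF assms(1), of x y "\<zero>\<^bsub>M\<^esub>"] eqmod_trans[OF assms(1), of y x "\<zero>\<^bsub>M\<^esub>"]
    eqmod_sym[OF assms] assms eqmod_zero[OF assms(1)] by blast

lemma eqmod_of_mem: "\<lbrakk>k \<le> n; x \<in> filt M k; y \<in> filt M k\<rbrakk> \<Longrightarrow> eqmod k x y"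
  using filt_closed(1)[of k] filt_closed(5)[of k] by (auto simp: eqmod_def)

end

lemma E_homD:
  assumes "E_object R n M" "E_object R n N" "f \<in> E_hom R n M N"
  shows "x \<in> carrier M \<Longrightarrow> f x \<in> carrier N"
    "\<lbrakk>x \<in> carrier M; y \<in> carrier M\<rbrakk> \<Longrightarrow> f (x \<oplus>\<^bsub>M\<^esub> y) = f x \<oplus>\<^bsub>N\<^esub> f y"
    "\<lbrakk>a \<in> carrier R; x \<in> carrier M\<rbrakk> \<Longrightarrow> f (a \<odot>\<^bsub>M\<^esub> x) = a \<odot>\<^bsub>N\<^esub> f x"
    "f \<zero>\<^bsub>M\<^esub> = \<zero>\<^bsub>N\<^esub>"
    "x \<in> carrier M \<Longrightarrow> f (\<ominus>\<^bsub>M\<^esub> x) = \<ominus>\<^bsub>N\<^esub> f x"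
    "\<lbrakk>x \<in> carrier M; y \<in> carrier M\<rbrakk> \<Longrightarrow> f (x \<ominus>\<^bsub>M\<^esub> y) = f x \<ominus>\<^bsub>N\<^esub> f y"
    "\<lbrakk>k \<le> n; x \<in> filt M k\<rbrakk> \<Longrightarrow> f x \<in> filt N k"
proof -
  interpret M: E_object R n M by fact
  interpret N: E_object R n N by fact
  have f: "f \<in> right_module_hom R M N" "\<forall>i\<in>{1..n}. f ` filt M i \<subseteq> filt N i"
    using assms(3) by (auto simp: E_hom_def)
  note h = right_module_homD[OF M.right_module_axioms N.right_module_axioms f(1)]
  show "x \<in> carrier M \<Longrightarrow> f x \<in> carrier N"
    "\<lbrakk>x \<in> carrier M; y \<in> carrier M\<rbrakk> \<Longrightarrow> f (x \<oplus>\<^bsub>M\<^esub> y) = f x \<oplus>\<^bsub>N\<^esub> f y"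
    "\<lbrakk>a \<in> carrier R; x \<in> carrier M\<rbrakk> \<Longrightarrow> f (a \<odot>\<^bsub>M\<^esub> x) = a \<odot>\<^bsub>N\<^esub> f x"
    "f \<zero>\<^bsub>M\<^esub> = \<zero>\<^bsub>N\<^esub>"
    "x \<in> carrier M \<Longrightarrow> f (\<ominus>\<^bsub>M\<^esub> x) = \<ominus>\<^bsub>N\<^esub> f x"
    "\<lbrakk>x \<in> carrier M; y \<in> carrier M\<rbrakk> \<Longrightarrow> f (x \<ominus>\<^bsub>M\<^esub> y) = f x \<ominus>\<^bsub>N\<^esub> f y"
    using h by auto
  show "f x \<in> filt N k" if "k \<le> n" "x \<in> filt M k"
  proof (cases "k = 0")
    case True
    then show ?thesis using that h(4) M.filt_0 N.filt_0 by simp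
  next
    case False
    then have "k \<in> {1..n}" using that by simp
    then show ?thesis using that(2) f(2) by blast
  qed
qed

lemma E_homI:
  assumes "E_object R n M" "E_object R n N"
    and "\<And>x. x \<in> carrier M \<Longrightarrow> f x \<in> carrier N"
    "\<And>x y. \<lbrakk>x \<in> carrier M; y \<in> carrier M\<rbrakk> \<Longrightarrow> f (x \<oplus>\<^bsub>M\<^esub> y) = f x \<oplus>\<^bsub>N\<^esub> f y"
    "\<And>a x. \<lbrakk>a \<in> carrier R; x \<in> carrier M\<rbrakk> \<Longrightarrow> f (a \<odot>\<^bsub>M\<^esub> x) = a \<odot>\<^bsub>N\<^esub> f x"
    "\<And>k x. \<lbrakk>k \<le> n; x \<in> filt M k\<rbrakk> \<Longrightarrow> f x \<in> filt N k"
  shows "f \<in> E_hom R n M N"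
  using assms by (auto simp: E_hom_def right_module_hom_def hom_def)

lemma E_hom_comp:
  assumes "E_object R n M" "E_object R n N" "E_object R n K" "f \<in> E_hom R n M N" "g \<in> E_hom R n N K"
  shows "g \<circ> f \<in> E_hom R n M K"
  using E_homD[OF assms(1,2,4)] E_homD[OF assms(2,3,5)]
  by (intro E_homI[OF assms(1,3)]) auto

lemma E_hom_cong:
  assumes "E_object R n M" "E_object R n N" "f \<in> E_hom R n M N" "\<And>x. x \<in> carrier M \<Longrightarrow> g x = f x"
  shows "g \<in> E_hom R n M N"
proof -
  interpret M: E_object R n M by fact
  note f = E_homD[OF assms(1-3)]
  show ?thesis
    using f assms(4) M.filt_closed(1)
    by (intro E_homI[OF assms(1,2)]) (auto simp: M.rsmult_closed)
qed

lemma E_hom_restrict: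
  assumes "E_object R n M" "E_object R n N" "f \<in> E_hom R n M N"
  shows "restrict f (carrier M) \<in> E_hom R n M N"
  using E_hom_cong[OF assms] by simp

text \<open>
  The endomorphism ring of an object. Endomorphisms are represented by extensional functions, so that
  equality in the ring is equality on the carrier.
\<close>

definition E_end_ring ::
  "('a, 'x) ring_scheme \<Rightarrow> nat \<Rightarrow> ('a, 'b, 'y) filtered_module_scheme \<Rightarrow> ('b \<Rightarrow> 'b) ring"
  where "E_end_ring R n M =
    \<lparr>carrier = E_hom R n M M \<inter> extensional (carrier M),
     mult = (\<lambda>f g. \<lambda>x\<in>carrier M. f (g x)), one = (\<lambda>x\<in>carrier M. x),
     zero = (\<lambda>x\<in>carrier M. \<zero>\<^bsub>M\<^esub>), add = (\<lambda>f g. \<lambda>x\<in>carrier M. f x \<oplus>\<^bsub>M\<^esub> g x)\<rparr>"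

context E_object
begin

abbreviation "EE \<equiv> E_end_ring R n M"

lemma end_carrier: "h \<in> carrier EE \<longleftrightarrow> h \<in> E_hom R n M M \<and> h \<in> extensional (carrier M)"
  by (simp add: E_end_ring_def)

lemma endD:
  assumes "h \<in> carrier EE"
  shows "x \<in> carrier M \<Longrightarrow> h x \<in> carrier M"
    "\<lbrakk>x \<in> carrier M; y \<in> carrier M\<rbrakk> \<Longrightarrow> h (x \<oplus>\<^bsub>M\<^esub> y) = h x \<oplus>\<^bsub>M\<^esub> h y"
    "\<lbrakk>a \<in> carrier R; x \<in> carrier M\<rbrakk> \<Longrightarrow> h (a \<odot>\<^bsub>M\<^esub> x) = a \<odot>\<^bsub>M\<^esub> h x"
    "h \<zero>\<^bsub>M\<^esub> = \<zero>\<^bsub>M\<^esub>"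
    "x \<in> carrier M \<Longrightarrow> h (\<ominus>\<^bsub>M\<^esub> x) = \<ominus>\<^bsub>M\<^esub> h x"
    "\<lbrakk>x \<in> carrier M; y \<in> carrier M\<rbrakk> \<Longrightarrow> h (x \<ominus>\<^bsub>M\<^esub> y) = h x \<ominus>\<^bsub>M\<^esub> h y"
    "\<lbrakk>k \<le> n; x \<in> filt M k\<rbrakk> \<Longrightarrow> h x \<in> filt M k"
  using E_homD[OF E_object_axioms E_object_axioms, of h] assms by (auto simp: end_carrier)

lemma endI:
  assumes "\<And>x. x \<in> carrier M \<Longrightarrow> f x \<in> carrier M"
    "\<And>x y. \<lbrakk>x \<in> carrier M; y \<in> carrier M\<rbrakk> \<Longrightarrow> f (x \<oplus>\<^bsub>M\<^esub> y) = f x \<oplus>\<^bsub>M\<^esub> f y"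
    "\<And>a x. \<lbrakk>a \<in> carrier R; x \<in> carrier M\<rbrakk> \<Longrightarrow> f (a \<odot>\<^bsub>M\<^esub> x) = a \<odot>\<^bsub>M\<^esub> f x"
    "\<And>k x. \<lbrakk>k \<le> n; x \<in> filt M k\<rbrakk> \<Longrightarrow> f x \<in> filt M k"
  shows "(\<lambda>x\<in>carrier M. f x) \<in> carrier EE"
  using E_hom_restrict[OF E_object_axioms E_object_axioms E_homI[OF E_object_axioms E_object_axioms assms]]
  by (simp add: end_carrier)

lemma end_eqI: "\<lbrakk>f \<in> carrier EE; g \<in> carrier EE; \<And>x. x \<in> carrier M \<Longrightarrow> f x = g x\<rbrakk> \<Longrightarrow> f = g"
  by (auto simp: end_carrier intro: extensionalityI)

lemma end_eval:
  "x \<in> carrier M \<Longrightarrow> (f \<otimes>\<^bsub>EE\<^esub> g) x = f (g x)"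
  "x \<in> carrier M \<Longrightarrow> (f \<oplus>\<^bsub>EE\<^esub> g) x = f x \<oplus>\<^bsub>M\<^esub> g x"
  "x \<in> carrier M \<Longrightarrow> \<one>\<^bsub>EE\<^esub> x = x"
  "x \<in> carrier M \<Longrightarrow> \<zero>\<^bsub>EE\<^esub> x = \<zero>\<^bsub>M\<^esub>"
  by (simp_all add: E_end_ring_def)

lemma end_closed:
  "\<lbrakk>f \<in> carrier EE; g \<in> carrier EE\<rbrakk> \<Longrightarrow> f \<otimes>\<^bsub>EE\<^esub> g \<in> carrier EE"
  "\<lbrakk>f \<in> carrier EE; g \<in> carrier EE\<rbrakk> \<Longrightarrow> f \<oplus>\<^bsub>EE\<^esub> g \<in> carrier EE"
  "\<one>\<^bsub>EE\<^esub> \<in> carrier EE" "\<zero>\<^bsub>EE\<^esub> \<in> carrier EE"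
proof -
  show "f \<otimes>\<^bsub>EE\<^esub> g \<in> carrier EE" if fg: "f \<in> carrier EE" "g \<in> carrier EE"
  proof -
    have "(\<lambda>x\<in>carrier M. f (g x)) \<in> carrier EE"
      using endD[OF fg(1)] endD[OF fg(2)] by (intro endI) auto
    then show ?thesis by (simp add: E_end_ring_def)
  qed
  show "f \<oplus>\<^bsub>EE\<^esub> g \<in> carrier EE" if fg: "f \<in> carrier EE" "g \<in> carrier EE"
  proof -
    have "(\<lambda>x\<in>carrier M. f x \<oplus>\<^bsub>M\<^esub> g x) \<in> carrier EE"
      using endD[OF fg(1)] endD[OF fg(2)] filt_closed(3)
      by (intro endI) (auto simp: M.a_ac rsmult_distr_module)
    then show ?thesis by (simp add: E_end_ring_def)
  qed
  have "(\<lambda>x\<in>carrier M. x) \<in> carrier EE" by (intro endI) auto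
  then show "\<one>\<^bsub>EE\<^esub> \<in> carrier EE" by (simp add: E_end_ring_def)
  have "(\<lambda>x\<in>carrier M. \<zero>\<^bsub>M\<^esub>) \<in> carrier EE"
    using filt_closed(2) by (intro endI) (auto simp: smult_zero_right)
  then show "\<zero>\<^bsub>EE\<^esub> \<in> carrier EE" by (simp add: E_end_ring_def)
qed

lemma ring_end: "ring EE"
proof (rule ringI)
  show "abelian_group EE"
  proof (rule abelian_groupI)
    fix f assume f: "f \<in> carrier EE"
    have "(\<lambda>x\<in>carrier M. \<ominus>\<^bsub>M\<^esub> f x) \<in> carrier EE"
      using endD[OF f] filt_closed(4)
      by (intro endI) (auto simp: M.minus_add M.a_ac smult_minus)
    moreover have "(\<lambda>x\<in>carrier M. \<ominus>\<^bsub>M\<^esub> f x) \<oplus>\<^bsub>EE\<^esub> f = \<zero>\<^bsub>EE\<^esub>"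
      using endD[OF f] by (auto simp: E_end_ring_def M.l_neg restrict_def)
    ultimately show "\<exists>g\<in>carrier EE. g \<oplus>\<^bsub>EE\<^esub> f = \<zero>\<^bsub>EE\<^esub>" by blast
  qed (auto intro!: end_eqI simp: end_closed end_eval endD M.a_ac)
  show "Group.monoid EE"
    by (rule monoidI) (auto intro!: end_eqI simp: end_closed end_eval endD)
qed (auto intro!: end_eqI simp: end_closed end_eval endD)

lemma end_neg: "\<lbrakk>f \<in> carrier EE; x \<in> carrier M\<rbrakk> \<Longrightarrow> (\<ominus>\<^bsub>EE\<^esub> f) x = \<ominus>\<^bsub>M\<^esub> f x"
proof -
  assume f: "f \<in> carrier EE" and x: "x \<in> carrier M"
  interpret EE: ring EE by (rule ring_end)
  have "(\<ominus>\<^bsub>EE\<^esub> f) x \<oplus>\<^bsub>M\<^esub> f x = \<zero>\<^bsub>M\<^esub>"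
    using end_eval(2)[OF x, of "\<ominus>\<^bsub>EE\<^esub> f" f] end_eval(4)[OF x] f by (simp add: EE.l_neg)
  then show ?thesis
    using M.minus_equality endD(1)[OF f x] endD(1)[OF EE.a_inv_closed[OF f] x] by simp
qed

lemma end_diff: "\<lbrakk>f \<in> carrier EE; g \<in> carrier EE; x \<in> carrier M\<rbrakk> \<Longrightarrow> (f \<ominus>\<^bsub>EE\<^esub> g) x = f x \<ominus>\<^bsub>M\<^esub> g x"
  by (simp add: a_minus_def end_eval end_neg)

lemma end_eqmod: "\<lbrakk>k \<le> n; h \<in> carrier EE; eqmod k x y\<rbrakk> \<Longrightarrow> eqmod k (h x) (h y)"
  using endD(1,6,7)[of h] unfolding eqmod_def by metis

lemma end_finsum_mem:
  assumes "finite B" "\<And>l. l \<in> B \<Longrightarrow> f l \<in> carrier EE" "submodule X R M" "t \<in> carrier M"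
    "\<And>l. l \<in> B \<Longrightarrow> f l t \<in> X"
  shows "(finsum EE f B) t \<in> X"
proof -
  interpret EE: ring EE by (rule ring_end)
  show ?thesis using assms
  proof (induction B rule: finite_induct)
    case empty
    then show ?case using submoduleD(2) by (simp add: end_eval)
  next
    case (insert l B)
    then have "finsum EE f (insert l B) = f l \<oplus>\<^bsub>EE\<^esub> finsum EE f B"
      by (intro EE.finsum_insert) auto
    then show ?case using insert submoduleD(3) by (simp add: end_eval)
  qed
qed

end

section \<open>Endomorphisms of an object decomposed into summands with uniserial factors\<close>

text \<open>
  The $2n$ ideals are numbered by naturals: the indices \<open>2 * i\<close> and \<open>2 * i + 1\<close>, for
  $i = 1, \dots, n$, stand for $P_{i,m}$ and $P_{i,e}$.
\<close>

definition layer_indices :: "nat \<Rightarrow> nat set"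
  where "layer_indices n = {2..2 * n + 1}"

lemma layer_indices_iff: "2 * i \<in> layer_indices n \<longleftrightarrow> i \<in> {1..n}" "Suc (2 * i) \<in> layer_indices n \<longleftrightarrow> i \<in> {1..n}"
  by (auto simp: layer_indices_def)

text \<open>
  An internal direct sum decomposition of \<open>T\<close> into summands $e_x T$ with uniserial factors. Instead of
  $\sum_x e_x = 1$ only joint injectivity of the \<open>e x\<close> is required. Uniseriality is stated in terms of
  elements: of two elements of a factor of a summand, one is a multiple of the other.
\<close>

locale decomposed_object = E_object R n T
  for R :: "('a, 'x) ring_scheme" (structure)
    and n :: nat
    and T :: "('a, 'b, 'y) filtered_module_scheme" (structure) +
  fixes I :: "'i set" and e :: "'i \<Rightarrow> 'b \<Rightarrow> 'b"
  assumes finite_I: "finite I"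
    and e_end: "x \<in> I \<Longrightarrow> e x \<in> carrier (E_end_ring R n T)"
    and e_e: "\<lbrakk>x \<in> I; t \<in> carrier T\<rbrakk> \<Longrightarrow> e x (e x t) = e x t"
    and e_other: "\<lbrakk>x \<in> I; y \<in> I; x \<noteq> y; t \<in> carrier T\<rbrakk> \<Longrightarrow> e x (e y t) = \<zero>\<^bsub>T\<^esub>"
    and e_faithful: "\<lbrakk>t \<in> carrier T; \<And>x. x \<in> I \<Longrightarrow> e x t = \<zero>\<^bsub>T\<^esub>\<rbrakk> \<Longrightarrow> t = \<zero>\<^bsub>T\<^esub>"
    and e_uniserial: "\<lbrakk>x \<in> I; i \<in> {1..n}; u \<in> filt T i; v \<in> filt T i\<rbrakk> \<Longrightarrow>
      (\<exists>a\<in>carrier R. e x u \<ominus>\<^bsub>T\<^esub> a \<odot>\<^bsub>T\<^esub> e x v \<in> filt T (i - 1)) \<or>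
      (\<exists>a\<in>carrier R. e x v \<ominus>\<^bsub>T\<^esub> a \<odot>\<^bsub>T\<^esub> e x u \<in> filt T (i - 1))"
begin

sublocale EE: ring EE by (rule ring_end)

text \<open>The \<open>i\<close>-th factor of the summand \<open>x\<close> is nonzero.\<close>

definition part_nonzero :: "nat \<Rightarrow> 'i \<Rightarrow> bool"
  where "part_nonzero i x \<longleftrightarrow> (\<exists>u\<in>filt T i. e x u \<notin> filt T (i - 1))"

text \<open>
  For a morphism \<open>h\<close> out of \<open>x\<close>: the \<open>i\<close>-th factor of \<open>x\<close> is nonzero and \<open>h\<close> induces an injective
  map on it.
\<close>

definition part_mono :: "nat \<Rightarrow> 'i \<Rightarrow> ('b \<Rightarrow> 'b) \<Rightarrow> bool"
  where "part_mono i x h \<longleftrightarrow> part_nonzero i x \<and>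
    (\<forall>u\<in>filt T i. h u \<in> filt T (i - 1) \<longrightarrow> e x u \<in> filt T (i - 1))"

text \<open>
  For a morphism \<open>h\<close> into \<open>y\<close>: the \<open>i\<close>-th factor of \<open>y\<close> is nonzero and \<open>h\<close> induces a surjective map
  onto it.
\<close>

definition part_epi :: "nat \<Rightarrow> 'i \<Rightarrow> ('b \<Rightarrow> 'b) \<Rightarrow> bool"
  where "part_epi i y h \<longleftrightarrow> part_nonzero i y \<and>
    (\<forall>v\<in>filt T i. \<exists>u\<in>filt T i. eqmod (i - 1) (h u) (e y v))"

text \<open>
  The morphisms from \<open>x\<close> to \<open>y\<close>. This is the set \<open>hm x y\<close> of the system of ideals below, needed before
  the latter is known to exist.
\<close>

definition hom_between :: "'i \<Rightarrow> 'i \<Rightarrow> ('b \<Rightarrow> 'b) \<Rightarrow> bool"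
  where "hom_between x y h \<longleftrightarrow> h \<in> carrier EE \<and> h \<otimes>\<^bsub>EE\<^esub> e x = h \<and> e y \<otimes>\<^bsub>EE\<^esub> h = h"

lemma hom_betweenD:
  assumes "hom_between x y h"
  shows "h \<in> carrier EE" "t \<in> carrier T \<Longrightarrow> h (e x t) = h t" "t \<in> carrier T \<Longrightarrow> e y (h t) = h t"
  using assms end_eval(1)[of t h "e x"] end_eval(1)[of t "e y" h] by (auto simp: hom_between_def)

context
  fixes i :: nat
  assumes i: "i \<in> {1..n}"
begin

lemma i_le: "i \<le> n" "i - 1 \<le> n" using i by auto

lemma layer_le: "filt T (i - 1) \<subseteq> filt T i" using filt_le[of "i - 1" i] i by simp

lemma uniserial_eqmod:
  assumes "x \<in> I" "u \<in> filt T i" "v \<in> filt T i"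
  shows "(\<exists>a\<in>carrier R. eqmod (i - 1) (e x u) (a \<odot>\<^bsub>T\<^esub> e x v)) \<or>
    (\<exists>a\<in>carrier R. eqmod (i - 1) (e x v) (a \<odot>\<^bsub>T\<^esub> e x u))"
proof -
  have "e x u \<in> carrier T" "e x v \<in> carrier T"
    using endD(1)[OF e_end[OF assms(1)]] filt_closed(1)[OF i_le(1)] assms by auto
  then show ?thesis
    using e_uniserial[OF assms(1) i assms(2,3)] rsmult_closed by (auto simp: eqmod_def)
qed

lemma F_carrier: "u \<in> filt T i \<Longrightarrow> u \<in> carrier T" using filt_closed(1)[OF i_le(1)] .

lemma G_carrier: "u \<in> filt T (i - 1) \<Longrightarrow> u \<in> carrier T" using filt_closed(1)[OF i_le(2)] .

lemma e_F: "\<lbrakk>x \<in> I; u \<in> filt T i\<rbrakk> \<Longrightarrow> e x u \<in> filt T i"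
  using endD(7)[OF e_end i_le(1)] .

text \<open>
  Finitely many morphisms out of \<open>x\<close>, each with nonzero kernel on the \<open>i\<close>-th factor, kill a common
  nonzero element.
\<close>

lemma common_kernel:
  assumes x: "x \<in> I" and fin: "finite H" and nz: "part_nonzero i x"
    and H: "\<And>h. h \<in> H \<Longrightarrow> h \<in> carrier EE \<and> (\<forall>t\<in>carrier T. h (e x t) = h t)
      \<and> (\<exists>u\<in>filt T i. h u \<in> filt T (i - 1) \<and> e x u \<notin> filt T (i - 1))"
  shows "\<exists>u\<in>filt T i. e x u = u \<and> u \<notin> filt T (i - 1) \<and> (\<forall>h\<in>H. h u \<in> filt T (i - 1))"
  using fin H
proof (induction H rule: finite_induct)
  case empty
  obtain u where "u \<in> filt T i" "e x u \<notin> filt T (i - 1)" using nz by (auto simp: part_nonzero_def)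
  then show ?case using e_F[OF x] e_e[OF x] F_carrier by blast
next
  case (insert h H)
  obtain u where u: "u \<in> filt T i" "e x u = u" "u \<notin> filt T (i - 1)" "\<forall>h\<in>H. h u \<in> filt T (i - 1)"
    using insert by auto
  obtain v where v: "v \<in> filt T i" "h v \<in> filt T (i - 1)" "e x v \<notin> filt T (i - 1)"
    using insert.prems[of h] by blast
  have h: "h \<in> carrier EE" "\<And>t. t \<in> carrier T \<Longrightarrow> h (e x t) = h t" using insert by auto
  have c: "u \<in> carrier T" "v \<in> carrier T" using u v F_carrier by auto
  consider a where "a \<in> carrier R" "eqmod (i - 1) (e x u) (a \<odot>\<^bsub>T\<^esub> e x v)"
    | a where "a \<in> carrier R" "eqmod (i - 1) (e x v) (a \<odot>\<^bsub>T\<^esub> e x u)"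
    using uniserial_eqmod[OF x u(1) v(1)] by blast
  then show ?case
  proof cases
    case 1
    have "eqmod (i - 1) (h u) (h (a \<odot>\<^bsub>T\<^esub> e x v))" using end_eqmod[OF i_le(2) h(1) 1(2)] u by simp
    moreover have "h (a \<odot>\<^bsub>T\<^esub> e x v) = a \<odot>\<^bsub>T\<^esub> h v"
      using endD(3)[OF h(1) 1(1)] endD(1)[OF e_end[OF x]] c h(2) by simp
    ultimately have "h u \<in> filt T (i - 1)"
      using eqmod_mem[OF i_le(2)] filt_closed(6)[OF i_le(2) 1(1) v(2)] by metis
    then show ?thesis using u by auto
  next
    case 2
    have ev: "e x v \<in> filt T i" using e_F[OF x v(1)] .
    have "g (e x v) \<in> filt T (i - 1)" if g: "g \<in> H" for g
    proof -
      have gE: "g \<in> carrier EE" using insert.prems g by blast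
      have "eqmod (i - 1) (g (e x v)) (g (a \<odot>\<^bsub>T\<^esub> u))" using end_eqmod[OF i_le(2) gE 2(2)] u by simp
      moreover have "g (a \<odot>\<^bsub>T\<^esub> u) = a \<odot>\<^bsub>T\<^esub> g u" using endD(3)[OF gE 2(1) c(1)] .
      ultimately show ?thesis
        using eqmod_mem[OF i_le(2)] filt_closed(6)[OF i_le(2) 2(1)] u(4) g by metis
    qed
    moreover have "h (e x v) \<in> filt T (i - 1)" using h(2)[OF c(2)] v by simp
    ultimately show ?thesis using ev v e_e[OF x c(2)] by (intro bexI[of _ "e x v"]) auto
  qed
qed

text \<open>
  Finitely many morphisms into \<open>y\<close>, none of them surjective on the \<open>i\<close>-th factor, miss a common
  element.
\<close>

lemma common_cokernel:
  assumes y: "y \<in> I" and fin: "finite H" and nz: "part_nonzero i y"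
    and H: "\<And>h. h \<in> H \<Longrightarrow> h \<in> carrier EE \<and> (\<forall>t\<in>carrier T. e y (h t) = h t)
      \<and> (\<exists>v\<in>filt T i. \<forall>u\<in>filt T i. \<not> eqmod (i - 1) (h u) (e y v))"
  shows "\<exists>w\<in>filt T i. e y w = w \<and> w \<notin> filt T (i - 1) \<and> (\<forall>h\<in>H. \<forall>u\<in>filt T i. \<not> eqmod (i - 1) (h u) w)"
  using fin H
proof (induction H rule: finite_induct)
  case empty
  obtain u where "u \<in> filt T i" "e y u \<notin> filt T (i - 1)" using nz by (auto simp: part_nonzero_def)
  then show ?case using e_F[OF y] e_e[OF y] F_carrier by blast
next
  case (insert h H)
  obtain w where w: "w \<in> filt T i" "e y w = w" "w \<notin> filt T (i - 1)"
    "\<And>h u. h \<in> H \<Longrightarrow> u \<in> filt T i \<Longrightarrow> \<not> eqmod (i - 1) (h u) w"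
    using insert by auto
  obtain v where v: "v \<in> filt T i" "\<And>u. u \<in> filt T i \<Longrightarrow> \<not> eqmod (i - 1) (h u) (e y v)"
    using insert.prems[of h] by blast
  have c: "w \<in> carrier T" "v \<in> carrier T" using w v F_carrier by auto
  have scale: "\<not> eqmod (i - 1) (g u) w'" if "eqmod (i - 1) w'' (a \<odot>\<^bsub>T\<^esub> w')" "a \<in> carrier R" "g \<in> carrier EE"
    "\<And>u. u \<in> filt T i \<Longrightarrow> \<not> eqmod (i - 1) (g u) w''" "u \<in> filt T i" for g u w' w'' a
  proof
    assume "eqmod (i - 1) (g u) w'"
    then have "eqmod (i - 1) (a \<odot>\<^bsub>T\<^esub> g u) (a \<odot>\<^bsub>T\<^esub> w')" using eqmod_smult[OF i_le(2)] that by blast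
    then have "eqmod (i - 1) (g (a \<odot>\<^bsub>T\<^esub> u)) (a \<odot>\<^bsub>T\<^esub> w')"
      using endD(3)[OF that(3,2)] F_carrier[OF that(5)] by simp
    then have "eqmod (i - 1) (g (a \<odot>\<^bsub>T\<^esub> u)) w''"
      using eqmod_trans[OF i_le(2)] eqmod_sym[OF i_le(2) that(1)] by blast
    then show False using that(4) filt_closed(6)[OF i_le(1) that(2,5)] by blast
  qed
  consider a where "a \<in> carrier R" "eqmod (i - 1) (e y w) (a \<odot>\<^bsub>T\<^esub> e y v)"
    | a where "a \<in> carrier R" "eqmod (i - 1) (e y v) (a \<odot>\<^bsub>T\<^esub> e y w)"
    using uniserial_eqmod[OF y w(1) v(1)] by blast
  then show ?case
  proof cases
    case 1
    have ev: "e y v \<in> filt T i" "e y (e y v) = e y v" using e_F[OF y v(1)] e_e[OF y c(2)] by auto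
    have 2: "e y v \<notin> filt T (i - 1)"
    proof
      assume "e y v \<in> filt T (i - 1)"
      then have "a \<odot>\<^bsub>T\<^esub> e y v \<in> filt T (i - 1)" using filt_closed(6)[OF i_le(2) 1(1)] by blast
      then show False using eqmod_mem[OF i_le(2) 1(2)] w by simp
    qed
    have "\<not> eqmod (i - 1) (g u) (e y v)" if g: "g \<in> insert h H" and u: "u \<in> filt T i" for g u
    proof (cases "g = h")
      case True then show ?thesis using v u by simp
    next
      case False
      then have gH: "g \<in> H" using g by simp
      show ?thesis
        by (rule scale[OF _ 1(1)]) (use 1(2) w(2) w(4)[OF gH] insert.prems[OF g] u in auto)
    qed
    then show ?thesis using ev 2 by blast
  next
    case 2
    have "\<not> eqmod (i - 1) (h u) w" if u: "u \<in> filt T i" for u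
      by (rule scale[OF _ 2(1)]) (use 2(2) w(2) v(2) insert.prems[of h] u in auto)
    then show ?thesis using w by auto
  qed
qed

lemma part_mono_addD:
  assumes "x \<in> I" "hom_between x y a" "hom_between x y b" "part_mono i x (a \<oplus>\<^bsub>EE\<^esub> b)"
  shows "part_mono i x a \<or> part_mono i x b"
proof (rule ccontr)
  assume n: "\<not> ?thesis"
  have nz: "part_nonzero i x" using assms(4) by (simp add: part_mono_def)
  note a = hom_betweenD[OF assms(2)] and b = hom_betweenD[OF assms(3)]
  have "\<exists>u\<in>filt T i. e x u = u \<and> u \<notin> filt T (i - 1) \<and> (\<forall>h\<in>{a, b}. h u \<in> filt T (i - 1))"
    by (rule common_kernel[OF assms(1) _ nz]) (use a b n nz in \<open>auto simp: part_mono_def\<close>)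
  then obtain u where u: "u \<in> filt T i" "e x u = u" "u \<notin> filt T (i - 1)"
    "a u \<in> filt T (i - 1)" "b u \<in> filt T (i - 1)" by auto
  have "(a \<oplus>\<^bsub>EE\<^esub> b) u \<in> filt T (i - 1)"
    using u filt_closed(3)[OF i_le(2)] F_carrier by (simp add: end_eval)
  then show False using assms(4) u by (auto simp: part_mono_def)
qed

lemma part_epi_addD:
  assumes "y \<in> I" "hom_between x y a" "hom_between x y b" "part_epi i y (a \<oplus>\<^bsub>EE\<^esub> b)"
  shows "part_epi i y a \<or> part_epi i y b"
proof (rule ccontr)
  assume n: "\<not> ?thesis"
  have nz: "part_nonzero i y" using assms(4) by (simp add: part_epi_def)
  note a = hom_betweenD[OF assms(2)] and b = hom_betweenD[OF assms(3)]
  have "\<exists>w\<in>filt T i. e y w = w \<and> w \<notin> filt T (i - 1) \<and> (\<forall>h\<in>{a, b}. \<forall>u\<in>filt T i. \<not> eqmod (i - 1) (h u) w)"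
    by (rule common_cokernel[OF assms(1) _ nz]) (use a b n nz in \<open>auto simp: part_epi_def\<close>)
  then obtain w where w: "w \<in> filt T i" "e y w = w"
    "\<And>u. u \<in> filt T i \<Longrightarrow> \<not> eqmod (i - 1) (a u) w" "\<And>u. u \<in> filt T i \<Longrightarrow> \<not> eqmod (i - 1) (b u) w" by auto
  obtain u where u: "u \<in> filt T i" "eqmod (i - 1) ((a \<oplus>\<^bsub>EE\<^esub> b) u) w"
    using assms(4) w by (auto simp: part_epi_def)
  have uc: "u \<in> carrier T" using u F_carrier by blast
  have s: "eqmod (i - 1) (a u \<oplus>\<^bsub>T\<^esub> b u) w" using u uc by (simp add: end_eval)
  have key: False
    if hE: "h \<in> carrier EE" and c: "c \<in> carrier R" and g: "eqmod (i - 1) g (c \<odot>\<^bsub>T\<^esub> h u)"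
      and s: "eqmod (i - 1) (g \<oplus>\<^bsub>T\<^esub> h u) w" and n: "\<And>u. u \<in> filt T i \<Longrightarrow> \<not> eqmod (i - 1) (h u) w" for h g c
  proof -
    have hu: "h u \<in> carrier T" using endD(1)[OF hE uc] .
    have "h (c \<odot>\<^bsub>T\<^esub> u \<oplus>\<^bsub>T\<^esub> u) = c \<odot>\<^bsub>T\<^esub> h u \<oplus>\<^bsub>T\<^esub> h u"
      using endD(2,3)[OF hE] c uc rsmult_closed by simp
    moreover have "eqmod (i - 1) (g \<oplus>\<^bsub>T\<^esub> h u) (c \<odot>\<^bsub>T\<^esub> h u \<oplus>\<^bsub>T\<^esub> h u)"
      using eqmod_add[OF i_le(2) g eqmod_refl[OF i_le(2) hu]] .
    ultimately have "eqmod (i - 1) (h (c \<odot>\<^bsub>T\<^esub> u \<oplus>\<^bsub>T\<^esub> u)) w"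
      using eqmod_trans[OF i_le(2)] eqmod_sym[OF i_le(2)] s by metis
    then show False using n filt_closed(3,6)[OF i_le(1)] c u(1) by blast
  qed
  have "a u \<in> filt T i" "b u \<in> filt T i" using endD(7)[OF _ i_le(1) u(1)] a b by auto
  then consider c where "c \<in> carrier R" "eqmod (i - 1) (a u) (c \<odot>\<^bsub>T\<^esub> b u)"
    | c where "c \<in> carrier R" "eqmod (i - 1) (b u) (c \<odot>\<^bsub>T\<^esub> a u)"
    using uniserial_eqmod[OF assms(1), of "a u" "b u"] a(3)[OF uc] b(3)[OF uc] by auto
  then show False
  proof cases
    case 1 then show ?thesis using key[OF b(1) 1 s] w by blast
  next
    case 2
    have "eqmod (i - 1) (b u \<oplus>\<^bsub>T\<^esub> a u) w"
      using s a b endD(1) uc by (simp add: M.a_comm)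
    then show ?thesis using key[OF a(1) 2] w by blast
  qed
qed

lemma part_mono_mult:
  assumes "x \<in> I" "y \<in> I" "z \<in> I" "hom_between y z a" "hom_between x y b"
  shows "part_mono i x (a \<otimes>\<^bsub>EE\<^esub> b) \<longleftrightarrow> part_mono i y a \<and> part_mono i x b"
proof -
  note a = hom_betweenD[OF assms(4)] and b = hom_betweenD[OF assms(5)]
  have ev: "(a \<otimes>\<^bsub>EE\<^esub> b) u = a (b u)" if "u \<in> filt T i" for u using F_carrier that by (simp add: end_eval)
  have bF: "b u \<in> filt T i" if "u \<in> filt T i" for u using endD(7)[OF b(1) i_le(1) that] .
  show ?thesis
  proof (intro iffI conjI)
    assume ab: "part_mono i x (a \<otimes>\<^bsub>EE\<^esub> b)"
    then have nz: "part_nonzero i x"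
      and inj: "\<And>u. u \<in> filt T i \<Longrightarrow> a (b u) \<in> filt T (i - 1) \<Longrightarrow> e x u \<in> filt T (i - 1)"
      using ev by (auto simp: part_mono_def)
    have binj: "e x u \<in> filt T (i - 1)" if "u \<in> filt T i" "b u \<in> filt T (i - 1)" for u
      using inj[OF that(1)] endD(7)[OF a(1) i_le(2) that(2)] by blast
    then show "part_mono i x b" using nz by (simp add: part_mono_def)
    obtain u where u: "u \<in> filt T i" "e x u \<notin> filt T (i - 1)" using nz by (auto simp: part_nonzero_def)
    have uc: "u \<in> carrier T" using F_carrier u by blast
    have bu: "b u \<in> filt T i" "e y (b u) = b u" "b u \<notin> filt T (i - 1)"
      using bF[OF u(1)] b(3)[OF uc] binj u by auto
    have nzy: "part_nonzero i y" using bu by (auto simp: part_nonzero_def intro!: bexI[of _ "b u"])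
    have "e y v \<in> filt T (i - 1)" if v: "v \<in> filt T i" "a v \<in> filt T (i - 1)" for v
    proof -
      have vc: "v \<in> carrier T" "b u \<in> carrier T" using F_carrier v bu by auto
      have eyv: "e y v \<in> carrier T" using endD(1)[OF e_end[OF assms(2)] vc(1)] .
      consider c where "c \<in> carrier R" "eqmod (i - 1) (b u) (c \<odot>\<^bsub>T\<^esub> e y v)"
        | c where "c \<in> carrier R" "eqmod (i - 1) (e y v) (c \<odot>\<^bsub>T\<^esub> b u)"
        using uniserial_eqmod[OF assms(2) bu(1) v(1)] bu by auto
      then show ?thesis
      proof cases
        case 1
        have "eqmod (i - 1) (a (b u)) (a (c \<odot>\<^bsub>T\<^esub> e y v))" using end_eqmod[OF i_le(2) a(1) 1(2)] .
        moreover have "a (c \<odot>\<^bsub>T\<^esub> e y v) = c \<odot>\<^bsub>T\<^esub> a v" using endD(3)[OF a(1) 1(1) eyv] a(2)[OF vc(1)] by simp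
        ultimately have "a (b u) \<in> filt T (i - 1)"
          using eqmod_mem[OF i_le(2)] filt_closed(6)[OF i_le(2) 1(1) v(2)] by metis
        then show ?thesis using inj u by blast
      next
        case 2
        have cu: "c \<odot>\<^bsub>T\<^esub> u \<in> filt T i" using filt_closed(6)[OF i_le(1) 2(1) u(1)] .
        have bcu: "b (c \<odot>\<^bsub>T\<^esub> u) = c \<odot>\<^bsub>T\<^esub> b u" using endD(3)[OF b(1) 2(1) uc] .
        have "eqmod (i - 1) (a (e y v)) (a (b (c \<odot>\<^bsub>T\<^esub> u)))" using end_eqmod[OF i_le(2) a(1) 2(2)] bcu by simp
        then have "a (b (c \<odot>\<^bsub>T\<^esub> u)) \<in> filt T (i - 1)"
          using eqmod_mem[OF i_le(2)] a(2)[OF vc(1)] v(2) by metis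
        then have 3: "e x (c \<odot>\<^bsub>T\<^esub> u) \<in> filt T (i - 1)" using inj cu by blast
        have "b (c \<odot>\<^bsub>T\<^esub> u) = b (e x (c \<odot>\<^bsub>T\<^esub> u))" using b(2) F_carrier[OF cu] by simp
        also have "\<dots> \<in> filt T (i - 1)" using endD(7)[OF b(1) i_le(2) 3] .
        finally show ?thesis using eqmod_mem[OF i_le(2) 2(2)] bcu by simp
      qed
    qed
    then show "part_mono i y a" using nzy by (simp add: part_mono_def)
  next
    assume "part_mono i y a \<and> part_mono i x b"
    then have m: "part_nonzero i x"
      "\<And>v. v \<in> filt T i \<Longrightarrow> a v \<in> filt T (i - 1) \<Longrightarrow> e y v \<in> filt T (i - 1)"
      "\<And>u. u \<in> filt T i \<Longrightarrow> b u \<in> filt T (i - 1) \<Longrightarrow> e x u \<in> filt T (i - 1)"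
      by (auto simp: part_mono_def)
    have "e x u \<in> filt T (i - 1)" if "u \<in> filt T i" "a (b u) \<in> filt T (i - 1)" for u
      using m(3)[OF that(1)] m(2)[OF bF[OF that(1)] that(2)] b(3)[OF F_carrier[OF that(1)]] by simp
    then show "part_mono i x (a \<otimes>\<^bsub>EE\<^esub> b)" using m(1) ev by (simp add: part_mono_def)
  qed
qed

lemma part_epi_mult:
  assumes "x \<in> I" "y \<in> I" "z \<in> I" "hom_between y z a" "hom_between x y b"
  shows "part_epi i z (a \<otimes>\<^bsub>EE\<^esub> b) \<longleftrightarrow> part_epi i z a \<and> part_epi i y b"
proof -
  note a = hom_betweenD[OF assms(4)] and b = hom_betweenD[OF assms(5)]
  have ev: "(a \<otimes>\<^bsub>EE\<^esub> b) u = a (b u)" if "u \<in> filt T i" for u using F_carrier that by (simp add: end_eval)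
  have bF: "b u \<in> filt T i" if "u \<in> filt T i" for u using endD(7)[OF b(1) i_le(1) that] .
  have aF: "a u \<in> filt T i" if "u \<in> filt T i" for u using endD(7)[OF a(1) i_le(1) that] .
  show ?thesis
  proof (intro iffI conjI)
    assume ab: "part_epi i z (a \<otimes>\<^bsub>EE\<^esub> b)"
    then have nz: "part_nonzero i z" by (simp add: part_epi_def)
    have sur: "\<exists>u\<in>filt T i. eqmod (i - 1) (a (b u)) (e z v)" if "v \<in> filt T i" for v
      using ab ev that by (auto simp: part_epi_def)
    then show "part_epi i z a" using nz bF unfolding part_epi_def by blast
    obtain t where t: "t \<in> filt T i" "e z t \<notin> filt T (i - 1)" using nz by (auto simp: part_nonzero_def)
    obtain u0 where u0: "u0 \<in> filt T i" "a (b u0) \<notin> filt T (i - 1)"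
      using sur[OF t(1)] t(2) eqmod_mem[OF i_le(2)] by blast
    have "e y (b u0) \<notin> filt T (i - 1)"
      using u0 endD(7)[OF a(1) i_le(2)] a(2) b(3)[OF F_carrier[OF u0(1)]] by metis
    then have nzy: "part_nonzero i y" using bF u0 by (auto simp: part_nonzero_def)
    have "\<exists>u\<in>filt T i. eqmod (i - 1) (b u) (e y v)" if v: "v \<in> filt T i" for v
    proof (rule ccontr)
      assume none: "\<not> ?thesis"
      obtain u1 where u1: "u1 \<in> filt T i" "eqmod (i - 1) (a (b u1)) (e z (a v))" using sur[OF aF[OF v]] by blast
      have c: "v \<in> carrier T" "u1 \<in> carrier T" "b u1 \<in> carrier T" "e y v \<in> carrier T"
        using F_carrier v u1 bF endD(1)[OF e_end[OF assms(2)]] by auto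
      define w where "w = e y v \<ominus>\<^bsub>T\<^esub> b u1"
      have wF: "w \<in> filt T i" using w_def filt_closed(5)[OF i_le(1)] e_F[OF assms(2) v] bF[OF u1(1)] by simp
      have wc: "w \<in> carrier T" using wF F_carrier by blast
      have eyw: "e y w = w"
        using endD(6)[OF e_end[OF assms(2)]] c e_e[OF assms(2)] b(3) by (simp add: w_def)
      have aw: "a w = a v \<ominus>\<^bsub>T\<^esub> a (b u1)" using endD(6)[OF a(1)] c a(2) by (simp add: w_def)
      have "eqmod (i - 1) (a v) (a (b u1))" using eqmod_sym[OF i_le(2)] u1(2) a(3)[OF c(1)] by simp
      then have aw0: "a w \<in> filt T (i - 1)" by (simp add: aw eqmod_def)
      have "a (b u) \<in> filt T (i - 1)" if u: "u \<in> filt T i" for u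
      proof -
        have uc: "u \<in> carrier T" "b u \<in> carrier T" using u F_carrier bF by auto
        consider d where "d \<in> carrier R" "eqmod (i - 1) (b u) (d \<odot>\<^bsub>T\<^esub> w)"
          | d where "d \<in> carrier R" "eqmod (i - 1) w (d \<odot>\<^bsub>T\<^esub> b u)"
          using uniserial_eqmod[OF assms(2) bF[OF u] wF] eyw b(3)[OF uc(1)] by auto
        then show ?thesis
        proof cases
          case 1
          have "eqmod (i - 1) (a (b u)) (d \<odot>\<^bsub>T\<^esub> a w)"
            using end_eqmod[OF i_le(2) a(1) 1(2)] endD(3)[OF a(1) 1(1) wc] by simp
          then show ?thesis using eqmod_mem[OF i_le(2)] filt_closed(6)[OF i_le(2) 1(1) aw0] by metis
        next
          case 2
          let ?u = "d \<odot>\<^bsub>T\<^esub> u \<oplus>\<^bsub>T\<^esub> u1"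
          have uF: "?u \<in> filt T i" using filt_closed(3,6)[OF i_le(1)] u u1 2(1) by blast
          have "b ?u = d \<odot>\<^bsub>T\<^esub> b u \<oplus>\<^bsub>T\<^esub> b u1" using endD(2,3)[OF b(1)] 2(1) uc c rsmult_closed by simp
          moreover have "eqmod (i - 1) (d \<odot>\<^bsub>T\<^esub> b u \<oplus>\<^bsub>T\<^esub> b u1) (w \<oplus>\<^bsub>T\<^esub> b u1)"
            using eqmod_add[OF i_le(2) eqmod_sym[OF i_le(2) 2(2)] eqmod_refl[OF i_le(2) c(3)]] .
          moreover have "w \<oplus>\<^bsub>T\<^esub> b u1 = e y v" using c by (simp add: w_def M.minus_eq M.a_assoc M.l_neg)
          ultimately have "eqmod (i - 1) (b ?u) (e y v)" by simp
          then show ?thesis using none uF by blast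
        qed
      qed
      then show False using u0 by blast
    qed
    then show "part_epi i y b" using nzy by (simp add: part_epi_def)
  next
    assume as: "part_epi i z a \<and> part_epi i y b"
    have "\<exists>u\<in>filt T i. eqmod (i - 1) (a (b u)) (e z v)" if v: "v \<in> filt T i" for v
    proof -
      obtain u where u: "u \<in> filt T i" "eqmod (i - 1) (a u) (e z v)" using as v by (auto simp: part_epi_def)
      obtain u' where u': "u' \<in> filt T i" "eqmod (i - 1) (b u') (e y u)" using as u(1) by (auto simp: part_epi_def)
      have "eqmod (i - 1) (a (b u')) (a u)"
        using end_eqmod[OF i_le(2) a(1) u'(2)] a(2)[OF F_carrier[OF u(1)]] by simp
      then have "eqmod (i - 1) (a (b u')) (e z v)" using eqmod_trans[OF i_le(2) _ u(2)] by blast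
      then show ?thesis using u'(1) by blast
    qed
    then show "part_epi i z (a \<otimes>\<^bsub>EE\<^esub> b)" using as ev by (simp add: part_epi_def)
  qed
qed

lemma part_not_zero:
  shows "\<not> part_mono i x \<zero>\<^bsub>EE\<^esub>" "y \<in> I \<Longrightarrow> \<not> part_epi i y \<zero>\<^bsub>EE\<^esub>"
proof -
  have z: "\<zero>\<^bsub>EE\<^esub> u \<in> filt T (i - 1)" if "u \<in> filt T i" for u
    using F_carrier[OF that] filt_closed(2)[OF i_le(2)] by (simp add: end_eval)
  show "\<not> part_mono i x \<zero>\<^bsub>EE\<^esub>" using z by (auto simp: part_mono_def part_nonzero_def)
  show "\<not> part_epi i y \<zero>\<^bsub>EE\<^esub>" if y: "y \<in> I"
  proof
    assume ep: "part_epi i y \<zero>\<^bsub>EE\<^esub>"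
    then obtain u where u: "u \<in> filt T i" "e y u \<notin> filt T (i - 1)" by (auto simp: part_epi_def part_nonzero_def)
    obtain u' where u': "u' \<in> filt T i" "eqmod (i - 1) (\<zero>\<^bsub>EE\<^esub> u') (e y u)"
      using ep u by (auto simp: part_epi_def)
    show False using eqmod_mem[OF i_le(2) u'(2)] z[OF u'(1)] u(2) by simp
  qed
qed

lemma part_id:
  assumes "x \<in> I" "part_nonzero i x"
  shows "part_mono i x (e x)" "part_epi i x (e x)"
proof -
  show "part_mono i x (e x)" using assms by (simp add: part_mono_def)
  have "eqmod (i - 1) (e x v) (e x v)" if "v \<in> filt T i" for v
    using eqmod_refl[OF i_le(2)] endD(1)[OF e_end[OF assms(1)] F_carrier[OF that]] by blast
  then show "part_epi i x (e x)" using assms unfolding part_epi_def by blast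
qed

end

lemma e_filt: "\<lbrakk>x \<in> I; k \<le> n; t \<in> filt T k\<rbrakk> \<Longrightarrow> e x t \<in> filt T k"
  using endD(7)[OF e_end] .

text \<open>
  An endomorphism of a summand that is injective on every nonzero factor reflects the filtration;
  for \<open>k = 0\<close> this is injectivity.
\<close>

lemma corner_filt_reflect:
  assumes x: "x \<in> I" and h: "hom_between x x h"
    and nz: "\<And>i. \<lbrakk>i \<in> {1..n}; part_nonzero i x\<rbrakk> \<Longrightarrow> part_mono i x h"
    and t: "t \<in> carrier T" and k: "k \<le> n" and ht: "h t \<in> filt T k"
  shows "e x t \<in> filt T k"
proof -
  note hD = hom_betweenD[OF h]
  have "e x t \<in> filt T m" if "k \<le> m" "m \<le> n" for m
    using that(2,1)
  proof (induction m rule: inc_induct)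
    case base
    then show ?case using endD(1)[OF e_end[OF x] t] filt_n by simp
  next
    case (step m)
    then have IH: "e x t \<in> filt T (Suc m)" by simp
    have i: "Suc m \<in> {1..n}" using step by simp
    have hm: "h (e x t) \<in> filt T m" using ht filt_le[of k m] step hD(2)[OF t] by auto
    show ?case
    proof (cases "part_nonzero (Suc m) x")
      case True
      then have "e x (e x t) \<in> filt T m" using nz[OF i] IH hm by (auto simp: part_mono_def)
      then show ?thesis using e_e[OF x t] by simp
    next
      case False
      then have "e x (e x t) \<in> filt T m" using IH by (auto simp: part_nonzero_def)
      then show ?thesis using e_e[OF x t] by simp
    qed
  qed
  then show ?thesis using k by blast
qed

lemma corner_surj:
  assumes x: "x \<in> I" and h: "hom_between x x h"
    and nz: "\<And>i. \<lbrakk>i \<in> {1..n}; part_nonzero i x\<rbrakk> \<Longrightarrow> part_epi i x h"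
  shows "\<lbrakk>k \<le> n; v \<in> filt T k\<rbrakk> \<Longrightarrow> \<exists>u\<in>filt T k. e x u = u \<and> h u = e x v"
proof (induction k arbitrary: v)
  case 0
  then have "v = \<zero>\<^bsub>T\<^esub>" using filt_0 by simp
  then show ?case
    using endD(4)[OF e_end[OF x]] endD(4)[OF hom_betweenD(1)[OF h]] filt_closed(2)[of 0] by auto
next
  case (Suc k)
  note hD = hom_betweenD[OF h]
  have i: "Suc k \<in> {1..n}" and kn: "k \<le> n" using Suc.prems by auto
  have vc: "v \<in> carrier T" using filt_closed(1)[OF Suc.prems] .
  have sub: "filt T k \<subseteq> filt T (Suc k)" using filt_mono Suc.prems by simp
  show ?case
  proof (cases "part_nonzero (Suc k) x")
    case True
    then obtain u where u: "u \<in> filt T (Suc k)" "eqmod k (h u) (e x v)"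
      using nz[OF i True] Suc.prems(2) by (auto simp: part_epi_def)
    have uc: "u \<in> carrier T" using filt_closed(1)[OF Suc.prems(1) u(1)] .
    have c: "h u \<in> carrier T" "e x v \<in> carrier T" "e x u \<in> carrier T"
      using eqmodD[OF u(2)] endD(1)[OF e_end[OF x] uc] by auto
    have "e x v \<ominus>\<^bsub>T\<^esub> h u \<in> filt T k" using eqmod_sym[OF kn u(2)] by (simp add: eqmod_def)
    then obtain u' where u': "u' \<in> filt T k" "e x u' = u'" "h u' = e x (e x v \<ominus>\<^bsub>T\<^esub> h u)"
      using Suc.IH[OF kn] by blast
    have u'c: "u' \<in> carrier T" using filt_closed(1)[OF kn u'(1)] .
    have hu': "h u' = e x v \<ominus>\<^bsub>T\<^esub> h u"
      using u'(3) endD(6)[OF e_end[OF x] c(2,1)] e_e[OF x vc] hD(3)[OF uc] by simp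
    let ?w = "e x u \<oplus>\<^bsub>T\<^esub> u'"
    have "?w \<in> filt T (Suc k)" using filt_closed(3)[OF Suc.prems(1)] e_filt[OF x Suc.prems(1) u(1)] u' sub by blast
    moreover have "e x ?w = ?w" using endD(2)[OF e_end[OF x] c(3) u'c] e_e[OF x uc] u' by simp
    moreover have "h ?w = e x v"
      using endD(2)[OF hD(1) c(3) u'c] hD(2)[OF uc] hu' c by (simp add: M.minus_eq M.a_lcomm[of "h u"] M.r_neg)
    ultimately show ?thesis by blast
  next
    case False
    then have "e x v \<in> filt T k" using Suc.prems by (auto simp: part_nonzero_def)
    then obtain u where "u \<in> filt T k" "e x u = u" "h u = e x (e x v)" using Suc.IH[OF kn] by blast
    then show ?thesis using sub e_e[OF x vc] by auto
  qed
qed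

lemma corner_inverse:
  assumes x: "x \<in> I" and h: "hom_between x x h"
    and mono: "\<And>i. \<lbrakk>i \<in> {1..n}; part_nonzero i x\<rbrakk> \<Longrightarrow> part_mono i x h"
    and epi: "\<And>i. \<lbrakk>i \<in> {1..n}; part_nonzero i x\<rbrakk> \<Longrightarrow> part_epi i x h"
  shows "\<exists>q. hom_between x x q \<and> h \<otimes>\<^bsub>EE\<^esub> q = e x \<and> q \<otimes>\<^bsub>EE\<^esub> h = e x"
proof -
  note hD = hom_betweenD[OF h]
  have ex: "e x \<in> carrier EE" using e_end[OF x] .
  have inj: "u = u'" if "u \<in> carrier T" "u' \<in> carrier T" "e x u = u" "e x u' = u'" "h u = h u'" for u u'
  proof -
    have c: "u \<ominus>\<^bsub>T\<^esub> u' \<in> carrier T" using that by simp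
    have "h (u \<ominus>\<^bsub>T\<^esub> u') = \<zero>\<^bsub>T\<^esub>"
      using endD(6)[OF hD(1)] endD(1)[OF hD(1)] that by (simp add: M.minus_eq M.r_neg)
    then have "e x (u \<ominus>\<^bsub>T\<^esub> u') \<in> filt T 0"
      using corner_filt_reflect[OF x h mono c, of 0] filt_0 by simp
    then have "u \<ominus>\<^bsub>T\<^esub> u' = \<zero>\<^bsub>T\<^esub>" using endD(6)[OF ex] that filt_0 by simp
    then show ?thesis using eq_of_diff_zero that by blast
  qed
  have "\<exists>u. u \<in> carrier T \<and> e x u = u \<and> h u = e x t" if "t \<in> carrier T" for t
    using corner_surj[OF x h epi, of n t] that filt_n by auto
  then obtain q where q: "\<And>t. t \<in> carrier T \<Longrightarrow> q t \<in> carrier T"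
    "\<And>t. t \<in> carrier T \<Longrightarrow> e x (q t) = q t" "\<And>t. t \<in> carrier T \<Longrightarrow> h (q t) = e x t"
    by metis
  have uniq: "u = q t" if "t \<in> carrier T" "u \<in> carrier T" "e x u = u" "h u = e x t" for u t
    using inj[of u "q t"] q[OF that(1)] that by simp
  define Q where "Q = (\<lambda>t\<in>carrier T. q t)"
  have QE: "Q \<in> carrier EE"
    unfolding Q_def
  proof (rule endI)
    fix t assume ts: "t \<in> carrier T" then show "q t \<in> carrier T" using q by simp
  next
    fix k t assume k: "k \<le> n" and t: "t \<in> filt T k"
    have tc: "t \<in> carrier T" using filt_closed(1)[OF k t] .
    have "h (q t) \<in> filt T k" using q(3)[OF tc] e_filt[OF x k t] by simp
    then show "q t \<in> filt T k" using corner_filt_reflect[OF x h mono q(1)[OF tc] k] q(2)[OF tc] by simp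
  next
    fix t s assume ts: "t \<in> carrier T" "s \<in> carrier T"
    have "q t \<oplus>\<^bsub>T\<^esub> q s = q (t \<oplus>\<^bsub>T\<^esub> s)"
      using ts q endD(2)[OF ex] endD(2)[OF hD(1)] by (intro uniq) auto
    then show "q (t \<oplus>\<^bsub>T\<^esub> s) = q t \<oplus>\<^bsub>T\<^esub> q s" ..
  next
    fix a t assume a: "a \<in> carrier R" and ts: "t \<in> carrier T"
    have "a \<odot>\<^bsub>T\<^esub> q t = q (a \<odot>\<^bsub>T\<^esub> t)"
      using ts a q endD(3)[OF ex] endD(3)[OF hD(1)] rsmult_closed by (intro uniq) auto
    then show "q (a \<odot>\<^bsub>T\<^esub> t) = a \<odot>\<^bsub>T\<^esub> q t" ..
  qed
  have exc: "e x t \<in> carrier T" if "t \<in> carrier T" for t using endD(1)[OF ex that] .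
  have qe: "q (e x t) = q t" if "t \<in> carrier T" for t
    using uniq[of "e x t" "q t"] q that e_e[OF x that] exc by simp
  have "Q \<otimes>\<^bsub>EE\<^esub> e x = Q" "e x \<otimes>\<^bsub>EE\<^esub> Q = Q" "h \<otimes>\<^bsub>EE\<^esub> Q = e x"
    using QE ex hD(1) exc qe q by (auto intro!: end_eqI simp: end_closed end_eval Q_def)
  moreover have "q (h t) = e x t" if t: "t \<in> carrier T" for t
    using uniq[of "h t" "e x t"] t exc hD e_e[OF x t] endD(1)[OF hD(1)] by simp
  then have "Q \<otimes>\<^bsub>EE\<^esub> h = e x"
    using QE ex hD(1) endD(1)[OF hD(1)] by (intro end_eqI) (simp_all add: end_closed end_eval Q_def)
  ultimately show ?thesis using QE by (auto simp: hom_between_def)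
qed

lemma e_idem_end: "x \<in> I \<Longrightarrow> e x \<otimes>\<^bsub>EE\<^esub> e x = e x"
  using e_end by (intro end_eqI) (auto simp: end_closed end_eval e_e)

lemma e_orth_end: "\<lbrakk>x \<in> I; y \<in> I; x \<noteq> y\<rbrakk> \<Longrightarrow> e x \<otimes>\<^bsub>EE\<^esub> e y = \<zero>\<^bsub>EE\<^esub>"
  using e_end by (intro end_eqI) (auto simp: end_closed end_eval e_other)

lemma e_finsum_eval:
  assumes B: "B \<subseteq> I" and x: "x \<in> I" and t: "t \<in> carrier T"
  shows "e x ((finsum EE e B) t) = (if x \<in> B then e x t else \<zero>\<^bsub>T\<^esub>)"
proof -
  have fB: "finite B" using finite_subset[OF B finite_I] .
  have eB: "e \<in> B \<rightarrow> carrier EE" using e_end B by blast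
  have ex: "e x \<in> carrier EE" using e_end x by blast
  have "e x \<otimes>\<^bsub>EE\<^esub> finsum EE e B = (\<Oplus>\<^bsub>EE\<^esub>y\<in>B. e x \<otimes>\<^bsub>EE\<^esub> e y)"
    using EE.finsum_rdistr[OF fB ex eB] .
  also have "\<dots> = (\<Oplus>\<^bsub>EE\<^esub>y\<in>B. if x = y then e y else \<zero>\<^bsub>EE\<^esub>)"
    using eB B x e_idem_end e_orth_end by (intro EE.finsum_cong') (auto split: if_splits)
  also have "\<dots> = (if x \<in> B then e x else \<zero>\<^bsub>EE\<^esub>)"
  proof (cases "x \<in> B")
    case True
    then show ?thesis using EE.finsum_singleton[OF True fB eB] by simp
  next
    case False
    then have "(\<Oplus>\<^bsub>EE\<^esub>y\<in>B. if x = y then e y else \<zero>\<^bsub>EE\<^esub>) = (\<Oplus>\<^bsub>EE\<^esub>y\<in>B. \<zero>\<^bsub>EE\<^esub>)"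
      by (intro EE.finsum_cong') auto
    then show ?thesis using False by simp
  qed
  finally show ?thesis using t end_eval(1)[OF t, of "e x" "finsum EE e B"] by (auto simp: end_eval)
qed

lemma e_sum_end: "finsum EE e I = \<one>\<^bsub>EE\<^esub>"
proof -
  have eI: "e \<in> I \<rightarrow> carrier EE" using e_end by blast
  have SE: "finsum EE e I \<in> carrier EE" using EE.finsum_closed[OF eI] .
  show ?thesis
  proof (rule end_eqI[OF SE end_closed(3)])
    fix t assume t: "t \<in> carrier T"
    have c: "(finsum EE e I) t \<in> carrier T" using endD(1)[OF SE t] .
    have "(finsum EE e I) t \<ominus>\<^bsub>T\<^esub> t = \<zero>\<^bsub>T\<^esub>"
    proof (rule e_faithful)
      show "(finsum EE e I) t \<ominus>\<^bsub>T\<^esub> t \<in> carrier T" using c t by simp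
      show "e x ((finsum EE e I) t \<ominus>\<^bsub>T\<^esub> t) = \<zero>\<^bsub>T\<^esub>" if x: "x \<in> I" for x
        using endD(6)[OF e_end[OF x] c t] e_finsum_eval[OF subset_refl x t] x endD(1)[OF e_end[OF x] t]
        by (simp add: M.minus_eq M.r_neg)
    qed
    then have "(finsum EE e I) t = t" using eq_of_diff_zero c t by blast
    then show "(finsum EE e I) t = \<one>\<^bsub>EE\<^esub> t" using t by (simp add: end_eval)
  qed
qed

text \<open>The complements of the ideals $P_{i,m}$ and $P_{i,e}$.\<close>

definition nz :: "nat \<Rightarrow> 'i \<Rightarrow> 'i \<Rightarrow> ('b \<Rightarrow> 'b) \<Rightarrow> bool"
  where "nz j x y h \<longleftrightarrow> (if even j then part_mono (j div 2) x h else part_epi (j div 2) y h)"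

lemma nz_simps: "nz (2 * i) x y h \<longleftrightarrow> part_mono i x h" "nz (Suc (2 * i)) x y h \<longleftrightarrow> part_epi i y h"
  by (simp_all add: nz_def)

sublocale PS: prime_system EE I e "layer_indices n" nz
proof
  have half: "j div 2 \<in> {1..n}" if "j \<in> layer_indices n" for j
    using that by (auto simp: layer_indices_def)
  show "finite I" by (rule finite_I)
  show "finite (layer_indices n)" by (simp add: layer_indices_def)
  show "\<And>x. x \<in> I \<Longrightarrow> e x \<in> carrier EE" by (rule e_end)
  show "\<And>x. x \<in> I \<Longrightarrow> e x \<otimes>\<^bsub>EE\<^esub> e x = e x" by (rule e_idem_end)
  show "\<And>x y. \<lbrakk>x \<in> I; y \<in> I; x \<noteq> y\<rbrakk> \<Longrightarrow> e x \<otimes>\<^bsub>EE\<^esub> e y = \<zero>\<^bsub>EE\<^esub>" by (rule e_orth_end)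
  show "finsum EE e I = \<one>\<^bsub>EE\<^esub>" by (rule e_sum_end)
  show "\<not> nz j x y \<zero>\<^bsub>EE\<^esub>" if "j \<in> layer_indices n" "x \<in> I" "y \<in> I" for j x y
    using part_not_zero[OF half[OF that(1)]] that(3) by (simp add: nz_def)
  show "nz j x y a \<or> nz j x y b"
    if "j \<in> layer_indices n" "x \<in> I" "y \<in> I"
      "a \<in> carrier EE" "a \<otimes>\<^bsub>EE\<^esub> e x = a" "e y \<otimes>\<^bsub>EE\<^esub> a = a"
      "b \<in> carrier EE" "b \<otimes>\<^bsub>EE\<^esub> e x = b" "e y \<otimes>\<^bsub>EE\<^esub> b = b" "nz j x y (a \<oplus>\<^bsub>EE\<^esub> b)" for j x y a b
    using part_mono_addD[OF half[OF that(1)] that(2), of y a b]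
      part_epi_addD[OF half[OF that(1)] that(3), of x a b] that
    by (simp add: nz_def hom_between_def split: if_splits)
  show "nz j x z (a \<otimes>\<^bsub>EE\<^esub> b) \<longleftrightarrow> nz j y z a \<and> nz j x y b"
    if "j \<in> layer_indices n" "x \<in> I" "y \<in> I" "z \<in> I"
      "a \<in> carrier EE" "a \<otimes>\<^bsub>EE\<^esub> e y = a" "e z \<otimes>\<^bsub>EE\<^esub> a = a"
      "b \<in> carrier EE" "b \<otimes>\<^bsub>EE\<^esub> e x = b" "e y \<otimes>\<^bsub>EE\<^esub> b = b" for j x y z a b
    using part_mono_mult[OF half[OF that(1)] that(2-4), of a b]
      part_epi_mult[OF half[OF that(1)] that(2-4), of a b] that
    by (simp add: nz_def hom_between_def)
  show "\<exists>q\<in>carrier EE. q \<otimes>\<^bsub>EE\<^esub> e x = q \<and> e x \<otimes>\<^bsub>EE\<^esub> q = q \<and> h \<otimes>\<^bsub>EE\<^esub> q = e x \<and> q \<otimes>\<^bsub>EE\<^esub> h = e x"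
    if x: "x \<in> I" and h: "h \<in> carrier EE" "h \<otimes>\<^bsub>EE\<^esub> e x = h" "e x \<otimes>\<^bsub>EE\<^esub> h = h"
      and nzh: "\<And>j. j \<in> layer_indices n \<Longrightarrow> nz j x x (e x) \<Longrightarrow> nz j x x h" for x h
  proof -
    have hb: "hom_between x x h" using h by (simp add: hom_between_def)
    have m: "part_mono i x h" if i: "i \<in> {1..n}" "part_nonzero i x" for i
      using nzh[of "2 * i"] part_id(1)[OF i(1) x i(2)] i by (simp add: nz_simps layer_indices_def)
    have ep: "part_epi i x h" if i: "i \<in> {1..n}" "part_nonzero i x" for i
      using nzh[of "Suc (2 * i)"] part_id(2)[OF i(1) x i(2)] i by (simp add: nz_simps layer_indices_def)
    obtain q where "hom_between x x q" "h \<otimes>\<^bsub>EE\<^esub> q = e x" "q \<otimes>\<^bsub>EE\<^esub> h = e x"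
      using corner_inverse[OF x hb m ep] by blast
    then show ?thesis by (auto simp: hom_between_def)
  qed
qed

end

section \<open>Goldie dimension and dual Goldie dimension of a layer\<close>

context right_module
begin

text \<open>The sum of two submodules.\<close>

definition module_sum :: "'b set \<Rightarrow> 'b set \<Rightarrow> 'b set"
  where "module_sum X Y = {x \<oplus>\<^bsub>M\<^esub> y | x y. x \<in> X \<and> y \<in> Y}"

text \<open>The interval from \<open>G\<close> to \<open>F\<close> in the lattice of submodules.\<close>

definition submodules_between :: "'b set \<Rightarrow> 'b set \<Rightarrow> 'b set set"
  where "submodules_between G F = {X. submodule X R M \<and> G \<subseteq> X \<and> X \<subseteq> F}"

lemma module_sumI: "\<lbrakk>x \<in> X; y \<in> Y\<rbrakk> \<Longrightarrow> x \<oplus>\<^bsub>M\<^esub> y \<in> module_sum X Y"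
  by (auto simp: module_sum_def)

lemma submodule_Int: "\<lbrakk>submodule X R M; submodule Y R M\<rbrakk> \<Longrightarrow> submodule (X \<inter> Y) R M"
  using submoduleD[of X] submoduleD[of Y] by (intro right_submoduleI) auto

lemma submodule_sum:
  assumes X: "submodule X R M" and Y: "submodule Y R M"
  shows "submodule (module_sum X Y) R M"
proof (rule right_submoduleI)
  note XD = submoduleD[OF X] and YD = submoduleD[OF Y]
  show "module_sum X Y \<subseteq> carrier M" using XD(1) YD(1) by (auto simp: module_sum_def)
  have "\<zero>\<^bsub>M\<^esub> \<oplus>\<^bsub>M\<^esub> \<zero>\<^bsub>M\<^esub> \<in> module_sum X Y" using XD(2) YD(2) unfolding module_sum_def by blast
  then show "\<zero>\<^bsub>M\<^esub> \<in> module_sum X Y" by simp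
  show "p \<oplus>\<^bsub>M\<^esub> q \<in> module_sum X Y" if "p \<in> module_sum X Y" "q \<in> module_sum X Y" for p q
  proof -
    obtain x y x' y' where p: "x \<in> X" "y \<in> Y" "p = x \<oplus>\<^bsub>M\<^esub> y" and q: "x' \<in> X" "y' \<in> Y" "q = x' \<oplus>\<^bsub>M\<^esub> y'"
      using \<open>p \<in> _\<close> \<open>q \<in> _\<close> by (auto simp: module_sum_def)
    have c: "x \<in> carrier M" "y \<in> carrier M" "x' \<in> carrier M" "y' \<in> carrier M"
      using p q XD(1) YD(1) by auto
    have "p \<oplus>\<^bsub>M\<^esub> q = (x \<oplus>\<^bsub>M\<^esub> x') \<oplus>\<^bsub>M\<^esub> (y \<oplus>\<^bsub>M\<^esub> y')" using p q c by (simp add: M.a_ac)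
    then show ?thesis using p q XD(3) YD(3) module_sumI by simp
  qed
  show "a \<odot>\<^bsub>M\<^esub> p \<in> module_sum X Y" if a: "a \<in> carrier R" and pm: "p \<in> module_sum X Y" for a p
  proof -
    obtain x y where p: "x \<in> X" "y \<in> Y" "p = x \<oplus>\<^bsub>M\<^esub> y" using pm by (auto simp: module_sum_def)
    have "a \<odot>\<^bsub>M\<^esub> p = a \<odot>\<^bsub>M\<^esub> x \<oplus>\<^bsub>M\<^esub> a \<odot>\<^bsub>M\<^esub> y"
      using p a XD(1) YD(1) by (auto intro!: rsmult_distr_module)
    then show ?thesis using p a XD(6) YD(6) module_sumI by simp
  qed
qed

lemma module_sum_upper:
  assumes X: "submodule X R M" and Y: "submodule Y R M"
  shows "X \<subseteq> module_sum X Y" "Y \<subseteq> module_sum X Y"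
proof -
  note XD = submoduleD[OF X] and YD = submoduleD[OF Y]
  show "X \<subseteq> module_sum X Y"
  proof
    fix x assume x: "x \<in> X"
    then have "x = x \<oplus>\<^bsub>M\<^esub> \<zero>\<^bsub>M\<^esub>" using XD(1) by auto
    then show "x \<in> module_sum X Y" using x YD(2) unfolding module_sum_def by blast
  qed
  show "Y \<subseteq> module_sum X Y"
  proof
    fix x assume x: "x \<in> Y"
    then have "x = \<zero>\<^bsub>M\<^esub> \<oplus>\<^bsub>M\<^esub> x" using YD(1) by auto
    then show "x \<in> module_sum X Y" using x XD(2) unfolding module_sum_def by blast
  qed
qed

lemma module_sum_least: "\<lbrakk>submodule Z R M; X \<subseteq> Z; Y \<subseteq> Z\<rbrakk> \<Longrightarrow> module_sum X Y \<subseteq> Z"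
  using submoduleD(3)[of Z] by (auto simp: module_sum_def)

lemma module_sum_modular:
  assumes X: "submodule X R M" and Y: "submodule Y R M" and Z: "submodule Z R M" and "X \<subseteq> Z"
  shows "module_sum X Y \<inter> Z \<subseteq> module_sum X (Y \<inter> Z)"
proof
  fix t assume t: "t \<in> module_sum X Y \<inter> Z"
  then obtain x y where xy: "x \<in> X" "y \<in> Y" "t = x \<oplus>\<^bsub>M\<^esub> y" by (auto simp: module_sum_def)
  have c: "x \<in> carrier M" "y \<in> carrier M" using xy submoduleD(1)[OF X] submoduleD(1)[OF Y] by auto
  have "y = t \<ominus>\<^bsub>M\<^esub> x" using xy c by (simp add: M.minus_eq M.a_comm[of x y] M.a_assoc M.r_neg)
  moreover have "t \<in> Z" "x \<in> Z" using t xy(1) assms(4) by auto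
  ultimately have "y \<in> Z" using submoduleD(5)[OF Z] by metis
  then show "t \<in> module_sum X (Y \<inter> Z)" using xy module_sumI by simp
qed

lemma submodules_between_lattice:
  assumes "submodule G R M" "submodule F R M" "G \<subseteq> F"
  shows "modular_lattice_on (submodules_between G F) (\<subseteq>) (\<inter>) module_sum F"
    and "modular_lattice_on (submodules_between G F) (\<lambda>X Y. Y \<subseteq> X) module_sum (\<inter>) G"
proof -
  have sum: "module_sum X Y \<in> submodules_between G F"
    if "X \<in> submodules_between G F" "Y \<in> submodules_between G F" for X Y
    using that submodule_sum[of X Y] module_sum_upper(1)[of X Y] module_sum_least[OF assms(2), of X Y]
    by (auto simp: submodules_between_def)
  have int: "X \<inter> Y \<in> submodules_between G F"
    if "X \<in> submodules_between G F" "Y \<in> submodules_between G F" for X Y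
    using that submodule_Int by (auto simp: submodules_between_def)
  have modular': "X \<inter> module_sum Y Z \<subseteq> module_sum (X \<inter> Y) Z"
    if "submodule X R M" "submodule Y R M" "submodule Z R M" "Z \<subseteq> X" for X Y Z
  proof -
    have comm: "module_sum A B \<subseteq> module_sum B A" if "submodule A R M" "submodule B R M" for A B
      using module_sum_upper[OF that(2,1)] module_sum_least[OF submodule_sum[OF that(2,1)]] by blast
    have "X \<inter> module_sum Y Z \<subseteq> module_sum Z Y \<inter> X" using comm that by blast
    also have "\<dots> \<subseteq> module_sum Z (Y \<inter> X)" using module_sum_modular that by blast
    also have "\<dots> \<subseteq> module_sum (Y \<inter> X) Z" using comm that submodule_Int by blast
    finally show ?thesis by (simp add: Int_commute)
  qed
  show "modular_lattice_on (submodules_between G F) (\<subseteq>) (\<inter>) module_sum F"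
    using assms sum int module_sum_upper module_sum_least module_sum_modular
    by unfold_locales (auto 0 0 simp: submodules_between_def)
  show "modular_lattice_on (submodules_between G F) (\<lambda>X Y. Y \<subseteq> X) module_sum (\<inter>) G"
    using assms sum int module_sum_upper module_sum_least modular'
    by unfold_locales (auto 0 0 simp: submodules_between_def)
qed

end

context decomposed_object
begin

context
  fixes i :: nat
  assumes i: "i \<in> {1..n}"
begin

lemma filt_sub: "submodule (filt T i) R T" "submodule (filt T (i - 1)) R T"
  using filt_submodule[of i] filt_submodule[of "i - 1"] i by auto

text \<open>The submodules of the \<open>i\<close>-th factor of \<open>T\<close>, as submodules of \<open>T\<close> between consecutive terms of the filtration.\<close>

abbreviation "LL \<equiv> submodules_between (filt T (i - 1)) (filt T i)"

lemma LLI: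
  assumes "X \<subseteq> filt T i" "filt T (i - 1) \<subseteq> X" "\<And>x y. \<lbrakk>x \<in> X; y \<in> X\<rbrakk> \<Longrightarrow> x \<oplus>\<^bsub>T\<^esub> y \<in> X"
    "\<And>a x. \<lbrakk>a \<in> carrier R; x \<in> X\<rbrakk> \<Longrightarrow> a \<odot>\<^bsub>T\<^esub> x \<in> X"
  shows "X \<in> LL"
proof -
  have "submodule X R T"
    using assms F_carrier[OF i] filt_closed(2)[OF i_le(2)[OF i]] by (intro right_submoduleI) auto
  then show ?thesis using assms by (simp add: submodules_between_def)
qed

lemma LLD:
  assumes "X \<in> LL"
  shows "submodule X R T" "filt T (i - 1) \<subseteq> X" "X \<subseteq> filt T i"
    "eqmod (i - 1) s t \<Longrightarrow> s \<in> X \<longleftrightarrow> t \<in> X"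
proof -
  show 1: "submodule X R T" "filt T (i - 1) \<subseteq> X" "X \<subseteq> filt T i"
    using assms by (auto simp: submodules_between_def)
  have 2: "t \<in> X" if st: "eqmod (i - 1) s t" "s \<in> X" for s t
  proof -
    have c: "s \<in> carrier T" "t \<in> carrier T" using eqmodD[OF st(1)] by auto
    have "t \<ominus>\<^bsub>T\<^esub> s \<in> filt T (i - 1)" using eqmod_sym[OF i_le(2)[OF i] st(1)] by (simp add: eqmod_def)
    then have "(t \<ominus>\<^bsub>T\<^esub> s) \<oplus>\<^bsub>T\<^esub> s \<in> X" using 1 st(2) submoduleD(3)[OF 1(1)] by blast
    then show ?thesis using c by (simp add: M.minus_eq M.a_assoc M.l_neg)
  qed
  show "s \<in> X \<longleftrightarrow> t \<in> X" if "eqmod (i - 1) s t" using 2 that eqmod_sym[OF i_le(2)[OF i]] by blast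
qed

lemma e_kernel_LL: assumes "l \<in> I" shows "{t \<in> filt T i. e l t \<in> filt T (i - 1)} \<in> LL"
  using endD[OF e_end[OF assms]] filt_closed[OF i_le(1)[OF i]] filt_closed[OF i_le(2)[OF i]]
    layer_le[OF i] i_le[OF i]
  by (intro LLI) auto

lemma e_image_LL: assumes "l \<in> I" shows "{t \<in> filt T i. eqmod (i - 1) (e l t) t} \<in> LL"
proof (rule LLI)
  note E = endD[OF e_end[OF assms]] and le = i_le[OF i]
  show "filt T (i - 1) \<subseteq> {t \<in> filt T i. eqmod (i - 1) (e l t) t}"
    using layer_le[OF i] eqmod_of_mem[OF le(2)] E(7)[OF le(2)] by blast
  show "x \<oplus>\<^bsub>T\<^esub> y \<in> {t \<in> filt T i. eqmod (i - 1) (e l t) t}"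
    if "x \<in> {t \<in> filt T i. eqmod (i - 1) (e l t) t}" "y \<in> {t \<in> filt T i. eqmod (i - 1) (e l t) t}" for x y
    using that eqmod_add[OF le(2), of "e l x" x "e l y" y] E(2)[of x y] filt_closed(3)[OF le(1)] F_carrier[OF i] by auto
  show "a \<odot>\<^bsub>T\<^esub> x \<in> {t \<in> filt T i. eqmod (i - 1) (e l t) t}"
    if "a \<in> carrier R" "x \<in> {t \<in> filt T i. eqmod (i - 1) (e l t) t}" for a x
    using that eqmod_smult[OF le(2), of a "e l x" x] E(3)[of a x] filt_closed(6)[OF le(1)] F_carrier[OF i] by auto
qed auto

lemma chain_below_image:
  assumes l: "l \<in> I" and X: "X \<in> LL" "X \<subseteq> {t \<in> filt T i. eqmod (i - 1) (e l t) t}"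
    and Y: "Y \<in> LL" "Y \<subseteq> {t \<in> filt T i. eqmod (i - 1) (e l t) t}"
  shows "X \<subseteq> Y \<or> Y \<subseteq> X"
proof (rule ccontr)
  assume "\<not> ?thesis"
  then obtain s t where s: "s \<in> X" "s \<notin> Y" and t: "t \<in> Y" "t \<notin> X" by blast
  have F: "s \<in> filt T i" "t \<in> filt T i" and c: "eqmod (i - 1) (e l s) s" "eqmod (i - 1) (e l t) t"
    using s t X Y by auto
  note le = i_le[OF i]
  have move: "u \<in> Z" if a: "a \<in> carrier R" "eqmod (i - 1) (e l u) (a \<odot>\<^bsub>T\<^esub> e l v)" and
    c: "eqmod (i - 1) (e l u) u" "eqmod (i - 1) (e l v) v" and Z: "Z \<in> LL" "v \<in> Z" for u v a Z
  proof -
    have "eqmod (i - 1) u (a \<odot>\<^bsub>T\<^esub> v)"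
      using eqmod_trans[OF le(2) eqmod_trans[OF le(2) eqmod_sym[OF le(2) c(1)] a(2)] eqmod_smult[OF le(2) a(1) c(2)]] .
    moreover have "a \<odot>\<^bsub>T\<^esub> v \<in> Z" using submoduleD(6)[OF LLD(1)[OF Z(1)] a(1) Z(2)] .
    ultimately show ?thesis using LLD(4)[OF Z(1)] by blast
  qed
  from uniserial_eqmod[OF i l F] show False
    using move[of _ s t Y] move[of _ t s X] c s t X(1) Y(1) by blast
qed

lemma chain_above_kernel:
  assumes l: "l \<in> I" and X: "X \<in> LL" "{t \<in> filt T i. e l t \<in> filt T (i - 1)} \<subseteq> X"
    and Y: "Y \<in> LL" "{t \<in> filt T i. e l t \<in> filt T (i - 1)} \<subseteq> Y"
  shows "X \<subseteq> Y \<or> Y \<subseteq> X"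
proof (rule ccontr)
  assume "\<not> ?thesis"
  then obtain s t where s: "s \<in> X" "s \<notin> Y" and t: "t \<in> Y" "t \<notin> X" by blast
  have F: "s \<in> filt T i" "t \<in> filt T i" using s t LLD(3) X(1) Y(1) by auto
  note le = i_le[OF i] and E = endD[OF e_end[OF l]]
  have move: "u \<in> Z" if a: "a \<in> carrier R" "eqmod (i - 1) (e l u) (a \<odot>\<^bsub>T\<^esub> e l v)"
    and Z: "Z \<in> LL" "{t \<in> filt T i. e l t \<in> filt T (i - 1)} \<subseteq> Z" "v \<in> Z"
    and uv: "u \<in> filt T i" "v \<in> filt T i" for u v a Z
  proof -
    have c: "u \<in> carrier T" "v \<in> carrier T" "a \<odot>\<^bsub>T\<^esub> v \<in> carrier T"
      using uv F_carrier[OF i] a rsmult_closed by auto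
    have av: "a \<odot>\<^bsub>T\<^esub> v \<in> Z" using submoduleD(6)[OF LLD(1)[OF Z(1)] a(1) Z(3)] .
    have "e l (u \<ominus>\<^bsub>T\<^esub> a \<odot>\<^bsub>T\<^esub> v) \<in> filt T (i - 1)"
      using a c E(3,6) by (simp add: eqmod_def)
    moreover have "u \<ominus>\<^bsub>T\<^esub> a \<odot>\<^bsub>T\<^esub> v \<in> filt T i" using filt_closed(5,6)[OF le(1)] uv a by blast
    ultimately have "u \<ominus>\<^bsub>T\<^esub> a \<odot>\<^bsub>T\<^esub> v \<in> Z" using Z(2) by blast
    then have "(u \<ominus>\<^bsub>T\<^esub> a \<odot>\<^bsub>T\<^esub> v) \<oplus>\<^bsub>T\<^esub> a \<odot>\<^bsub>T\<^esub> v \<in> Z" using av submoduleD(3)[OF LLD(1)[OF Z(1)]] by blast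
    then show ?thesis using c by (simp add: M.minus_eq M.a_assoc M.l_neg)
  qed
  from uniserial_eqmod[OF i l F] show False
    using move[of _ s t Y] move[of _ t s X] F s t X Y by blast
qed

lemma finsum_e_filt:
  assumes B: "B \<subseteq> I" and X: "submodule X R T" and t: "t \<in> carrier T" "\<And>l. l \<in> B \<Longrightarrow> e l t \<in> X"
  shows "(finsum EE e B) t \<in> X"
  using end_finsum_mem[of B e X t] finite_subset[OF B finite_I] e_end B X t by blast

text \<open>
  If the identity matrix of \<open>A\<close> factors through \<open>B\<close> modulo $P_{i,m}$, choose nonzero elements \<open>u m\<close>
  that are killed by all entries in the \<open>m\<close>-th column of the error matrix \<open>D\<close>. Then the images \<open>w m\<close> of the
  \<open>u m\<close> generate independent nonzero submodules \<open>N m\<close> of the sum of the factors indexed by \<open>B\<close>. The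
  counting theorem is applied in the dual lattice; the \<open>l\<close>-th kernel plays the role of \<open>v l\<close>.
\<close>

theorem card_le_of_mono:
  assumes A: "A \<subseteq> I" and B: "B \<subseteq> I" and p: "p \<in> carrier EE" and q: "q \<in> carrier EE"
    and nz: "\<And>k. k \<in> A \<Longrightarrow> part_nonzero i k"
    and d: "\<And>k k'. \<lbrakk>k \<in> A; k' \<in> A\<rbrakk> \<Longrightarrow> \<not> part_mono i k'
      (e k \<otimes>\<^bsub>EE\<^esub> p \<otimes>\<^bsub>EE\<^esub> finsum EE e B \<otimes>\<^bsub>EE\<^esub> (q \<otimes>\<^bsub>EE\<^esub> e k') \<ominus>\<^bsub>EE\<^esub> (if k = k' then e k else \<zero>\<^bsub>EE\<^esub>))"
  shows "card A \<le> card B"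
proof -
  note le = i_le[OF i]
  let ?F = "filt T i" and ?G = "filt T (i - 1)"
  have finA: "finite A" and finB: "finite B" using A B finite_I finite_subset by auto
  define eB where "eB = finsum EE e B"
  have eB: "eB \<in> carrier EE" unfolding eB_def using e_end B by (intro EE.finsum_closed) auto
  have eE: "e k \<in> carrier EE" if "k \<in> A" for k using that A e_end by blast
  define \<delta> where "\<delta> k k' = (if k = k' then e k else \<zero>\<^bsub>EE\<^esub>)" for k k'
  define D where "D k k' = e k \<otimes>\<^bsub>EE\<^esub> p \<otimes>\<^bsub>EE\<^esub> eB \<otimes>\<^bsub>EE\<^esub> (q \<otimes>\<^bsub>EE\<^esub> e k') \<ominus>\<^bsub>EE\<^esub> \<delta> k k'" for k k'
  have \<delta>E: "\<delta> k k' \<in> carrier EE" if "k \<in> A" for k k' using eE[OF that] by (auto simp: \<delta>_def end_closed)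
  have DE: "D k k' \<in> carrier EE" if "k \<in> A" "k' \<in> A" for k k'
    using eE[OF that(1)] eE[OF that(2)] \<delta>E[OF that(1)] p q eB by (simp add: D_def)
  have Dev: "D k k' t = e k (p (eB (q (e k' t)))) \<ominus>\<^bsub>T\<^esub> \<delta> k k' t" if "k \<in> A" "k' \<in> A" "t \<in> carrier T" for k k' t
  proof -
    have c: "e k' t \<in> carrier T" "q (e k' t) \<in> carrier T" "eB (q (e k' t)) \<in> carrier T"
      using that eE endD(1) q eB by auto
    show ?thesis unfolding D_def
      using that eE[OF that(1)] eE[OF that(2)] \<delta>E[OF that(1)] p q eB c
      by (simp add: end_diff end_eval end_closed)
  qed
  have Dnot: "\<not> part_mono i k' (D k k')" if "k \<in> A" "k' \<in> A" for k k'
    using d[OF that] by (simp add: D_def eB_def \<delta>_def)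
  have De: "D k k' (e k' t) = D k k' t" if "k \<in> A" "k' \<in> A" "t \<in> carrier T" for k k' t
  proof -
    have k: "k \<in> I" "k' \<in> I" using that A by auto
    have "\<delta> k k' (e k' t) = \<delta> k k' t"
      using that endD(1)[OF eE[OF that(2)]] e_e[OF k(2) that(3)] by (simp add: \<delta>_def end_eval)
    then show ?thesis
      using Dev[OF that] Dev[OF that(1,2), of "e k' t"] that endD(1)[OF eE[OF that(2)]] e_e[OF k(2) that(3)] by simp
  qed
  have "\<exists>u\<in>?F. e m u = u \<and> u \<notin> ?G \<and> (\<forall>h\<in>(\<lambda>k. D k m) ` A. h u \<in> ?G)" if m: "m \<in> A" for m
  proof (rule common_kernel[OF i _ _ nz[OF m]])
    show "m \<in> I" using m A by blast
    show "finite ((\<lambda>k. D k m) ` A)" using finA by simp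
    fix h assume "h \<in> (\<lambda>k. D k m) ` A"
    then obtain k where k: "k \<in> A" "h = D k m" by blast
    show "h \<in> carrier EE \<and> (\<forall>t\<in>carrier T. h (e m t) = h t)
        \<and> (\<exists>u\<in>?F. h u \<in> ?G \<and> e m u \<notin> ?G)"
      using Dnot[OF k(1) m] nz[OF m] DE[OF k(1) m] De[OF k(1) m] k(2) by (auto simp: part_mono_def)
  qed
  then obtain u where u: "\<And>m. m \<in> A \<Longrightarrow> u m \<in> ?F" "\<And>m. m \<in> A \<Longrightarrow> e m (u m) = u m"
    "\<And>m. m \<in> A \<Longrightarrow> u m \<notin> ?G" "\<And>k m. m \<in> A \<Longrightarrow> k \<in> A \<Longrightarrow> D k m (u m) \<in> ?G"
    by (metis image_eqI)
  have uc: "u m \<in> carrier T" if "m \<in> A" for m using u(1)[OF that] F_carrier[OF i] by blast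
  define w where "w m = eB (q (u m))" for m
  have wF: "w m \<in> ?F" if "m \<in> A" for m using endD(7)[OF eB le(1)] endD(7)[OF q le(1)] u(1)[OF that] by (simp add: w_def)
  have wc: "w m \<in> carrier T" if "m \<in> A" for m using wF[OF that] F_carrier[OF i] by blast
  define pr where "pr k t = e k (p t)" for k t
  have prE: "pr k (a \<odot>\<^bsub>T\<^esub> t) = a \<odot>\<^bsub>T\<^esub> pr k t" if "k \<in> A" "a \<in> carrier R" "t \<in> carrier T" for k a t
    using endD(1,3)[OF p] endD(3)[OF eE[OF that(1)]] that by (simp add: pr_def)
  have pr_eqmod: "eqmod (i - 1) (pr k s) (pr k t)" if "k \<in> A" "eqmod (i - 1) s t" for k s t
    unfolding pr_def using end_eqmod[OF le(2) eE[OF that(1)] end_eqmod[OF le(2) p that(2)]] .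
  have prw: "eqmod (i - 1) (pr k (w m)) (if k = m then u m else \<zero>\<^bsub>T\<^esub>)" if "k \<in> A" "m \<in> A" for k m
  proof -
    have "D k m (u m) = pr k (w m) \<ominus>\<^bsub>T\<^esub> (if k = m then u m else \<zero>\<^bsub>T\<^esub>)"
      using Dev[OF that uc[OF that(2)]] u(2)[OF that(2)] uc[OF that(2)] by (simp add: pr_def w_def \<delta>_def end_eval)
    moreover have "pr k (w m) \<in> carrier T" using endD(1)[OF eE[OF that(1)]] endD(1)[OF p] wc[OF that(2)] by (simp add: pr_def)
    ultimately show ?thesis using u(4)[OF that(2,1)] uc[OF that(2)] by (simp add: eqmod_def)
  qed
  define N where "N m = {t \<in> ?F. \<exists>a\<in>carrier R. eqmod (i - 1) t (a \<odot>\<^bsub>T\<^esub> w m)}" for m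
  have NL: "N m \<in> LL" if m: "m \<in> A" for m
  proof (rule LLI)
    show "?G \<subseteq> N m"
    proof
      fix t assume t: "t \<in> ?G"
      have "eqmod (i - 1) t (\<zero>\<^bsub>R\<^esub> \<odot>\<^bsub>T\<^esub> w m)"
        using t wc[OF m] smult_zero_left eqmod_zero[OF le(2)] by simp
      then show "t \<in> N m" using t layer_le[OF i] by (auto simp: N_def)
    qed
    fix x y assume x: "x \<in> N m" and y: "y \<in> N m"
    then obtain a b where a: "a \<in> carrier R" "eqmod (i - 1) x (a \<odot>\<^bsub>T\<^esub> w m)" "x \<in> ?F"
      and b: "b \<in> carrier R" "eqmod (i - 1) y (b \<odot>\<^bsub>T\<^esub> w m)" "y \<in> ?F" by (auto simp: N_def)
    have "eqmod (i - 1) (x \<oplus>\<^bsub>T\<^esub> y) ((a \<oplus>\<^bsub>R\<^esub> b) \<odot>\<^bsub>T\<^esub> w m)"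
      using eqmod_add[OF le(2) a(2) b(2)] a b wc[OF m] by (simp add: rsmult_distr_ring)
    then show "x \<oplus>\<^bsub>T\<^esub> y \<in> N m" using a b filt_closed(3)[OF le(1)] R.add.m_closed by (auto simp: N_def)
  next
    fix c x assume c: "c \<in> carrier R" and x: "x \<in> N m"
    then obtain a where a: "a \<in> carrier R" "eqmod (i - 1) x (a \<odot>\<^bsub>T\<^esub> w m)" "x \<in> ?F" by (auto simp: N_def)
    have "eqmod (i - 1) (c \<odot>\<^bsub>T\<^esub> x) ((a \<otimes>\<^bsub>R\<^esub> c) \<odot>\<^bsub>T\<^esub> w m)"
      using eqmod_smult[OF le(2) c a(2)] a c wc[OF m] by (simp add: rsmult_assoc)
    then show "c \<odot>\<^bsub>T\<^esub> x \<in> N m" using a c filt_closed(6)[OF le(1)] R.m_closed by (auto simp: N_def)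
  qed (auto simp: N_def)
  \<comment> \<open>The sum of the factors indexed by \<open>B\<close>, inside the whole layer.\<close>
  define Z where "Z = {t \<in> ?F. \<forall>l\<in>I - B. e l t \<in> ?G}"
  have ZL: "Z \<in> LL"
    unfolding Z_def
  proof (rule LLI)
    show "?G \<subseteq> {t \<in> ?F. \<forall>l\<in>I - B. e l t \<in> ?G}" using layer_le[OF i] endD(7)[OF e_end le(2)] by auto
    show "x \<oplus>\<^bsub>T\<^esub> y \<in> {t \<in> ?F. \<forall>l\<in>I - B. e l t \<in> ?G}"
      if "x \<in> {t \<in> ?F. \<forall>l\<in>I - B. e l t \<in> ?G}" "y \<in> {t \<in> ?F. \<forall>l\<in>I - B. e l t \<in> ?G}" for x y
      using that filt_closed(3)[OF le(1)] filt_closed(3)[OF le(2)] endD(2)[OF e_end] F_carrier[OF i] by simp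
    show "a \<odot>\<^bsub>T\<^esub> x \<in> {t \<in> ?F. \<forall>l\<in>I - B. e l t \<in> ?G}"
      if "a \<in> carrier R" "x \<in> {t \<in> ?F. \<forall>l\<in>I - B. e l t \<in> ?G}" for a x
      using that filt_closed(6)[OF le(1)] filt_closed(6)[OF le(2)] endD(3)[OF e_end] F_carrier[OF i] by simp
  qed auto
  interpret lat: modular_lattice_on LL "\<lambda>X Y. Y \<subseteq> X" module_sum "(\<inter>)" ?G
    using submodules_between_lattice(2)[OF filt_sub(2,1) layer_le[OF i]] .
  show ?thesis
  proof (rule lat.card_coindependent_le[OF finB finA, of N "\<lambda>l. {t \<in> ?F. e l t \<in> ?G}" Z])
    show "N k \<in> LL" if "k \<in> A" for k using NL that .
    show "Z \<in> LL" by (rule ZL)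
    show "{t \<in> ?F. e l t \<in> ?G} \<in> LL" if "l \<in> B" for l using e_kernel_LL that B by blast
    show "N k \<noteq> ?G" if k: "k \<in> A" for k
    proof
      assume eq: "N k = ?G"
      have "w k \<in> N k"
        using wF[OF k] eqmod_refl[OF le(2) wc[OF k]] rsmult_one[OF wc[OF k]] R.one_closed unfolding N_def by force
      then have "eqmod (i - 1) (w k) \<zero>\<^bsub>T\<^esub>" using eq eqmod_zero[OF le(2)] by simp
      then have "eqmod (i - 1) (pr k (w k)) (pr k \<zero>\<^bsub>T\<^esub>)" using pr_eqmod k by blast
      moreover have "pr k \<zero>\<^bsub>T\<^esub> = \<zero>\<^bsub>T\<^esub>" using endD(4)[OF p] endD(4)[OF eE[OF k]] by (simp add: pr_def)
      ultimately have "pr k (w k) \<in> ?G" using eqmod_zero[OF le(2)] by simp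
      then show False using eqmod_mem[OF le(2) prw[OF k k]] u(3)[OF k] by simp
    qed
    show "\<exists>c\<in>LL. (\<forall>j\<in>A - {k}. N j \<subseteq> c) \<and> N k \<inter> c = ?G" if k: "k \<in> A" for k
    proof -
      let ?c = "{t \<in> ?F. pr k t \<in> ?G}"
      have ekp: "e k \<otimes>\<^bsub>EE\<^esub> p \<in> carrier EE" using eE[OF k] p by simp
      have pre: "(e k \<otimes>\<^bsub>EE\<^esub> p) t = pr k t" if "t \<in> carrier T" for t using that by (simp add: end_eval pr_def)
      have cL: "?c \<in> LL"
      proof (rule LLI)
        show "?G \<subseteq> ?c" using layer_le[OF i] endD(7)[OF ekp le(2)] pre G_carrier[OF i] by auto
        show "x \<oplus>\<^bsub>T\<^esub> y \<in> ?c" if "x \<in> ?c" "y \<in> ?c" for x y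
          using that endD(2)[OF ekp, of x y] pre F_carrier[OF i] filt_closed(3)[OF le(1)] filt_closed(3)[OF le(2)] by auto
        show "a \<odot>\<^bsub>T\<^esub> x \<in> ?c" if "a \<in> carrier R" "x \<in> ?c" for a x
          using that prE[OF k that(1), of x] F_carrier[OF i] filt_closed(6)[OF le(1)] filt_closed(6)[OF le(2)] by auto
      qed auto
      have sub: "N j \<subseteq> ?c" if j: "j \<in> A - {k}" for j
      proof
        fix t assume "t \<in> N j"
        then obtain a where a: "t \<in> ?F" "a \<in> carrier R" "eqmod (i - 1) t (a \<odot>\<^bsub>T\<^esub> w j)" by (auto simp: N_def)
        have jA: "j \<in> A" "k \<noteq> j" using j by auto
        have "pr k (w j) \<in> ?G" using prw[OF k jA(1)] jA(2) eqmod_zero[OF le(2)] by simp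
        then have "a \<odot>\<^bsub>T\<^esub> pr k (w j) \<in> ?G" using filt_closed(6)[OF le(2) a(2)] by blast
        moreover have "eqmod (i - 1) (pr k t) (a \<odot>\<^bsub>T\<^esub> pr k (w j))"
          using pr_eqmod[OF k a(3)] prE[OF k a(2) wc[OF jA(1)]] by simp
        ultimately show "t \<in> ?c" using a eqmod_mem[OF le(2)] by blast
      qed
      have "N k \<inter> ?c \<subseteq> ?G"
      proof
        fix t assume t: "t \<in> N k \<inter> ?c"
        then obtain a where a: "t \<in> ?F" "a \<in> carrier R" "eqmod (i - 1) t (a \<odot>\<^bsub>T\<^esub> w k)" by (auto simp: N_def)
        have "eqmod (i - 1) (pr k t) (a \<odot>\<^bsub>T\<^esub> pr k (w k))"
          using pr_eqmod[OF k a(3)] prE[OF k a(2) wc[OF k]] by simp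
        moreover have "eqmod (i - 1) (a \<odot>\<^bsub>T\<^esub> pr k (w k)) (a \<odot>\<^bsub>T\<^esub> u k)"
          using eqmod_smult[OF le(2) a(2) prw[OF k k]] by simp
        ultimately have "eqmod (i - 1) (pr k t) (a \<odot>\<^bsub>T\<^esub> u k)" using eqmod_trans[OF le(2)] by blast
        then have "a \<odot>\<^bsub>T\<^esub> u k \<in> ?G" using t eqmod_mem[OF le(2)] by blast
        then have "eB (q (a \<odot>\<^bsub>T\<^esub> u k)) \<in> ?G" using endD(7)[OF eB le(2)] endD(7)[OF q le(2)] by blast
        then have "a \<odot>\<^bsub>T\<^esub> w k \<in> ?G"
          using endD(3)[OF q a(2) uc[OF k]] endD(3)[OF eB a(2)] endD(1)[OF q uc[OF k]] by (simp add: w_def)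
        then show "t \<in> ?G" using eqmod_mem[OF le(2) a(3)] by blast
      qed
      then have "N k \<inter> ?c = ?G" using LLD(2)[OF NL[OF k]] LLD(2)[OF cL] by blast
      then show ?thesis using cL sub by blast
    qed
    show "b \<subseteq> a \<or> a \<subseteq> b" if "l \<in> B" "a \<in> LL" "b \<in> LL" "{t \<in> ?F. e l t \<in> ?G} \<subseteq> a" "{t \<in> ?F. e l t \<in> ?G} \<subseteq> b" for l a b
      using chain_above_kernel[of l b a] that B by blast
    show "N k \<subseteq> Z" if k: "k \<in> A" for k
    proof
      fix t assume "t \<in> N k"
      then obtain a where a: "t \<in> ?F" "a \<in> carrier R" "eqmod (i - 1) t (a \<odot>\<^bsub>T\<^esub> w k)" by (auto simp: N_def)
      have "e l t \<in> ?G" if l: "l \<in> I - B" for l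
      proof -
        have lI: "l \<in> I" using l by blast
        have "e l (w k) = \<zero>\<^bsub>T\<^esub>"
          using e_finsum_eval[OF B lI, of "q (u k)"] l endD(1)[OF q uc[OF k]] by (simp add: w_def eB_def)
        then have "e l (a \<odot>\<^bsub>T\<^esub> w k) = \<zero>\<^bsub>T\<^esub>"
          using endD(3)[OF e_end[OF lI] a(2) wc[OF k]] smult_zero_right[OF a(2)] by simp
        then have "eqmod (i - 1) (e l t) \<zero>\<^bsub>T\<^esub>" using end_eqmod[OF le(2) e_end[OF lI] a(3)] by simp
        then show ?thesis using eqmod_zero[OF le(2)] by simp
      qed
      then show "t \<in> Z" using a by (simp add: Z_def)
    qed
    show "x = ?G" if x: "x \<in> LL" "x \<subseteq> Z" "\<And>l. l \<in> B \<Longrightarrow> x \<subseteq> {t \<in> ?F. e l t \<in> ?G}" for x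
    proof
      show "?G \<subseteq> x" using LLD(2)[OF x(1)] .
      show "x \<subseteq> ?G"
      proof
        fix t assume t: "t \<in> x"
        have tc: "t \<in> carrier T" using LLD(3)[OF x(1)] t F_carrier[OF i] by blast
        have "e l t \<in> ?G" if "l \<in> I" for l using x(2,3) t that by (cases "l \<in> B") (auto simp: Z_def)
        then have "(finsum EE e I) t \<in> ?G" using finsum_e_filt[OF subset_refl filt_sub(2) tc] by blast
        then show "t \<in> ?G" using tc by (simp add: e_sum_end end_eval)
      qed
    qed
  qed
qed

text \<open>
  The dual: choose elements \<open>w k\<close> that are missed by all entries in the \<open>k\<close>-th row of the error matrix \<open>D\<close>. The elements
  whose multiples miss \<open>w k\<close> form a proper submodule of the \<open>k\<close>-th factor, and the preimages \<open>N k\<close>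
  of these submodules are coindependent.
\<close>

theorem card_le_of_epi:
  assumes A: "A \<subseteq> I" and B: "B \<subseteq> I" and p: "p \<in> carrier EE" and q: "q \<in> carrier EE"
    and nz: "\<And>k. k \<in> A \<Longrightarrow> part_nonzero i k"
    and d: "\<And>k k'. \<lbrakk>k \<in> A; k' \<in> A\<rbrakk> \<Longrightarrow> \<not> part_epi i k
      (e k \<otimes>\<^bsub>EE\<^esub> p \<otimes>\<^bsub>EE\<^esub> finsum EE e B \<otimes>\<^bsub>EE\<^esub> (q \<otimes>\<^bsub>EE\<^esub> e k') \<ominus>\<^bsub>EE\<^esub> (if k = k' then e k else \<zero>\<^bsub>EE\<^esub>))"
  shows "card A \<le> card B"
proof -
  note le = i_le[OF i]
  let ?F = "filt T i" and ?G = "filt T (i - 1)"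
  have finA: "finite A" and finB: "finite B" using A B finite_I finite_subset by auto
  define eB where "eB = finsum EE e B"
  have eB: "eB \<in> carrier EE" unfolding eB_def using e_end B by (intro EE.finsum_closed) auto
  have eE: "e k \<in> carrier EE" if "k \<in> A" for k using that A e_end by blast
  define \<delta> where "\<delta> k k' = (if k = k' then e k else \<zero>\<^bsub>EE\<^esub>)" for k k'
  define D where "D k k' = e k \<otimes>\<^bsub>EE\<^esub> p \<otimes>\<^bsub>EE\<^esub> eB \<otimes>\<^bsub>EE\<^esub> (q \<otimes>\<^bsub>EE\<^esub> e k') \<ominus>\<^bsub>EE\<^esub> \<delta> k k'" for k k'
  have \<delta>E: "\<delta> k k' \<in> carrier EE" if "k \<in> A" for k k' using eE[OF that] by (auto simp: \<delta>_def end_closed)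
  have DE: "D k k' \<in> carrier EE" if "k \<in> A" "k' \<in> A" for k k'
    using eE[OF that(1)] eE[OF that(2)] \<delta>E[OF that(1)] p q eB by (simp add: D_def)
  have Dev: "D k k' t = e k (p (eB (q (e k' t)))) \<ominus>\<^bsub>T\<^esub> \<delta> k k' t" if "k \<in> A" "k' \<in> A" "t \<in> carrier T" for k k' t
  proof -
    have c: "e k' t \<in> carrier T" "q (e k' t) \<in> carrier T" "eB (q (e k' t)) \<in> carrier T"
      using that eE endD(1) q eB by auto
    show ?thesis unfolding D_def
      using that eE[OF that(1)] eE[OF that(2)] \<delta>E[OF that(1)] p q eB c
      by (simp add: end_diff end_eval end_closed)
  qed
  have Dnot: "\<not> part_epi i k (D k k')" if "k \<in> A" "k' \<in> A" for k k'
    using d[OF that] by (simp add: D_def eB_def \<delta>_def)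
  have eD: "e k (D k k' t) = D k k' t" if "k \<in> A" "k' \<in> A" "t \<in> carrier T" for k k' t
  proof -
    have k: "k \<in> I" "k' \<in> I" using that A by auto
    have c: "\<delta> k k' t \<in> carrier T" "p (eB (q (e k' t))) \<in> carrier T" "e k (p (eB (q (e k' t)))) \<in> carrier T"
      using that eE endD(1) p q eB \<delta>E by auto
    have "e k (\<delta> k k' t) = \<delta> k k' t"
      using that endD(4)[OF eE[OF that(1)]] e_e[OF k(1) that(3)] by (auto simp: \<delta>_def end_eval)
    then show ?thesis
      using Dev[OF that] endD(6)[OF eE[OF that(1)] c(3,1)] e_e[OF k(1) c(2)] by simp
  qed
  have "\<exists>w\<in>?F. e k w = w \<and> w \<notin> ?G \<and> (\<forall>h\<in>(\<lambda>k'. D k k') ` A. \<forall>u\<in>?F. \<not> eqmod (i - 1) (h u) w)"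
    if k: "k \<in> A" for k
  proof (rule common_cokernel[OF i _ _ nz[OF k]])
    show "k \<in> I" using k A by blast
    show "finite ((\<lambda>k'. D k k') ` A)" using finA by simp
    fix h assume "h \<in> (\<lambda>k'. D k k') ` A"
    then obtain k' where k': "k' \<in> A" "h = D k k'" by blast
    show "h \<in> carrier EE \<and> (\<forall>t\<in>carrier T. e k (h t) = h t)
        \<and> (\<exists>v\<in>?F. \<forall>u\<in>?F. \<not> eqmod (i - 1) (h u) (e k v))"
      using Dnot[OF k k'(1)] nz[OF k] DE[OF k k'(1)] eD[OF k k'(1)] k'(2) by (auto simp: part_epi_def)
  qed
  then obtain w where w: "\<And>k. k \<in> A \<Longrightarrow> w k \<in> ?F" "\<And>k. k \<in> A \<Longrightarrow> e k (w k) = w k"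
    "\<And>k. k \<in> A \<Longrightarrow> w k \<notin> ?G"
    "\<And>k m u. k \<in> A \<Longrightarrow> m \<in> A \<Longrightarrow> u \<in> ?F \<Longrightarrow> \<not> eqmod (i - 1) (D k m u) (w k)"
    by (metis image_eqI)
  have wc: "w m \<in> carrier T" if "m \<in> A" for m using w(1)[OF that] F_carrier[OF i] by blast
  define P where "P k = e k \<otimes>\<^bsub>EE\<^esub> p \<otimes>\<^bsub>EE\<^esub> eB" for k
  have PE: "P k \<in> carrier EE" if "k \<in> A" for k using eE[OF that] p eB by (simp add: P_def)
  have Pev: "P k t = e k (p (eB t))" if "t \<in> carrier T" for k t
    using that endD(1)[OF eB] by (simp add: P_def end_eval)
  have eP: "e k (P k t) = P k t" if "k \<in> A" "t \<in> carrier T" for k t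
    using Pev[OF that(2)] e_e[of k "p (eB t)"] endD(1)[OF p endD(1)[OF eB that(2)]] that(1) A by auto
  have PF: "P k t \<in> ?F" if "k \<in> A" "t \<in> ?F" for k t using endD(7)[OF PE[OF that(1)] le(1) that(2)] .
  define N where "N k = {t \<in> ?F. \<forall>a\<in>carrier R. \<not> eqmod (i - 1) (a \<odot>\<^bsub>T\<^esub> P k t) (w k)}" for k
  have Gnot: "\<not> eqmod (i - 1) t (w k)" if "k \<in> A" "t \<in> ?G" for k t
    using w(3)[OF that(1)] eqmod_mem[OF le(2)] that(2) by blast
  have NL: "N k \<in> LL" if k: "k \<in> A" for k
  proof (rule LLI)
    note Pk = endD[OF PE[OF k]]
    show "?G \<subseteq> N k"
    proof
      fix t assume t: "t \<in> ?G"
      have "a \<odot>\<^bsub>T\<^esub> P k t \<in> ?G" if "a \<in> carrier R" for a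
        using filt_closed(6)[OF le(2) that] Pk(7)[OF le(2) t] by blast
      then show "t \<in> N k" using t layer_le[OF i] Gnot[OF k] by (auto simp: N_def)
    qed
    have sm: "c \<odot>\<^bsub>T\<^esub> x \<in> N k" if c: "c \<in> carrier R" and x: "x \<in> N k" for c x
    proof -
      have xF: "x \<in> ?F" and xn: "\<And>a. a \<in> carrier R \<Longrightarrow> \<not> eqmod (i - 1) (a \<odot>\<^bsub>T\<^esub> P k x) (w k)" using x by (auto simp: N_def)
      have xc: "x \<in> carrier T" using xF F_carrier[OF i] by blast
      have "a \<odot>\<^bsub>T\<^esub> P k (c \<odot>\<^bsub>T\<^esub> x) = (c \<otimes>\<^bsub>R\<^esub> a) \<odot>\<^bsub>T\<^esub> P k x" if "a \<in> carrier R" for a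
        using Pk(3)[OF c xc] rsmult_assoc[OF c that Pk(1)[OF xc]] by simp
      then show ?thesis using xn c xF filt_closed(6)[OF le(1)] R.m_closed by (simp add: N_def)
    qed
    then show "\<And>c x. \<lbrakk>c \<in> carrier R; x \<in> N k\<rbrakk> \<Longrightarrow> c \<odot>\<^bsub>T\<^esub> x \<in> N k" .
    have add: "x \<oplus>\<^bsub>T\<^esub> y \<in> N k" if x: "x \<in> N k" and y: "y \<in> N k"
      and c: "c \<in> carrier R" "eqmod (i - 1) (P k x) (c \<odot>\<^bsub>T\<^esub> P k y)" for x y c
    proof -
      have xF: "x \<in> ?F" and yF: "y \<in> ?F"
        and yn: "\<And>a. a \<in> carrier R \<Longrightarrow> \<not> eqmod (i - 1) (a \<odot>\<^bsub>T\<^esub> P k y) (w k)" using x y by (auto simp: N_def)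
      have xc: "x \<in> carrier T" "y \<in> carrier T" using xF yF F_carrier[OF i] by auto
      have "\<not> eqmod (i - 1) (a \<odot>\<^bsub>T\<^esub> P k (x \<oplus>\<^bsub>T\<^esub> y)) (w k)" if a: "a \<in> carrier R" for a
      proof
        assume h: "eqmod (i - 1) (a \<odot>\<^bsub>T\<^esub> P k (x \<oplus>\<^bsub>T\<^esub> y)) (w k)"
        have "eqmod (i - 1) (P k x \<oplus>\<^bsub>T\<^esub> P k y) (c \<odot>\<^bsub>T\<^esub> P k y \<oplus>\<^bsub>T\<^esub> P k y)"
          using eqmod_add[OF le(2) c(2) eqmod_refl[OF le(2) Pk(1)[OF xc(2)]]] .
        then have "eqmod (i - 1) (a \<odot>\<^bsub>T\<^esub> P k (x \<oplus>\<^bsub>T\<^esub> y)) (a \<odot>\<^bsub>T\<^esub> (c \<odot>\<^bsub>T\<^esub> P k y \<oplus>\<^bsub>T\<^esub> P k y))"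
          using eqmod_smult[OF le(2) a] Pk(2)[OF xc] by simp
        moreover have "a \<odot>\<^bsub>T\<^esub> (c \<odot>\<^bsub>T\<^esub> P k y \<oplus>\<^bsub>T\<^esub> P k y) = ((c \<otimes>\<^bsub>R\<^esub> a) \<oplus>\<^bsub>R\<^esub> a) \<odot>\<^bsub>T\<^esub> P k y"
          using a c Pk(1)[OF xc(2)] by (simp add: rsmult_distr_module rsmult_distr_ring rsmult_assoc rsmult_closed)
        ultimately have "eqmod (i - 1) (((c \<otimes>\<^bsub>R\<^esub> a) \<oplus>\<^bsub>R\<^esub> a) \<odot>\<^bsub>T\<^esub> P k y) (w k)"
          using eqmod_trans[OF le(2) eqmod_sym[OF le(2)] h] by simp
        then show False using yn a c by simp
      qed
      then show ?thesis using xF yF filt_closed(3)[OF le(1)] by (simp add: N_def)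
    qed
    fix x y assume x: "x \<in> N k" and y: "y \<in> N k"
    have F: "x \<in> ?F" "y \<in> ?F" using x y by (auto simp: N_def)
    have c: "x \<in> carrier T" "y \<in> carrier T" using F F_carrier[OF i] by auto
    have kI: "k \<in> I" using k A by blast
    from uniserial_eqmod[OF i kI PF[OF k F(1)] PF[OF k F(2)]] show "x \<oplus>\<^bsub>T\<^esub> y \<in> N k"
      using add[OF x y] add[OF y x] eP[OF k] c M.a_comm[OF c] by auto
  qed (auto simp: N_def)
  \<comment> \<open>The complement of the sum of the factors indexed by \<open>B\<close>.\<close>
  define Z where "Z = {t \<in> ?F. \<forall>l\<in>B. e l t \<in> ?G}"
  have eEB: "e l \<in> carrier EE" if "l \<in> B" for l using e_end B that by blast
  have ZL: "Z \<in> LL"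
    unfolding Z_def
  proof (rule LLI)
    show "?G \<subseteq> {t \<in> ?F. \<forall>l\<in>B. e l t \<in> ?G}" using layer_le[OF i] endD(7)[OF eEB le(2)] by auto
    show "x \<oplus>\<^bsub>T\<^esub> y \<in> {t \<in> ?F. \<forall>l\<in>B. e l t \<in> ?G}"
      if "x \<in> {t \<in> ?F. \<forall>l\<in>B. e l t \<in> ?G}" "y \<in> {t \<in> ?F. \<forall>l\<in>B. e l t \<in> ?G}" for x y
      using that filt_closed(3)[OF le(1)] filt_closed(3)[OF le(2)] endD(2)[OF eEB] F_carrier[OF i] by simp
    show "a \<odot>\<^bsub>T\<^esub> x \<in> {t \<in> ?F. \<forall>l\<in>B. e l t \<in> ?G}"
      if "a \<in> carrier R" "x \<in> {t \<in> ?F. \<forall>l\<in>B. e l t \<in> ?G}" for a x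
      using that filt_closed(6)[OF le(1)] filt_closed(6)[OF le(2)] endD(3)[OF eEB] F_carrier[OF i] by simp
  qed auto
  interpret lat: modular_lattice_on LL "(\<subseteq>)" "(\<inter>)" module_sum ?F
    using submodules_between_lattice(1)[OF filt_sub(2,1) layer_le[OF i]] .
  have P_split: "P k (t \<ominus>\<^bsub>T\<^esub> q (P k t)) = D k k (\<ominus>\<^bsub>T\<^esub> P k t)" if k: "k \<in> A" and t: "t \<in> carrier T" for k t
  proof -
    have c: "P k t \<in> carrier T" "q (P k t) \<in> carrier T" using endD(1)[OF PE[OF k] t] endD(1)[OF q] by auto
    have "D k k (P k t) = P k (q (P k t)) \<ominus>\<^bsub>T\<^esub> P k t"
      using Dev[OF k k c(1)] eP[OF k t] Pev[OF c(2)] by (simp add: \<delta>_def)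
    then have "D k k (\<ominus>\<^bsub>T\<^esub> P k t) = \<ominus>\<^bsub>T\<^esub> (P k (q (P k t)) \<ominus>\<^bsub>T\<^esub> P k t)"
      using endD(5)[OF DE[OF k k] c(1)] by simp
    also have "\<dots> = P k t \<ominus>\<^bsub>T\<^esub> P k (q (P k t))"
      using c endD(1)[OF PE[OF k] c(2)] by (simp add: M.minus_eq M.minus_add M.a_comm)
    finally show ?thesis using endD(6)[OF PE[OF k] t c(2)] by simp
  qed
  show ?thesis
  proof (rule lat.card_coindependent_le[OF finB finA, of N "\<lambda>l. {t \<in> ?F. eqmod (i - 1) (e l t) t}" Z])
    show "N k \<in> LL" if "k \<in> A" for k using NL that .
    show "Z \<in> LL" by (rule ZL)
    show "{t \<in> ?F. eqmod (i - 1) (e l t) t} \<in> LL" if "l \<in> B" for l using e_image_LL that B by blast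
    show "a \<subseteq> b \<or> b \<subseteq> a" if "l \<in> B" "a \<in> LL" "b \<in> LL" "a \<subseteq> {t \<in> ?F. eqmod (i - 1) (e l t) t}"
      "b \<subseteq> {t \<in> ?F. eqmod (i - 1) (e l t) t}" for l a b
      using chain_below_image[of l a b] that B by blast
    show "Z \<subseteq> N k" if k: "k \<in> A" for k
    proof
      fix t assume t: "t \<in> Z"
      then have tF: "t \<in> ?F" "t \<in> carrier T" using F_carrier[OF i] by (auto simp: Z_def)
      have "eB t \<in> ?G" unfolding eB_def using finsum_e_filt[OF B filt_sub(2) tF(2)] t by (simp add: Z_def)
      then have "P k t \<in> ?G"
        using Pev[OF tF(2)] endD(7)[OF p le(2)] endD(7)[OF eE[OF k] le(2)] by simp
      then have "a \<odot>\<^bsub>T\<^esub> P k t \<in> ?G" if "a \<in> carrier R" for a using filt_closed(6)[OF le(2) that] by blast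
      then show "t \<in> N k" using tF Gnot[OF k] by (auto simp: N_def)
    qed
    show "x = ?F" if x: "x \<in> LL" "Z \<subseteq> x" "\<And>l. l \<in> B \<Longrightarrow> {t \<in> ?F. eqmod (i - 1) (e l t) t} \<subseteq> x" for x
    proof
      show "x \<subseteq> ?F" using LLD(3)[OF x(1)] .
      show "?F \<subseteq> x"
      proof
        fix t assume t: "t \<in> ?F"
        have tc: "t \<in> carrier T" using t F_carrier[OF i] by blast
        have lI: "l \<in> I" if "l \<in> B" for l using B that by blast
        have elt: "e l t \<in> carrier T" if "l \<in> B" for l using endD(1)[OF eEB[OF that] tc] .
        have "e l t \<in> x" if l: "l \<in> B" for l
          using x(3)[OF l] e_F[OF i lI[OF l] t] e_e[OF lI[OF l] tc] eqmod_refl[OF le(2) elt[OF l]] by auto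
        then have 1: "eB t \<in> x" unfolding eB_def using finsum_e_filt[OF B LLD(1)[OF x(1)] tc] by blast
        have eBc: "eB t \<in> carrier T" using endD(1)[OF eB tc] .
        have "e l (t \<ominus>\<^bsub>T\<^esub> eB t) \<in> ?G" if l: "l \<in> B" for l
          using endD(6)[OF eEB[OF l] tc eBc] e_finsum_eval[OF B lI[OF l] tc] l elt[OF l]
            filt_closed(2)[OF le(2)] by (simp add: eB_def M.minus_eq M.r_neg)
        moreover have "t \<ominus>\<^bsub>T\<^esub> eB t \<in> ?F" using filt_closed(5)[OF le(1) t] endD(7)[OF eB le(1) t] by blast
        ultimately have "t \<ominus>\<^bsub>T\<^esub> eB t \<in> x" using x(2) by (auto simp: Z_def)
        then have "(t \<ominus>\<^bsub>T\<^esub> eB t) \<oplus>\<^bsub>T\<^esub> eB t \<in> x" using 1 submoduleD(3)[OF LLD(1)[OF x(1)]] by blast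
        then show "t \<in> x" using tc eBc by (simp add: M.minus_eq M.a_assoc M.l_neg)
      qed
    qed
    show "\<exists>c\<in>LL. (\<forall>j\<in>A - {k}. c \<subseteq> N j) \<and> module_sum (N k) c = ?F" if k: "k \<in> A" for k
    proof -
      let ?c = "{t \<in> ?F. \<exists>u\<in>?F. eqmod (i - 1) t (q (e k u))}"
      have qe: "q \<otimes>\<^bsub>EE\<^esub> e k \<in> carrier EE" using q eE[OF k] by simp
      have qev: "(q \<otimes>\<^bsub>EE\<^esub> e k) u = q (e k u)" if "u \<in> ?F" for u using F_carrier[OF i that] by (simp add: end_eval)
      have cL: "?c \<in> LL"
      proof (rule LLI)
        show "?G \<subseteq> ?c"
        proof
          fix t assume t: "t \<in> ?G"
          have "eqmod (i - 1) t (q (e k \<zero>\<^bsub>T\<^esub>))"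
            using t eqmod_zero[OF le(2)] endD(4)[OF q] endD(4)[OF eE[OF k]] by simp
          then show "t \<in> ?c" using t layer_le[OF i] filt_closed(2)[OF le(1)] by blast
        qed
        show "x \<oplus>\<^bsub>T\<^esub> y \<in> ?c" if x: "x \<in> ?c" and y: "y \<in> ?c" for x y
        proof -
          obtain u v where u: "x \<in> ?F" "u \<in> ?F" "eqmod (i - 1) x (q (e k u))" and v: "y \<in> ?F" "v \<in> ?F" "eqmod (i - 1) y (q (e k v))"
            using x y by blast
          have "eqmod (i - 1) (x \<oplus>\<^bsub>T\<^esub> y) (q (e k (u \<oplus>\<^bsub>T\<^esub> v)))"
            using eqmod_add[OF le(2) u(3) v(3)] endD(2)[OF qe, of u v] u v qev F_carrier[OF i] filt_closed(3)[OF le(1)] by simp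
          then show ?thesis using u v filt_closed(3)[OF le(1)] by blast
        qed
        show "a \<odot>\<^bsub>T\<^esub> x \<in> ?c" if a: "a \<in> carrier R" and x: "x \<in> ?c" for a x
        proof -
          obtain u where u: "x \<in> ?F" "u \<in> ?F" "eqmod (i - 1) x (q (e k u))" using x by blast
          have "eqmod (i - 1) (a \<odot>\<^bsub>T\<^esub> x) (q (e k (a \<odot>\<^bsub>T\<^esub> u)))"
            using eqmod_smult[OF le(2) a u(3)] endD(3)[OF qe a, of u] u qev a F_carrier[OF i] filt_closed(6)[OF le(1)] by simp
          then show ?thesis using u a filt_closed(6)[OF le(1)] by blast
        qed
      qed auto
      have sub: "?c \<subseteq> N j" if j: "j \<in> A - {k}" for j
      proof
        fix t assume "t \<in> ?c"
        then obtain u where u: "t \<in> ?F" "u \<in> ?F" "eqmod (i - 1) t (q (e k u))" by blast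
        have jA: "j \<in> A" "j \<noteq> k" using j by auto
        have uc: "u \<in> carrier T" "q (e k u) \<in> carrier T" using F_carrier[OF i u(2)] endD(1)[OF qe] qev[OF u(2)] by force+
        have Dc: "D j k u \<in> carrier T" using endD(1)[OF DE[OF jA(1) k] uc(1)] .
        have "P j (q (e k u)) = D j k u"
          using Dev[OF jA(1) k uc(1)] jA(2) Pev[OF uc(2)] endD(1)[OF PE[OF jA(1)] uc(2)] uc
          by (simp add: \<delta>_def end_eval M.minus_eq neg_zero)
        then have Pt: "eqmod (i - 1) (P j t) (D j k u)" using end_eqmod[OF le(2) PE[OF jA(1)] u(3)] by simp
        have "\<not> eqmod (i - 1) (a \<odot>\<^bsub>T\<^esub> P j t) (w j)" if a: "a \<in> carrier R" for a
        proof
          assume h: "eqmod (i - 1) (a \<odot>\<^bsub>T\<^esub> P j t) (w j)"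
          have "eqmod (i - 1) (a \<odot>\<^bsub>T\<^esub> P j t) (D j k (a \<odot>\<^bsub>T\<^esub> u))"
            using eqmod_smult[OF le(2) a Pt] endD(3)[OF DE[OF jA(1) k] a uc(1)] by simp
          then have "eqmod (i - 1) (D j k (a \<odot>\<^bsub>T\<^esub> u)) (w j)" using eqmod_trans[OF le(2) eqmod_sym[OF le(2)] h] by blast
          then show False using w(4)[OF jA(1) k] filt_closed(6)[OF le(1) a u(2)] by blast
        qed
        then show "t \<in> N j" using u by (simp add: N_def)
      qed
      have "?F \<subseteq> module_sum (N k) ?c"
      proof
        fix t assume t: "t \<in> ?F"
        have tc: "t \<in> carrier T" using F_carrier[OF i t] .
        have y: "P k t \<in> ?F" "P k t \<in> carrier T" "e k (P k t) = P k t"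
          using PF[OF k t] F_carrier[OF i] eP[OF k tc] by auto
        have qy: "q (P k t) \<in> ?F" "q (P k t) \<in> carrier T" using endD(7)[OF q le(1) y(1)] F_carrier[OF i] by auto
        let ?t = "t \<ominus>\<^bsub>T\<^esub> q (P k t)"
        have tF: "?t \<in> ?F" using filt_closed(5)[OF le(1) t qy(1)] .
        have "a \<odot>\<^bsub>T\<^esub> P k ?t = D k k (a \<odot>\<^bsub>T\<^esub> \<ominus>\<^bsub>T\<^esub> P k t)" if "a \<in> carrier R" for a
          using P_split[OF k tc] endD(3)[OF DE[OF k k] that] y by simp
        then have "?t \<in> N k"
          using tF w(4)[OF k k] filt_closed(4,6)[OF le(1)] y(1) by (simp add: N_def)
        moreover have "q (P k t) \<in> ?c" using qy y eqmod_refl[OF le(2) qy(2)] by (intro CollectI conjI bexI[of _ "P k t"]) simp_all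
        moreover have "t = ?t \<oplus>\<^bsub>T\<^esub> q (P k t)" using tc qy by (simp add: M.minus_eq M.a_assoc M.l_neg)
        ultimately show "t \<in> module_sum (N k) ?c" unfolding module_sum_def by blast
      qed
      moreover have "module_sum (N k) ?c \<subseteq> ?F"
        using module_sum_least[OF filt_sub(1)] LLD(3)[OF NL[OF k]] LLD(3)[OF cL] by blast
      ultimately show ?thesis using cL sub by blast
    qed
    show "N k \<noteq> ?F" if k: "k \<in> A" for k
    proof
      assume eq: "N k = ?F"
      have kI: "k \<in> I" using k A by blast
      let ?y = "P k (q (w k))"
      have qw: "q (w k) \<in> ?F" "q (w k) \<in> carrier T" using endD(7)[OF q le(1) w(1)[OF k]] endD(1)[OF q wc[OF k]] by auto
      have yF: "?y \<in> ?F" "?y \<in> carrier T" "e k ?y = ?y" using PF[OF k qw(1)] F_carrier[OF i] eP[OF k qw(2)] by auto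
      have Dw: "D k k (w k) = ?y \<ominus>\<^bsub>T\<^esub> w k"
        using Dev[OF k k wc[OF k]] w(2)[OF k] Pev[OF qw(2)] by (simp add: \<delta>_def)
      have no: "\<not> eqmod (i - 1) (a \<odot>\<^bsub>T\<^esub> ?y) (w k)" if "a \<in> carrier R" for a
        using qw(1) eq that by (auto simp: N_def)
      have DF: "D k k (w k) \<in> ?F" "e k (D k k (w k)) = D k k (w k)" "D k k (w k) \<in> carrier T"
        using endD(7)[OF DE[OF k k] le(1) w(1)[OF k]] eD[OF k k wc[OF k]] endD(1)[OF DE[OF k k] wc[OF k]] by auto
      have wy: "w k = ?y \<ominus>\<^bsub>T\<^esub> D k k (w k)"
        using wc[OF k] yF by (simp add: Dw M.minus_eq M.minus_add M.a_lcomm[of ?y] M.r_neg M.a_ac)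
      \<comment> \<open>One of \<open>?y\<close> and \<open>D k k (w k)\<close> is a multiple of the other. As \<open>w k\<close> is their difference, it is
        in the image of \<open>D k k\<close> or a multiple of \<open>?y\<close>; neither is possible.\<close>
      consider a where "a \<in> carrier R" "eqmod (i - 1) ?y (a \<odot>\<^bsub>T\<^esub> D k k (w k))"
        | a where "a \<in> carrier R" "eqmod (i - 1) (D k k (w k)) (a \<odot>\<^bsub>T\<^esub> ?y)"
        using uniserial_eqmod[OF i kI yF(1) DF(1)] yF DF by auto
      then show False
      proof cases
        case 1
        let ?u = "a \<odot>\<^bsub>T\<^esub> w k \<ominus>\<^bsub>T\<^esub> w k"
        have uF: "?u \<in> ?F" using filt_closed(5,6)[OF le(1)] w(1)[OF k] 1(1) by blast
        have "D k k ?u = a \<odot>\<^bsub>T\<^esub> D k k (w k) \<ominus>\<^bsub>T\<^esub> D k k (w k)"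
          using endD(3,6)[OF DE[OF k k]] 1(1) wc[OF k] rsmult_closed by simp
        moreover have "eqmod (i - 1) (a \<odot>\<^bsub>T\<^esub> D k k (w k) \<ominus>\<^bsub>T\<^esub> D k k (w k)) (?y \<ominus>\<^bsub>T\<^esub> D k k (w k))"
          using eqmod_add[OF le(2) eqmod_sym[OF le(2) 1(2)] eqmod_refl[OF le(2), of "\<ominus>\<^bsub>T\<^esub> D k k (w k)"]] DF(3)
          by (simp add: M.minus_eq)
        ultimately have "eqmod (i - 1) (D k k ?u) (w k)" using wy by simp
        then show False using w(4)[OF k k uF] by blast
      next
        case 2
        let ?b = "\<one>\<^bsub>R\<^esub> \<oplus>\<^bsub>R\<^esub> \<ominus>\<^bsub>R\<^esub> \<one>\<^bsub>R\<^esub> \<otimes>\<^bsub>R\<^esub> a"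
        have ay: "a \<odot>\<^bsub>T\<^esub> ?y \<in> carrier T" using rsmult_closed 2(1) yF by blast
        have "?b \<odot>\<^bsub>T\<^esub> ?y = ?y \<oplus>\<^bsub>T\<^esub> a \<odot>\<^bsub>T\<^esub> (\<ominus>\<^bsub>T\<^esub> ?y)"
          using 2(1) yF(2) by (simp add: rsmult_distr_ring rsmult_assoc rsmult_one smult_neg_one)
        then have b: "?b \<odot>\<^bsub>T\<^esub> ?y = ?y \<ominus>\<^bsub>T\<^esub> a \<odot>\<^bsub>T\<^esub> ?y" using 2(1) yF(2) by (simp add: smult_minus M.minus_eq)
        have "eqmod (i - 1) (?y \<ominus>\<^bsub>T\<^esub> a \<odot>\<^bsub>T\<^esub> ?y) (?y \<ominus>\<^bsub>T\<^esub> D k k (w k))"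
          using eqmod_add[OF le(2) eqmod_refl[OF le(2) yF(2)] eqmod_neg[OF le(2) eqmod_sym[OF le(2) 2(2)]]]
          by (simp add: M.minus_eq)
        then have "eqmod (i - 1) (?b \<odot>\<^bsub>T\<^esub> ?y) (w k)" using b wy by simp
        then show False using no[of ?b] 2(1) by simp
      qed
    qed
  qed
qed

end

end

section \<open>Matching the summands of the two halves\<close>

context decomposed_object
begin

lemma rel_part_nonzero: "PS.rel j x \<Longrightarrow> part_nonzero (j div 2) x"
  by (auto simp: PS.rel_def nz_def part_mono_def part_epi_def split: if_splits)

lemma rel_iff: assumes "i \<in> {1..n}" "x \<in> I"
  shows "PS.rel (2 * i) x \<longleftrightarrow> part_nonzero i x" "PS.rel (Suc (2 * i)) x \<longleftrightarrow> part_nonzero i x"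
  unfolding PS.rel_def nz_simps layer_indices_iff
  using part_id[OF assms] assms(1) unfolding part_mono_def part_epi_def by blast+

text \<open>The predicate \<open>c\<close> colours the summands; \<open>s\<close> is an involution that exchanges the two colours.\<close>

lemma class_bijection:
  assumes s: "s \<in> carrier EE" "s \<otimes>\<^bsub>EE\<^esub> s = \<one>\<^bsub>EE\<^esub>"
    and odd: "\<And>x y. \<lbrakk>x \<in> I; y \<in> I; c x = c y\<rbrakk> \<Longrightarrow> e y \<otimes>\<^bsub>EE\<^esub> s \<otimes>\<^bsub>EE\<^esub> e x = \<zero>\<^bsub>EE\<^esub>"
    and j: "j \<in> layer_indices n"
  shows "\<exists>\<phi>. bij_betw \<phi> {x \<in> I. PS.rel j x \<and> c x} {x \<in> I. PS.rel j x \<and> \<not> c x} \<and>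
    (\<forall>x\<in>{x \<in> I. PS.rel j x \<and> c x}. PS.sim j x (\<phi> x))"
proof (rule bij_betw_respecting_classes)
  let ?X = "{x \<in> I. PS.rel j x \<and> c x}" and ?Y = "{x \<in> I. PS.rel j x \<and> \<not> c x}"
  have i: "j div 2 \<in> {1..n}" using j by (auto simp: layer_indices_def)
  have dim: "card A \<le> card B"
    if "A \<subseteq> I" "B \<subseteq> I" "p \<in> carrier EE" "q \<in> carrier EE" "\<And>k. k \<in> A \<Longrightarrow> PS.rel j k"
      "\<And>k k'. \<lbrakk>k \<in> A; k' \<in> A\<rbrakk> \<Longrightarrow> \<not> nz j k' k (e k \<otimes>\<^bsub>EE\<^esub> p \<otimes>\<^bsub>EE\<^esub> (\<Oplus>\<^bsub>EE\<^esub>l\<in>B. e l) \<otimes>\<^bsub>EE\<^esub> (q \<otimes>\<^bsub>EE\<^esub> e k')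
        \<ominus>\<^bsub>EE\<^esub> (if k = k' then e k else \<zero>\<^bsub>EE\<^esub>))" for A B p q
  proof (cases "even j")
    case True
    then show ?thesis
      using card_le_of_mono[OF i that(1-4)] that(5,6) rel_part_nonzero by (simp add: nz_def)
  next
    case False
    then show ?thesis
      using card_le_of_epi[OF i that(1-4)] that(5,6) rel_part_nonzero by (simp add: nz_def)
  qed
  show "finite ?X" "finite ?Y" using finite_I by auto
  show "PS.sim j x x" if "x \<in> ?X \<union> ?Y" for x using PS.sim_refl[of x j] that by auto
  show "PS.sim j y x" if "PS.sim j x y" for x y using PS.sim_sym that by blast
  show "PS.sim j x z" if "x \<in> ?X \<union> ?Y" "y \<in> ?X \<union> ?Y" "z \<in> ?X \<union> ?Y" "PS.sim j x y" "PS.sim j y z" for x y z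
    using PS.sim_trans[OF j, of x y z] that by auto
  show "card {x \<in> ?X. PS.sim j z x} = card {y \<in> ?Y. PS.sim j z y}" if z: "z \<in> ?X \<union> ?Y" for z
  proof -
    have zI: "z \<in> I" using z by auto
    have r: "PS.rel j x" if "x \<in> I" "PS.sim j z x" for x using PS.sim_rel[OF j zI that] by blast
    have 1: "{x \<in> ?X. PS.sim j z x} = {x \<in> I. PS.sim j z x \<and> c x = True}" using r by auto
    have 2: "{x \<in> ?Y. PS.sim j z x} = {x \<in> I. PS.sim j z x \<and> c x = False}" using r by auto
    have "card {x \<in> I. PS.sim j z x \<and> c x = b} \<le> card {x \<in> I. PS.sim j z x \<and> c x = (\<not> b)}" for b
      by (rule PS.class_card_le[OF s odd dim j zI])
    from this[of True] this[of False] show ?thesis unfolding 1 2 by simp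
  qed
qed

text \<open>Class-preserving bijections between the two colours yield a unit that exchanges the colours.\<close>

lemma odd_unit:
  assumes "\<And>j. j \<in> layer_indices n \<Longrightarrow>
      bij_betw (\<phi> j) {x \<in> I. PS.rel j x \<and> c x} {x \<in> I. PS.rel j x \<and> \<not> c x} \<and>
      (\<forall>x\<in>{x \<in> I. PS.rel j x \<and> c x}. PS.sim j x (\<phi> j x))"
  shows "\<exists>s\<in>Units EE. \<forall>x\<in>I. \<forall>y\<in>I. c x = c y \<longrightarrow> e y \<otimes>\<^bsub>EE\<^esub> s \<otimes>\<^bsub>EE\<^esub> e x = \<zero>\<^bsub>EE\<^esub>"
proof -
  define X where "X j = {x \<in> I. PS.rel j x \<and> c x}" for j
  define Y where "Y j = {x \<in> I. PS.rel j x \<and> \<not> c x}" for j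
  have b: "bij_betw (\<phi> j) (X j) (Y j)" "\<And>x. x \<in> X j \<Longrightarrow> PS.sim j x (\<phi> j x)" if "j \<in> layer_indices n" for j
    using assms[OF that] by (auto simp: X_def Y_def)
  define \<pi> where "\<pi> j x = (if c x then \<phi> j x else inv_into (X j) (\<phi> j) x)" for j x
  have main: "\<pi> j x \<in> I \<and> PS.sim j x (\<pi> j x) \<and> \<pi> j (\<pi> j x) = x \<and> c (\<pi> j x) \<noteq> c x"
    if x: "x \<in> I" and r: "PS.rel j x" for j x
  proof -
    have j: "j \<in> layer_indices n" using r by (simp add: PS.rel_def)
    show ?thesis
    proof (cases "c x")
      case True
      then have xX: "x \<in> X j" using x r by (simp add: X_def)
      then have y: "\<phi> j x \<in> Y j" using b(1)[OF j] bij_betw_apply by fastforce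
      have "inv_into (X j) (\<phi> j) (\<phi> j x) = x" using b(1)[OF j] xX bij_betw_inv_into_left by fastforce
      then show ?thesis using True y b(2)[OF j xX] by (simp add: \<pi>_def Y_def)
    next
      case False
      then have xY: "x \<in> Y j" using x r by (simp add: Y_def)
      let ?y = "inv_into (X j) (\<phi> j) x"
      have y: "?y \<in> X j" using bij_betw_inv_into[OF b(1)[OF j]] xY bij_betw_apply by fastforce
      have "\<phi> j ?y = x" using b(1)[OF j] xY bij_betw_inv_into_right by fastforce
      then show ?thesis using False y b(2)[OF j y] PS.sim_sym by (simp add: \<pi>_def X_def)
    qed
  qed
  obtain s where "s \<in> Units EE"
    "\<And>x y. \<lbrakk>x \<in> I; y \<in> I; \<forall>j. PS.rel j x \<longrightarrow> \<pi> j x \<noteq> y\<rbrakk> \<Longrightarrow> e y \<otimes>\<^bsub>EE\<^esub> s \<otimes>\<^bsub>EE\<^esub> e x = \<zero>\<^bsub>EE\<^esub>"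
    using PS.unit_from_involutions[of \<pi>] main by blast
  then show ?thesis using main by metis
qed

text \<open>
  An endomorphism without blocks between summands of the same colour maps elements supported on one
  colour to elements supported on the other.
\<close>

lemma odd_maps:
  assumes s: "s \<in> carrier EE"
    and odd: "\<And>x y. \<lbrakk>x \<in> I; y \<in> I; c x = c y\<rbrakk> \<Longrightarrow> e y \<otimes>\<^bsub>EE\<^esub> s \<otimes>\<^bsub>EE\<^esub> e x = \<zero>\<^bsub>EE\<^esub>"
    and t: "t \<in> carrier T" "\<And>y. \<lbrakk>y \<in> I; c y \<noteq> b\<rbrakk> \<Longrightarrow> e y t = \<zero>\<^bsub>T\<^esub>" and x: "x \<in> I" "c x = b"
  shows "e x (s t) = \<zero>\<^bsub>T\<^esub>"
proof -
  have ex: "e x \<in> carrier EE" "e x \<otimes>\<^bsub>EE\<^esub> s \<in> carrier EE" using e_end x s by auto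
  have eq: "e x \<otimes>\<^bsub>EE\<^esub> s = (\<Oplus>\<^bsub>EE\<^esub>y\<in>I. (e x \<otimes>\<^bsub>EE\<^esub> s \<otimes>\<^bsub>EE\<^esub> e y) \<otimes>\<^bsub>EE\<^esub> (e y \<otimes>\<^bsub>EE\<^esub> \<one>\<^bsub>EE\<^esub>))"
    using PS.expand_mult[OF ex(2) EE.one_closed] ex by simp
  have z: "submodule {\<zero>\<^bsub>T\<^esub>} R T" by (rule right_submoduleI) (auto simp: smult_zero_right)
  have "(e x \<otimes>\<^bsub>EE\<^esub> s) t \<in> {\<zero>\<^bsub>T\<^esub>}"
  proof (subst eq, rule end_finsum_mem[OF finite_I _ z t(1)])
    fix y assume y: "y \<in> I"
    have ey: "e y \<in> carrier EE" using e_end y by blast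
    show "(e x \<otimes>\<^bsub>EE\<^esub> s \<otimes>\<^bsub>EE\<^esub> e y) \<otimes>\<^bsub>EE\<^esub> (e y \<otimes>\<^bsub>EE\<^esub> \<one>\<^bsub>EE\<^esub>) \<in> carrier EE" using ex ey by simp
    have c: "e y t \<in> carrier T" using endD(1)[OF ey t(1)] .
    have 0: "\<zero>\<^bsub>T\<^esub> \<in> carrier T" by simp
    have "((e x \<otimes>\<^bsub>EE\<^esub> s \<otimes>\<^bsub>EE\<^esub> e y) \<otimes>\<^bsub>EE\<^esub> (e y \<otimes>\<^bsub>EE\<^esub> \<one>\<^bsub>EE\<^esub>)) t = (e x \<otimes>\<^bsub>EE\<^esub> s \<otimes>\<^bsub>EE\<^esub> e y) (e y t)"
      using t(1) ey by (simp add: end_eval)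
    also have "\<dots> = \<zero>\<^bsub>T\<^esub>"
    proof (cases "c y = b")
      case True
      then show ?thesis using odd[OF y x(1)] x c by (simp add: end_eval)
    next
      case False
      have "e x \<otimes>\<^bsub>EE\<^esub> s \<otimes>\<^bsub>EE\<^esub> e y \<in> carrier EE" using ex ey by simp
      then show ?thesis using t(2)[OF y False] endD(4) by simp
    qed
    finally show "((e x \<otimes>\<^bsub>EE\<^esub> s \<otimes>\<^bsub>EE\<^esub> e y) \<otimes>\<^bsub>EE\<^esub> (e y \<otimes>\<^bsub>EE\<^esub> \<one>\<^bsub>EE\<^esub>)) t \<in> {\<zero>\<^bsub>T\<^esub>}" by simp
  qed
  then show ?thesis using end_eval(1)[OF t(1), of "e x" s] by simp
qed

end

context E_object
begin

text \<open>The cosets that make up the factor modules.\<close>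

definition coset :: "nat \<Rightarrow> 'b \<Rightarrow> 'b set"
  where "coset k a = filt M k +>\<^bsub>M\<^esub> a"

lemma mem_coset: assumes "k \<le> n" "a \<in> carrier M" shows "y \<in> coset k a \<longleftrightarrow> eqmod k y a"
proof
  assume "y \<in> coset k a"
  then obtain h where h: "h \<in> filt M k" "y = h \<oplus>\<^bsub>M\<^esub> a" by (auto simp: coset_def a_r_coset_def r_coset_def)
  have hc: "h \<in> carrier M" using filt_closed(1)[OF assms(1) h(1)] .
  have "y \<ominus>\<^bsub>M\<^esub> a = h" using h hc assms(2) by (simp add: M.minus_eq M.a_assoc M.r_neg)
  then show "eqmod k y a" using h hc assms by (simp add: eqmod_def)
next
  assume y: "eqmod k y a"
  have c: "y \<in> carrier M" using eqmodD[OF y] by simp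
  have "y = (y \<ominus>\<^bsub>M\<^esub> a) \<oplus>\<^bsub>M\<^esub> a" using c assms(2) by (simp add: M.minus_eq M.a_assoc M.l_neg)
  moreover have "y \<ominus>\<^bsub>M\<^esub> a \<in> filt M k" using y by (simp add: eqmod_def)
  ultimately show "y \<in> coset k a" unfolding coset_def a_r_coset_def r_coset_def by auto
qed

lemma coset_eq_iff: assumes "k \<le> n" "a \<in> carrier M" "b \<in> carrier M"
  shows "coset k a = coset k b \<longleftrightarrow> eqmod k a b"
proof
  assume "coset k a = coset k b"
  moreover have "a \<in> coset k a" using mem_coset[OF assms(1,2)] eqmod_refl[OF assms(1,2)] by simp
  ultimately show "eqmod k a b" using mem_coset[OF assms(1,3)] by simp
next
  assume ab: "eqmod k a b"
  show "coset k a = coset k b"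
    using mem_coset[OF assms(1,2)] mem_coset[OF assms(1,3)] eqmod_trans[OF assms(1)] ab eqmod_sym[OF assms(1) ab] by blast
qed

lemma coset_zero: "k \<le> n \<Longrightarrow> coset k \<zero>\<^bsub>M\<^esub> = filt M k"
  using mem_coset[of k "\<zero>\<^bsub>M\<^esub>"] eqmod_zero[of k] by auto

lemma factor_carrier: "carrier (factor_module M i) = coset (i - 1) ` filt M i"
  by (auto simp: factor_module_def quotient_module_def A_RCOSETS_def RCOSETS_def coset_def
      a_r_coset_def r_coset_def)

lemma factor_zero: "\<zero>\<^bsub>factor_module M i\<^esub> = filt M (i - 1)"
  by (simp add: factor_module_def quotient_module_def)

lemma factor_nonzero_iff:
  assumes i: "i \<in> {1..n}"
  shows "carrier (factor_module M i) \<noteq> {\<zero>\<^bsub>factor_module M i\<^esub>} \<longleftrightarrow> (\<exists>a\<in>filt M i. a \<notin> filt M (i - 1))"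
proof -
  have le: "i \<le> n" "i - 1 \<le> n" using i by auto
  have 0: "\<zero>\<^bsub>M\<^esub> \<in> filt M i" using filt_closed(2)[OF le(1)] .
  have iff: "coset (i - 1) a = filt M (i - 1) \<longleftrightarrow> a \<in> filt M (i - 1)" if "a \<in> filt M i" for a
    using coset_eq_iff[OF le(2), of a "\<zero>\<^bsub>M\<^esub>"] coset_zero[OF le(2)] eqmod_zero[OF le(2)] filt_closed(1)[OF le(1) that] by simp
  have "coset (i - 1) ` filt M i = {filt M (i - 1)} \<longleftrightarrow> (\<forall>a\<in>filt M i. coset (i - 1) a = filt M (i - 1))"
    using 0 by blast
  also have "\<dots> \<longleftrightarrow> (\<forall>a\<in>filt M i. a \<in> filt M (i - 1))" by (rule ball_cong[OF refl iff])
  finally show ?thesis unfolding factor_carrier factor_zero by blast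
qed

lemma factor_add:
  assumes "k \<le> n" "a \<in> carrier M" "b \<in> carrier M"
  shows "set_add M (coset k a) (coset k b) = coset k (a \<oplus>\<^bsub>M\<^esub> b)"
proof
  show "set_add M (coset k a) (coset k b) \<subseteq> coset k (a \<oplus>\<^bsub>M\<^esub> b)"
    using eqmod_add[OF assms(1)] assms mem_coset by (auto simp: set_add_def set_mult_def)
  show "coset k (a \<oplus>\<^bsub>M\<^esub> b) \<subseteq> set_add M (coset k a) (coset k b)"
  proof
    fix y assume "y \<in> coset k (a \<oplus>\<^bsub>M\<^esub> b)"
    then have y: "eqmod k y (a \<oplus>\<^bsub>M\<^esub> b)" using mem_coset assms by simp
    then have c: "y \<in> carrier M" by (rule eqmodD)
    have "eqmod k (y \<oplus>\<^bsub>M\<^esub> \<ominus>\<^bsub>M\<^esub> b) (a \<oplus>\<^bsub>M\<^esub> b \<oplus>\<^bsub>M\<^esub> \<ominus>\<^bsub>M\<^esub> b)"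
      using eqmod_add[OF assms(1) y eqmod_refl[OF assms(1)]] assms by simp
    then have "eqmod k (y \<oplus>\<^bsub>M\<^esub> \<ominus>\<^bsub>M\<^esub> b) a" using assms by (simp add: M.a_assoc M.r_neg)
    moreover have "y = (y \<oplus>\<^bsub>M\<^esub> \<ominus>\<^bsub>M\<^esub> b) \<oplus>\<^bsub>M\<^esub> b" using c assms by (simp add: M.a_assoc M.l_neg)
    ultimately show "y \<in> set_add M (coset k a) (coset k b)"
      using mem_coset[OF assms(1,2)] mem_coset[OF assms(1,3)] eqmod_refl[OF assms(1,3)]
      unfolding set_add_def set_mult_def by auto
  qed
qed

lemma factor_smult:
  assumes "k \<le> n" "a \<in> carrier M" "c \<in> carrier R"
  shows "(\<Union>x\<in>coset k a. filt M k +>\<^bsub>M\<^esub> (c \<odot>\<^bsub>M\<^esub> x)) = coset k (c \<odot>\<^bsub>M\<^esub> a)"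
proof -
  have "filt M k +>\<^bsub>M\<^esub> (c \<odot>\<^bsub>M\<^esub> x) = coset k (c \<odot>\<^bsub>M\<^esub> a)" if "x \<in> coset k a" for x
  proof -
    have x: "eqmod k x a" using that mem_coset assms by simp
    then have "eqmod k (c \<odot>\<^bsub>M\<^esub> x) (c \<odot>\<^bsub>M\<^esub> a)" using eqmod_smult assms by blast
    then show ?thesis
      using coset_eq_iff[OF assms(1), of "c \<odot>\<^bsub>M\<^esub> x" "c \<odot>\<^bsub>M\<^esub> a"] eqmodD[OF x] assms rsmult_closed by (simp add: coset_def)
  qed
  moreover have "a \<in> coset k a" using mem_coset[OF assms(1,2)] eqmod_refl[OF assms(1,2)] by simp
  ultimately show ?thesis by blast
qed

lemma cyclic_submodule_of_factor:
  assumes i: "i \<in> {1..n}" and u: "u \<in> filt M i"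
  shows "submodule ((\<lambda>c. coset (i - 1) (c \<odot>\<^bsub>M\<^esub> u)) ` carrier R) R (factor_module M i)"
proof -
  have le: "i \<le> n" "i - 1 \<le> n" using i by auto
  let ?Q = "factor_module M i" and ?H = "(\<lambda>c. coset (i - 1) (c \<odot>\<^bsub>M\<^esub> u)) ` carrier R"
  have uc: "u \<in> carrier M" using filt_closed(1)[OF le(1) u] .
  have add: "X \<oplus>\<^bsub>?Q\<^esub> Y = set_add M X Y" for X Y
    by (simp add: factor_module_def quotient_module_def set_add_def set_mult_def)
  have smu: "c \<odot>\<^bsub>?Q\<^esub> X = (\<Union>x\<in>X. filt M (i - 1) +>\<^bsub>M\<^esub> (c \<odot>\<^bsub>M\<^esub> x))" for c X
    by (simp add: factor_module_def quotient_module_def a_r_coset_def r_coset_def)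
  have zero: "\<zero>\<^bsub>?Q\<^esub> = coset (i - 1) \<zero>\<^bsub>M\<^esub>" using factor_zero coset_zero[OF le(2)] by simp
  have cF: "c \<odot>\<^bsub>M\<^esub> u \<in> filt M i" "c \<odot>\<^bsub>M\<^esub> u \<in> carrier M" if "c \<in> carrier R" for c
    using filt_closed(6)[OF le(1) that u] rsmult_closed[OF that uc] by auto
  have inv: "inv\<^bsub>add_monoid ?Q\<^esub> (coset (i - 1) a) = coset (i - 1) (\<ominus>\<^bsub>M\<^esub> a)" if a: "a \<in> filt M i" for a
  proof -
    have ac: "a \<in> carrier M" using filt_closed(1)[OF le(1) a] .
    have "(THE y. y \<in> carrier ?Q \<and> coset (i - 1) a \<oplus>\<^bsub>?Q\<^esub> y = \<zero>\<^bsub>?Q\<^esub> \<and> y \<oplus>\<^bsub>?Q\<^esub> coset (i - 1) a = \<zero>\<^bsub>?Q\<^esub>)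
        = coset (i - 1) (\<ominus>\<^bsub>M\<^esub> a)"
    proof (rule the_equality)
      show "coset (i - 1) (\<ominus>\<^bsub>M\<^esub> a) \<in> carrier ?Q \<and> coset (i - 1) a \<oplus>\<^bsub>?Q\<^esub> coset (i - 1) (\<ominus>\<^bsub>M\<^esub> a) = \<zero>\<^bsub>?Q\<^esub> \<and>
          coset (i - 1) (\<ominus>\<^bsub>M\<^esub> a) \<oplus>\<^bsub>?Q\<^esub> coset (i - 1) a = \<zero>\<^bsub>?Q\<^esub>"
        using a ac filt_closed(4)[OF le(1)] factor_add[OF le(2)]
        by (simp add: add zero factor_carrier M.r_neg M.l_neg)
      fix y assume y: "y \<in> carrier ?Q \<and> coset (i - 1) a \<oplus>\<^bsub>?Q\<^esub> y = \<zero>\<^bsub>?Q\<^esub> \<and> y \<oplus>\<^bsub>?Q\<^esub> coset (i - 1) a = \<zero>\<^bsub>?Q\<^esub>"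
      then obtain b where b: "b \<in> filt M i" "y = coset (i - 1) b" by (auto simp: factor_carrier)
      have bc: "b \<in> carrier M" using filt_closed(1)[OF le(1) b(1)] .
      have "coset (i - 1) (b \<oplus>\<^bsub>M\<^esub> a) = coset (i - 1) \<zero>\<^bsub>M\<^esub>"
        using y b factor_add[OF le(2) bc ac] by (simp add: add zero)
      then have "eqmod (i - 1) (b \<oplus>\<^bsub>M\<^esub> a) \<zero>\<^bsub>M\<^esub>" using coset_eq_iff[OF le(2)] ac bc by simp
      then have "b \<oplus>\<^bsub>M\<^esub> a \<in> filt M (i - 1)" using eqmod_zero[OF le(2)] by simp
      then have "eqmod (i - 1) b (\<ominus>\<^bsub>M\<^esub> a)" using ac bc by (simp add: eqmod_def M.minus_eq)
      then show "y = coset (i - 1) (\<ominus>\<^bsub>M\<^esub> a)" using b coset_eq_iff[OF le(2)] ac bc by simp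
    qed
    then show ?thesis by (simp add: m_inv_def)
  qed
  have "subgroup ?H (add_monoid ?Q)"
  proof
    show "?H \<subseteq> carrier (add_monoid ?Q)" using cF by (auto simp: factor_carrier)
    show "x \<otimes>\<^bsub>add_monoid ?Q\<^esub> y \<in> ?H" if x: "x \<in> ?H" and y: "y \<in> ?H" for x y
    proof -
      obtain c d where c: "c \<in> carrier R" "x = coset (i - 1) (c \<odot>\<^bsub>M\<^esub> u)" and d: "d \<in> carrier R" "y = coset (i - 1) (d \<odot>\<^bsub>M\<^esub> u)"
        using x y by blast
      have "x \<otimes>\<^bsub>add_monoid ?Q\<^esub> y = coset (i - 1) ((c \<oplus>\<^bsub>R\<^esub> d) \<odot>\<^bsub>M\<^esub> u)"
        using c d cF factor_add[OF le(2)] uc by (simp add: add rsmult_distr_ring)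
      then show ?thesis using c d R.add.m_closed by blast
    qed
    have "coset (i - 1) (\<zero>\<^bsub>R\<^esub> \<odot>\<^bsub>M\<^esub> u) \<in> ?H" by blast
    then show "\<one>\<^bsub>add_monoid ?Q\<^esub> \<in> ?H" using smult_zero_left[OF uc] by (simp add: zero)
    show "inv\<^bsub>add_monoid ?Q\<^esub> x \<in> ?H" if x: "x \<in> ?H" for x
    proof -
      obtain c where c: "c \<in> carrier R" "x = coset (i - 1) (c \<odot>\<^bsub>M\<^esub> u)" using x by blast
      have "\<ominus>\<^bsub>M\<^esub> (c \<odot>\<^bsub>M\<^esub> u) = (c \<otimes>\<^bsub>R\<^esub> \<ominus>\<^bsub>R\<^esub> \<one>\<^bsub>R\<^esub>) \<odot>\<^bsub>M\<^esub> u"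
        using c uc cF by (simp only: rsmult_assoc R.a_inv_closed R.one_closed smult_neg_one)
      then have "inv\<^bsub>add_monoid ?Q\<^esub> x = coset (i - 1) ((c \<otimes>\<^bsub>R\<^esub> \<ominus>\<^bsub>R\<^esub> \<one>\<^bsub>R\<^esub>) \<odot>\<^bsub>M\<^esub> u)"
        using inv[OF cF(1)[OF c(1)]] c by simp
      then show ?thesis using c by blast
    qed
  qed
  moreover have "a \<odot>\<^bsub>?Q\<^esub> x \<in> ?H" if a: "a \<in> carrier R" and x: "x \<in> ?H" for a x
  proof -
    obtain c where c: "c \<in> carrier R" "x = coset (i - 1) (c \<odot>\<^bsub>M\<^esub> u)" using x by blast
    have "a \<odot>\<^bsub>?Q\<^esub> x = coset (i - 1) ((c \<otimes>\<^bsub>R\<^esub> a) \<odot>\<^bsub>M\<^esub> u)"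
      using factor_smult[OF le(2) cF(2)[OF c(1)] a] c a uc by (simp add: smu rsmult_assoc)
    then show ?thesis using c a by blast
  qed
  ultimately show ?thesis by (simp add: submodule_def submodule_axioms_def)
qed

lemma uniserial_factor_eqmod:
  assumes i: "i \<in> {1..n}" and uni: "uniserial R (factor_module M i)" and u: "u \<in> filt M i" and v: "v \<in> filt M i"
  shows "(\<exists>a\<in>carrier R. eqmod (i - 1) u (a \<odot>\<^bsub>M\<^esub> v)) \<or> (\<exists>a\<in>carrier R. eqmod (i - 1) v (a \<odot>\<^bsub>M\<^esub> u))"
proof -
  have le: "i \<le> n" "i - 1 \<le> n" using i by auto
  let ?H = "\<lambda>u. (\<lambda>c. coset (i - 1) (c \<odot>\<^bsub>M\<^esub> u)) ` carrier R"
  have key: "\<exists>a\<in>carrier R. eqmod (i - 1) u (a \<odot>\<^bsub>M\<^esub> v)" if H: "?H u \<subseteq> ?H v" and F: "u \<in> filt M i" "v \<in> filt M i" for u v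
  proof -
    have c: "u \<in> carrier M" "v \<in> carrier M" using F filt_closed(1)[OF le(1)] by auto
    have "coset (i - 1) (\<one>\<^bsub>R\<^esub> \<odot>\<^bsub>M\<^esub> u) \<in> ?H u" by blast
    then have "coset (i - 1) u \<in> ?H v" using H rsmult_one[OF c(1)] by auto
    then obtain a where a: "a \<in> carrier R" "coset (i - 1) u = coset (i - 1) (a \<odot>\<^bsub>M\<^esub> v)" by blast
    then have "eqmod (i - 1) u (a \<odot>\<^bsub>M\<^esub> v)" using coset_eq_iff[OF le(2) c(1), of "a \<odot>\<^bsub>M\<^esub> v"] rsmult_closed[OF a(1) c(2)] by simp
    then show ?thesis using a by blast
  qed
  have "?H u \<subseteq> ?H v \<or> ?H v \<subseteq> ?H u"
    using uni cyclic_submodule_of_factor[OF i u] cyclic_submodule_of_factor[OF i v] unfolding uniserial_def by blast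
  then show ?thesis using key[OF _ u v] key[OF _ v u] by blast
qed

end

lemma induced_map_coset:
  assumes A: "E_object R n A" and B: "E_object R n B" and f: "f \<in> E_hom R n A B"
    and i: "i \<in> {1..n}" and a: "a \<in> filt A i"
  shows "induced_map B i f (E_object.coset A (i - 1) a) = E_object.coset B (i - 1) (f a)"
proof -
  interpret A: E_object R n A by fact
  interpret B: E_object R n B by fact
  note fD = E_homD[OF A B f]
  have le: "i \<le> n" "i - 1 \<le> n" using i by auto
  have ac: "a \<in> carrier A" using A.filt_closed(1)[OF le(1) a] .
  have "filt B (i - 1) +>\<^bsub>B\<^esub> f x = B.coset (i - 1) (f a)" if x: "x \<in> A.coset (i - 1) a" for x
  proof -
    have "A.eqmod (i - 1) x a" using x A.mem_coset[OF le(2) ac] by simp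
    then have xc: "x \<in> carrier A" and "x \<ominus>\<^bsub>A\<^esub> a \<in> filt A (i - 1)" by (auto simp: A.eqmod_def)
    then have "f x \<ominus>\<^bsub>B\<^esub> f a \<in> filt B (i - 1)" using fD(6)[OF xc ac] fD(7)[OF le(2), of "x \<ominus>\<^bsub>A\<^esub> a"] by simp
    then have "B.eqmod (i - 1) (f x) (f a)" using fD(1)[OF xc] fD(1)[OF ac] by (simp add: B.eqmod_def)
    then show ?thesis using B.coset_eq_iff[OF le(2) fD(1)[OF xc] fD(1)[OF ac]] by (simp add: B.coset_def)
  qed
  moreover have "a \<in> A.coset (i - 1) a" using A.mem_coset[OF le(2) ac] A.eqmod_refl[OF le(2) ac] by simp
  ultimately show ?thesis unfolding induced_map_def by blast
qed

lemma factor_inj_iff: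
  assumes A: "E_object R n A" and B: "E_object R n B" and f: "f \<in> E_hom R n A B" and i: "i \<in> {1..n}"
  shows "factor_inj A B i f \<longleftrightarrow> (\<forall>a\<in>filt A i. f a \<in> filt B (i - 1) \<longrightarrow> a \<in> filt A (i - 1))"
proof -
  interpret A: E_object R n A by fact
  interpret B: E_object R n B by fact
  note fD = E_homD[OF A B f]
  have le: "i \<le> n" "i - 1 \<le> n" using i by auto
  note Ac = A.filt_closed[OF le(1)]
  have 0: "\<zero>\<^bsub>A\<^esub> \<in> filt A i" using Ac(2) .
  have im: "induced_map B i f (A.coset (i - 1) a) = B.coset (i - 1) (f a)" if "a \<in> filt A i" for a
    using induced_map_coset[OF A B f i that] .
  show ?thesis
  proof
    assume inj: "factor_inj A B i f"
    show "\<forall>a\<in>filt A i. f a \<in> filt B (i - 1) \<longrightarrow> a \<in> filt A (i - 1)"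
    proof (intro ballI impI)
      fix a assume a: "a \<in> filt A i" "f a \<in> filt B (i - 1)"
      have "B.eqmod (i - 1) (f a) (f \<zero>\<^bsub>A\<^esub>)" using a B.eqmod_zero[OF le(2)] fD(4) by simp
      then have "B.coset (i - 1) (f a) = B.coset (i - 1) (f \<zero>\<^bsub>A\<^esub>)"
        using B.coset_eq_iff[OF le(2)] fD(1) Ac(1) a 0 by blast
      then have eq: "induced_map B i f (A.coset (i - 1) a) = induced_map B i f (A.coset (i - 1) \<zero>\<^bsub>A\<^esub>)"
        unfolding im[OF a(1)] im[OF 0] .
      have "inj_on (induced_map B i f) (A.coset (i - 1) ` filt A i)"
        using inj unfolding factor_inj_def A.factor_carrier .
      from inj_onD[OF this eq] have "A.coset (i - 1) a = A.coset (i - 1) \<zero>\<^bsub>A\<^esub>"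
        using a(1) 0 by blast
      then have "A.eqmod (i - 1) a \<zero>\<^bsub>A\<^esub>" using A.coset_eq_iff[OF le(2)] Ac(1) a 0 by blast
      then show "a \<in> filt A (i - 1)" using A.eqmod_zero[OF le(2)] by simp
    qed
  next
    assume k: "\<forall>a\<in>filt A i. f a \<in> filt B (i - 1) \<longrightarrow> a \<in> filt A (i - 1)"
    have "A.coset (i - 1) a = A.coset (i - 1) b"
      if ab: "a \<in> filt A i" "b \<in> filt A i" "B.coset (i - 1) (f a) = B.coset (i - 1) (f b)" for a b
    proof -
      have c: "a \<in> carrier A" "b \<in> carrier A" using ab Ac(1) by auto
      have "B.eqmod (i - 1) (f a) (f b)" using ab(3) B.coset_eq_iff[OF le(2) fD(1)[OF c(1)] fD(1)[OF c(2)]] by simp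
      then have "f (a \<ominus>\<^bsub>A\<^esub> b) \<in> filt B (i - 1)" using fD(6)[OF c] by (simp add: B.eqmod_def)
      then have "a \<ominus>\<^bsub>A\<^esub> b \<in> filt A (i - 1)" using k Ac(5)[OF ab(1,2)] by blast
      then show ?thesis using A.coset_eq_iff[OF le(2) c] c by (simp add: A.eqmod_def)
    qed
    then have "inj_on (induced_map B i f) (A.coset (i - 1) ` filt A i)"
      by (intro inj_onI) (elim imageE, metis im)
    then show "factor_inj A B i f" unfolding factor_inj_def A.factor_carrier .
  qed
qed

lemma factor_surj_iff:
  assumes A: "E_object R n A" and B: "E_object R n B" and f: "f \<in> E_hom R n A B" and i: "i \<in> {1..n}"
  shows "factor_surj A B i f \<longleftrightarrow> (\<forall>b\<in>filt B i. \<exists>a\<in>filt A i. f a \<ominus>\<^bsub>B\<^esub> b \<in> filt B (i - 1))"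
proof -
  interpret A: E_object R n A by fact
  interpret B: E_object R n B by fact
  note fD = E_homD[OF A B f]
  have le: "i \<le> n" "i - 1 \<le> n" using i by auto
  note Ac = A.filt_closed[OF le(1)] and Bc = B.filt_closed[OF le(1)]
  have im: "induced_map B i f ` carrier (factor_module A i) = (\<lambda>a. B.coset (i - 1) (f a)) ` filt A i"
    unfolding A.factor_carrier using induced_map_coset[OF A B f i] by (auto simp: image_image)
  have sub: "(\<lambda>a. B.coset (i - 1) (f a)) ` filt A i \<subseteq> carrier (factor_module B i)"
    unfolding B.factor_carrier using fD(7)[OF le(1)] by auto
  have iff: "B.coset (i - 1) b = B.coset (i - 1) (f a) \<longleftrightarrow> f a \<ominus>\<^bsub>B\<^esub> b \<in> filt B (i - 1)"
    if "a \<in> filt A i" "b \<in> filt B i" for a b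
  proof -
    have c: "f a \<in> carrier B" "b \<in> carrier B" using that fD(1) Ac(1) Bc(1) by auto
    then show ?thesis using B.coset_eq_iff[OF le(2) c] by (auto simp: B.eqmod_def)
  qed
  have "factor_surj A B i f \<longleftrightarrow> carrier (factor_module B i) \<subseteq> (\<lambda>a. B.coset (i - 1) (f a)) ` filt A i"
    unfolding factor_surj_def im using sub by blast
  also have "\<dots> \<longleftrightarrow> (\<forall>b\<in>filt B i. \<exists>a\<in>filt A i. B.coset (i - 1) b = B.coset (i - 1) (f a))"
    unfolding B.factor_carrier by blast
  finally show ?thesis using iff by auto
qed

section \<open>Passing between summands and objects\<close>

text \<open>The idempotent endomorphism of \<open>T\<close> given by an inclusion \<open>\<iota>\<close> and a projection \<open>\<pi>\<close>.\<close>

definition summand_idem ::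
  "('a, 'b, 'y) filtered_module_scheme \<Rightarrow> ('c \<Rightarrow> 'b) \<Rightarrow> ('b \<Rightarrow> 'c) \<Rightarrow> 'b \<Rightarrow> 'b"
  where "summand_idem T \<iota> \<pi> = (\<lambda>t\<in>carrier T. \<iota> (\<pi> t))"

text \<open>The object \<open>A\<close> is a direct summand of \<open>T\<close>.\<close>

locale E_summand = T: E_object R n T + A: E_object R n A
  for R :: "('a, 'x) ring_scheme" and n :: nat
    and T :: "('a, 'b, 'y) filtered_module_scheme" and A :: "('a, 'c, 'z) filtered_module_scheme" +
  fixes \<iota> :: "'c \<Rightarrow> 'b" and \<pi> :: "'b \<Rightarrow> 'c"
  assumes inj_hom: "\<iota> \<in> E_hom R n A T" and proj_hom: "\<pi> \<in> E_hom R n T A"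
    and proj_inj: "a \<in> carrier A \<Longrightarrow> \<pi> (\<iota> a) = a"
begin

lemmas inj = E_homD[OF A.E_object_axioms T.E_object_axioms inj_hom]
lemmas proj = E_homD[OF T.E_object_axioms A.E_object_axioms proj_hom]

lemma idem_eval: "t \<in> carrier T \<Longrightarrow> summand_idem T \<iota> \<pi> t = \<iota> (\<pi> t)"
  by (simp add: summand_idem_def)

lemma idem_end: "summand_idem T \<iota> \<pi> \<in> carrier (E_end_ring R n T)"
  unfolding summand_idem_def using inj proj by (intro T.endI) auto

lemma idem_idem: "t \<in> carrier T \<Longrightarrow> summand_idem T \<iota> \<pi> (summand_idem T \<iota> \<pi> t) = summand_idem T \<iota> \<pi> t"
  using proj(1)[of t] inj(1)[of "\<pi> t"] proj_inj[of "\<pi> t"] by (simp add: summand_idem_def)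

lemma inj_filt_iff: "\<lbrakk>k \<le> n; a \<in> carrier A\<rbrakk> \<Longrightarrow> \<iota> a \<in> filt T k \<longleftrightarrow> a \<in> filt A k"
  using inj(7) proj(7) proj_inj by metis

lemma idem_nonzero_iff:
  assumes "i \<in> {1..n}"
  shows "(\<exists>u\<in>filt T i. summand_idem T \<iota> \<pi> u \<notin> filt T (i - 1)) \<longleftrightarrow> (\<exists>a\<in>filt A i. a \<notin> filt A (i - 1))"
proof -
  have le: "i \<le> n" "i - 1 \<le> n" using assms by auto
  show ?thesis
  proof
    assume "\<exists>u\<in>filt T i. summand_idem T \<iota> \<pi> u \<notin> filt T (i - 1)"
    then obtain u where u: "u \<in> filt T i" "summand_idem T \<iota> \<pi> u \<notin> filt T (i - 1)" by blast
    have uc: "u \<in> carrier T" using T.filt_closed(1)[OF le(1) u(1)] .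
    have "\<pi> u \<notin> filt A (i - 1)" using u(2) idem_eval[OF uc] inj_filt_iff[OF le(2) proj(1)[OF uc]] by simp
    then show "\<exists>a\<in>filt A i. a \<notin> filt A (i - 1)" using proj(7)[OF le(1) u(1)] by blast
  next
    assume "\<exists>a\<in>filt A i. a \<notin> filt A (i - 1)"
    then obtain a where a: "a \<in> filt A i" "a \<notin> filt A (i - 1)" by blast
    have ac: "a \<in> carrier A" using A.filt_closed(1)[OF le(1) a(1)] .
    have "summand_idem T \<iota> \<pi> (\<iota> a) \<notin> filt T (i - 1)"
      using a(2) idem_eval[OF inj(1)[OF ac]] proj_inj[OF ac] inj_filt_iff[OF le(2) ac] by simp
    then show "\<exists>u\<in>filt T i. summand_idem T \<iota> \<pi> u \<notin> filt T (i - 1)" using inj(7)[OF le(1) a(1)] by blast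
  qed
qed

lemma idem_uniserial:
  assumes i: "i \<in> {1..n}" and uni: "uniserial R (factor_module A i)"
    and u: "u \<in> filt T i" and v: "v \<in> filt T i"
  shows "(\<exists>a\<in>carrier R. summand_idem T \<iota> \<pi> u \<ominus>\<^bsub>T\<^esub> a \<odot>\<^bsub>T\<^esub> summand_idem T \<iota> \<pi> v \<in> filt T (i - 1)) \<or>
    (\<exists>a\<in>carrier R. summand_idem T \<iota> \<pi> v \<ominus>\<^bsub>T\<^esub> a \<odot>\<^bsub>T\<^esub> summand_idem T \<iota> \<pi> u \<in> filt T (i - 1))"
proof -
  have le: "i \<le> n" "i - 1 \<le> n" using i by auto
  have key: "summand_idem T \<iota> \<pi> u \<ominus>\<^bsub>T\<^esub> a \<odot>\<^bsub>T\<^esub> summand_idem T \<iota> \<pi> v \<in> filt T (i - 1)"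
    if a: "a \<in> carrier R" and c: "A.eqmod (i - 1) (\<pi> u) (a \<odot>\<^bsub>A\<^esub> \<pi> v)" and F: "u \<in> filt T i" "v \<in> filt T i" for u v a
  proof -
    have uc: "u \<in> carrier T" "v \<in> carrier T" using T.filt_closed(1)[OF le(1)] F by auto
    have pc: "\<pi> u \<in> carrier A" "\<pi> v \<in> carrier A" "a \<odot>\<^bsub>A\<^esub> \<pi> v \<in> carrier A"
      using proj(1) uc A.rsmult_closed[OF a] by auto
    have "\<iota> (\<pi> u \<ominus>\<^bsub>A\<^esub> a \<odot>\<^bsub>A\<^esub> \<pi> v) \<in> filt T (i - 1)"
      using inj(7)[OF le(2)] c by (simp add: A.eqmod_def)
    then show ?thesis using inj(6)[OF pc(1,3)] inj(3)[OF a pc(2)] idem_eval uc by simp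
  qed
  from A.uniserial_factor_eqmod[OF i uni proj(7)[OF le(1) u] proj(7)[OF le(1) v]]
  show ?thesis using key u v by blast
qed

end

text \<open>Morphisms between two summands, viewed as endomorphisms of \<open>T\<close>, and back.\<close>

lemma summand_lift:
  assumes A: "E_summand R n T A \<iota> \<pi>" and B: "E_summand R n T B \<iota>' \<pi>'" and f: "f \<in> E_hom R n A B"
  shows "(\<lambda>t\<in>carrier T. \<iota>' (f (\<pi> t))) \<in> carrier (E_end_ring R n T)"
    and "t \<in> carrier T \<Longrightarrow> (\<lambda>t\<in>carrier T. \<iota>' (f (\<pi> t))) (summand_idem T \<iota> \<pi> t) = \<iota>' (f (\<pi> t))"
    and "t \<in> carrier T \<Longrightarrow> summand_idem T \<iota>' \<pi>' (\<iota>' (f (\<pi> t))) = \<iota>' (f (\<pi> t))"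
    and "i \<in> {1..n} \<Longrightarrow>
      (\<forall>u\<in>filt T i. \<iota>' (f (\<pi> u)) \<in> filt T (i - 1) \<longrightarrow> summand_idem T \<iota> \<pi> u \<in> filt T (i - 1)) \<longleftrightarrow>
      factor_inj A B i f"
    and "i \<in> {1..n} \<Longrightarrow>
      (\<forall>v\<in>filt T i. \<exists>u\<in>filt T i. \<iota>' (f (\<pi> u)) \<ominus>\<^bsub>T\<^esub> summand_idem T \<iota>' \<pi>' v \<in> filt T (i - 1)) \<longleftrightarrow>
      factor_surj A B i f"
proof -
  interpret A: E_summand R n T A \<iota> \<pi> by fact
  interpret B: E_summand R n T B \<iota>' \<pi>' by fact
  note fD = E_homD[OF A.A.E_object_axioms B.A.E_object_axioms f]
  show "(\<lambda>t\<in>carrier T. \<iota>' (f (\<pi> t))) \<in> carrier (E_end_ring R n T)"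
    using A.proj fD B.inj by (intro A.T.endI) auto
  show "(\<lambda>t\<in>carrier T. \<iota>' (f (\<pi> t))) (summand_idem T \<iota> \<pi> t) = \<iota>' (f (\<pi> t))" if t: "t \<in> carrier T"
    using A.proj(1)[OF t] A.inj(1)[OF A.proj(1)[OF t]] A.proj_inj[OF A.proj(1)[OF t]] A.idem_eval[OF t] by simp
  show "summand_idem T \<iota>' \<pi>' (\<iota>' (f (\<pi> t))) = \<iota>' (f (\<pi> t))" if t: "t \<in> carrier T"
    using A.proj(1)[OF t] fD(1) B.inj(1) B.proj_inj B.idem_eval by simp
  show "(\<forall>u\<in>filt T i. \<iota>' (f (\<pi> u)) \<in> filt T (i - 1) \<longrightarrow> summand_idem T \<iota> \<pi> u \<in> filt T (i - 1)) \<longleftrightarrow>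
      factor_inj A B i f" if i: "i \<in> {1..n}"
  proof -
    have le: "i \<le> n" "i - 1 \<le> n" using i by auto
    have iff: "(\<iota>' (f (\<pi> u)) \<in> filt T (i - 1) \<longrightarrow> summand_idem T \<iota> \<pi> u \<in> filt T (i - 1)) \<longleftrightarrow>
      (f (\<pi> u) \<in> filt B (i - 1) \<longrightarrow> \<pi> u \<in> filt A (i - 1))" if u: "u \<in> filt T i" for u
    proof -
      have uc: "u \<in> carrier T" using A.T.filt_closed(1)[OF le(1) u] .
      show ?thesis using A.idem_eval[OF uc] A.inj_filt_iff[OF le(2) A.proj(1)[OF uc]]
        B.inj_filt_iff[OF le(2) fD(1)[OF A.proj(1)[OF uc]]] by simp
    qed
    have ex: "(\<forall>u\<in>filt T i. Q (\<pi> u)) \<longleftrightarrow> (\<forall>a\<in>filt A i. Q a)" for Q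
    proof
      assume Q: "\<forall>u\<in>filt T i. Q (\<pi> u)"
      show "\<forall>a\<in>filt A i. Q a"
      proof
        fix a assume a: "a \<in> filt A i"
        show "Q a" using Q A.inj(7)[OF le(1) a] A.proj_inj[OF A.A.filt_closed(1)[OF le(1) a]] by force
      qed
    next
      assume "\<forall>a\<in>filt A i. Q a" then show "\<forall>u\<in>filt T i. Q (\<pi> u)" using A.proj(7)[OF le(1)] by blast
    qed
    show ?thesis
      unfolding factor_inj_iff[OF A.A.E_object_axioms B.A.E_object_axioms f i] ex[symmetric]
      by (rule ball_cong[OF refl iff])
  qed
  show "(\<forall>v\<in>filt T i. \<exists>u\<in>filt T i. \<iota>' (f (\<pi> u)) \<ominus>\<^bsub>T\<^esub> summand_idem T \<iota>' \<pi>' v \<in> filt T (i - 1)) \<longleftrightarrow>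
      factor_surj A B i f" if i: "i \<in> {1..n}"
  proof -
    have le: "i \<le> n" "i - 1 \<le> n" using i by auto
    note Fc = A.T.filt_closed(1)[OF le(1)] A.A.filt_closed(1)[OF le(1)] B.A.filt_closed(1)[OF le(1)]
    have eq: "\<iota>' (f (\<pi> u)) \<ominus>\<^bsub>T\<^esub> summand_idem T \<iota>' \<pi>' v \<in> filt T (i - 1) \<longleftrightarrow> f (\<pi> u) \<ominus>\<^bsub>B\<^esub> \<pi>' v \<in> filt B (i - 1)"
      if u: "u \<in> carrier T" and v: "v \<in> carrier T" for u v
    proof -
      have c: "f (\<pi> u) \<in> carrier B" "\<pi>' v \<in> carrier B" using u v A.proj(1) fD(1) B.proj(1) by auto
      show ?thesis
        using B.idem_eval[OF v] B.inj(6)[OF c] B.inj_filt_iff[OF le(2), of "f (\<pi> u) \<ominus>\<^bsub>B\<^esub> \<pi>' v"] c by simp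
    qed
    show ?thesis
      unfolding factor_surj_iff[OF A.A.E_object_axioms B.A.E_object_axioms f i]
    proof (intro iffI ballI)
      fix b assume L: "\<forall>v\<in>filt T i. \<exists>u\<in>filt T i. \<iota>' (f (\<pi> u)) \<ominus>\<^bsub>T\<^esub> summand_idem T \<iota>' \<pi>' v \<in> filt T (i - 1)"
        and b: "b \<in> filt B i"
      obtain u where u: "u \<in> filt T i" "\<iota>' (f (\<pi> u)) \<ominus>\<^bsub>T\<^esub> summand_idem T \<iota>' \<pi>' (\<iota>' b) \<in> filt T (i - 1)"
        using L B.inj(7)[OF le(1) b] by blast
      have "f (\<pi> u) \<ominus>\<^bsub>B\<^esub> b \<in> filt B (i - 1)"
        using u(2) eq[OF Fc(1)[OF u(1)] B.inj(1)[OF Fc(3)[OF b]]] B.proj_inj[OF Fc(3)[OF b]] by simp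
      then show "\<exists>a\<in>filt A i. f a \<ominus>\<^bsub>B\<^esub> b \<in> filt B (i - 1)" using A.proj(7)[OF le(1) u(1)] by blast
    next
      fix v assume L: "\<forall>b\<in>filt B i. \<exists>a\<in>filt A i. f a \<ominus>\<^bsub>B\<^esub> b \<in> filt B (i - 1)" and v: "v \<in> filt T i"
      obtain a where a: "a \<in> filt A i" "f a \<ominus>\<^bsub>B\<^esub> \<pi>' v \<in> filt B (i - 1)"
        using L B.proj(7)[OF le(1) v] by blast
      have "\<iota>' (f (\<pi> (\<iota> a))) \<ominus>\<^bsub>T\<^esub> summand_idem T \<iota>' \<pi>' v \<in> filt T (i - 1)"
        using a(2) eq[OF A.inj(1)[OF Fc(2)[OF a(1)]] Fc(1)[OF v]] A.proj_inj[OF Fc(2)[OF a(1)]] by simp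
      then show "\<exists>u\<in>filt T i. \<iota>' (f (\<pi> u)) \<ominus>\<^bsub>T\<^esub> summand_idem T \<iota>' \<pi>' v \<in> filt T (i - 1)"
        using A.inj(7)[OF le(1) a(1)] by blast
    qed
  qed
qed

lemma summand_restrict:
  assumes A: "E_summand R n T A \<iota> \<pi>" and B: "E_summand R n T B \<iota>' \<pi>'"
    and h: "h \<in> carrier (E_end_ring R n T)"
    "\<And>t. t \<in> carrier T \<Longrightarrow> h (summand_idem T \<iota> \<pi> t) = h t"
    "\<And>t. t \<in> carrier T \<Longrightarrow> summand_idem T \<iota>' \<pi>' (h t) = h t"
  shows "\<pi>' \<circ> h \<circ> \<iota> \<in> E_hom R n A B" "(\<lambda>t\<in>carrier T. \<iota>' ((\<pi>' \<circ> h \<circ> \<iota>) (\<pi> t))) = h"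
proof -
  interpret A: E_summand R n T A \<iota> \<pi> by fact
  interpret B: E_summand R n T B \<iota>' \<pi>' by fact
  have hom: "h \<in> E_hom R n T T" using h(1) A.T.end_carrier by blast
  note TO = A.T.E_object_axioms and AO = A.A.E_object_axioms and BO = B.A.E_object_axioms
  show "\<pi>' \<circ> h \<circ> \<iota> \<in> E_hom R n A B"
    using E_hom_comp[OF AO TO BO A.inj_hom E_hom_comp[OF TO TO BO hom B.proj_hom]] by (simp add: comp_assoc)
  show "(\<lambda>t\<in>carrier T. \<iota>' ((\<pi>' \<circ> h \<circ> \<iota>) (\<pi> t))) = h"
  proof (rule extensionalityI[of _ "carrier T"])
    show "(\<lambda>t\<in>carrier T. \<iota>' ((\<pi>' \<circ> h \<circ> \<iota>) (\<pi> t))) \<in> extensional (carrier T)" by simp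
    show "h \<in> extensional (carrier T)" using h(1) A.T.end_carrier by blast
    fix t assume t: "t \<in> carrier T"
    show "(\<lambda>t\<in>carrier T. \<iota>' ((\<pi>' \<circ> h \<circ> \<iota>) (\<pi> t))) t = h t"
      using t h(2,3)[OF t] A.idem_eval[OF t] B.idem_eval[OF A.T.endD(1)[OF h(1) t]] by simp
  qed
qed

context decomposed_object
begin

lemma sim_iff_same_class:
  assumes x: "x \<in> I" and y: "y \<in> I" and i: "i \<in> {1..n}"
    and A: "E_summand R n T A \<iota> \<pi>" "e x = summand_idem T \<iota> \<pi>"
    and B: "E_summand R n T B \<iota>' \<pi>'" "e y = summand_idem T \<iota>' \<pi>'"
    and nz: "part_nonzero i x" "part_nonzero i y"
  shows "PS.sim (2 * i) x y \<longleftrightarrow> same_monogeny_class R n i A B"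
    and "PS.sim (Suc (2 * i)) x y \<longleftrightarrow> same_epigeny_class R n i A B"
proof -
  have Fc: "u \<in> carrier T" if "u \<in> filt T i" for u using F_carrier[OF i that] .
  have lift: "\<exists>h\<in>PS.hm x y. (part_mono i x h \<longleftrightarrow> factor_inj A B i f) \<and> (part_epi i y h \<longleftrightarrow> factor_surj A B i f)"
    if x: "x \<in> I" and y: "y \<in> I" and A: "E_summand R n T A \<iota> \<pi>" "e x = summand_idem T \<iota> \<pi>"
    and B: "E_summand R n T B \<iota>' \<pi>'" "e y = summand_idem T \<iota>' \<pi>'" and f: "f \<in> E_hom R n A B"
    and nz: "part_nonzero i x" "part_nonzero i y"
    for x y and A :: "('a, 'p, 'q) filtered_module_scheme" and \<iota> \<pi>
      and B :: "('a, 'v, 'w) filtered_module_scheme" and \<iota>' \<pi>' f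
  proof -
    let ?h = "\<lambda>t\<in>carrier T. \<iota>' (f (\<pi> t))"
    note l = summand_lift[OF A(1) B(1) f]
    have hE: "?h \<in> carrier EE" using l(1) .
    have h1: "?h \<otimes>\<^bsub>EE\<^esub> e x = ?h"
      using hE e_end[OF x] l(2) A(2) by (intro end_eqI) (auto simp: end_closed end_eval)
    have h2: "e y \<otimes>\<^bsub>EE\<^esub> ?h = ?h"
      using hE e_end[OF y] l(3) B(2) by (intro end_eqI) (auto simp: end_closed end_eval)
    have hc: "\<iota>' (f (\<pi> u)) \<in> carrier T" if "u \<in> carrier T" for u using endD(1)[OF hE that] that by simp
    have m: "part_mono i x ?h \<longleftrightarrow> factor_inj A B i f"
      unfolding l(4)[OF i, symmetric] part_mono_def A(2)[symmetric] using nz Fc by auto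
    have "(eqmod (i - 1) (?h u) (e y v)) \<longleftrightarrow> \<iota>' (f (\<pi> u)) \<ominus>\<^bsub>T\<^esub> e y v \<in> filt T (i - 1)"
      if "u \<in> filt T i" "v \<in> filt T i" for u v
      using hc Fc that endD(1)[OF e_end[OF y]] by (simp add: eqmod_def)
    then have ep: "part_epi i y ?h \<longleftrightarrow> factor_surj A B i f"
      unfolding l(5)[OF i, symmetric] part_epi_def B(2)[symmetric] using nz by auto
    show ?thesis using hE h1 h2 m ep unfolding PS.hm_def by blast
  qed
  have drop: "\<exists>f\<in>E_hom R n A B. (part_mono i x h \<longleftrightarrow> factor_inj A B i f) \<and> (part_epi i y h \<longleftrightarrow> factor_surj A B i f)"
    if x: "x \<in> I" and y: "y \<in> I" and A: "E_summand R n T A \<iota> \<pi>" "e x = summand_idem T \<iota> \<pi>"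
    and B: "E_summand R n T B \<iota>' \<pi>'" "e y = summand_idem T \<iota>' \<pi>'" and h: "h \<in> PS.hm x y"
    and nz: "part_nonzero i x" "part_nonzero i y"
    for x y and A :: "('a, 'p, 'q) filtered_module_scheme" and \<iota> \<pi>
      and B :: "('a, 'v, 'w) filtered_module_scheme" and \<iota>' \<pi>' h
  proof -
    let ?f = "\<pi>' \<circ> h \<circ> \<iota>"
    have hb: "hom_between x y h" using h by (simp add: PS.hm_def hom_between_def)
    note hD = hom_betweenD[OF hb]
    have f: "?f \<in> E_hom R n A B" "(\<lambda>t\<in>carrier T. \<iota>' (?f (\<pi> t))) = h"
      using summand_restrict[OF A(1) B(1) hD(1)] hD(2,3) A(2) B(2) by auto
    have hev: "\<iota>' (?f (\<pi> u)) = h u" if "u \<in> filt T i" for u using fun_cong[OF f(2), of u] Fc[OF that] by simp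
    note l = summand_lift[OF A(1) B(1) f(1)]
    have m: "part_mono i x h \<longleftrightarrow> factor_inj A B i ?f"
      unfolding l(4)[OF i, symmetric] part_mono_def A(2)[symmetric] using nz hev by auto
    have "(eqmod (i - 1) (h u) (e y v)) \<longleftrightarrow> \<iota>' (?f (\<pi> u)) \<ominus>\<^bsub>T\<^esub> e y v \<in> filt T (i - 1)"
      if "u \<in> filt T i" "v \<in> filt T i" for u v
      using hev Fc that endD(1)[OF e_end[OF y]] endD(1)[OF hD(1)] by (simp add: eqmod_def)
    then have ep: "part_epi i y h \<longleftrightarrow> factor_surj A B i ?f"
      unfolding l(5)[OF i, symmetric] part_epi_def B(2)[symmetric] using nz by auto
    show ?thesis using f m ep by blast
  qed
  show "PS.sim (2 * i) x y \<longleftrightarrow> same_monogeny_class R n i A B"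
    unfolding PS.sim_def same_monogeny_class_def nz_simps
    using lift[OF x y A B _ nz] lift[OF y x B A _ nz(2,1)] drop[OF x y A B _ nz] drop[OF y x B A _ nz(2,1)] by meson
  show "PS.sim (Suc (2 * i)) x y \<longleftrightarrow> same_epigeny_class R n i A B"
    unfolding PS.sim_def same_epigeny_class_def nz_simps
    using lift[OF x y A B _ nz] lift[OF y x B A _ nz(2,1)] drop[OF x y A B _ nz] drop[OF y x B A _ nz(2,1)] by meson
qed

end

text \<open>The direct sum of two objects, possibly with elements of different types.\<close>

definition E_pair ::
  "('a, 'b, 'y) filtered_module_scheme \<Rightarrow> ('a, 'c, 'z) filtered_module_scheme \<Rightarrow> ('a, 'b \<times> 'c) filtered_module"
  where "E_pair P Q =
    \<lparr>carrier = carrier P \<times> carrier Q, mult = undefined, one = undefined, zero = (\<zero>\<^bsub>P\<^esub>, \<zero>\<^bsub>Q\<^esub>),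
     add = (\<lambda>x y. (fst x \<oplus>\<^bsub>P\<^esub> fst y, snd x \<oplus>\<^bsub>Q\<^esub> snd y)),
     smult = (\<lambda>a x. (a \<odot>\<^bsub>P\<^esub> fst x, a \<odot>\<^bsub>Q\<^esub> snd x)),
     filt = (\<lambda>i. filt P i \<times> filt Q i)\<rparr>"

lemma E_pair_simps:
  "carrier (E_pair P Q) = carrier P \<times> carrier Q" "\<zero>\<^bsub>E_pair P Q\<^esub> = (\<zero>\<^bsub>P\<^esub>, \<zero>\<^bsub>Q\<^esub>)"
  "x \<oplus>\<^bsub>E_pair P Q\<^esub> y = (fst x \<oplus>\<^bsub>P\<^esub> fst y, snd x \<oplus>\<^bsub>Q\<^esub> snd y)"
  "a \<odot>\<^bsub>E_pair P Q\<^esub> x = (a \<odot>\<^bsub>P\<^esub> fst x, a \<odot>\<^bsub>Q\<^esub> snd x)"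
  "filt (E_pair P Q) i = filt P i \<times> filt Q i"
  by (simp_all add: E_pair_def)

lemma E_dsum_simps:
  "carrier (E_dsum r M) = (\<Pi>\<^sub>E k\<in>{1..r}. carrier (M k))" "\<zero>\<^bsub>E_dsum r M\<^esub> = (\<lambda>k\<in>{1..r}. \<zero>\<^bsub>M k\<^esub>)"
  "x \<oplus>\<^bsub>E_dsum r M\<^esub> y = (\<lambda>k\<in>{1..r}. x k \<oplus>\<^bsub>M k\<^esub> y k)"
  "a \<odot>\<^bsub>E_dsum r M\<^esub> x = (\<lambda>k\<in>{1..r}. a \<odot>\<^bsub>M k\<^esub> x k)"
  "filt (E_dsum r M) i = (\<Pi>\<^sub>E k\<in>{1..r}. filt (M k) i)"
  by (simp_all add: E_dsum_def)

lemma E_objectI: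
  assumes R: "ring R" and ab: "abelian_group M" and rm: "right_module_axioms R M"
    and sub: "\<And>k. k \<le> n \<Longrightarrow> filt M k \<subseteq> carrier M \<and> \<zero>\<^bsub>M\<^esub> \<in> filt M k \<and>
      (\<forall>x\<in>filt M k. \<forall>y\<in>filt M k. x \<oplus>\<^bsub>M\<^esub> y \<in> filt M k) \<and> (\<forall>a\<in>carrier R. \<forall>x\<in>filt M k. a \<odot>\<^bsub>M\<^esub> x \<in> filt M k)"
    and mono: "\<And>k. k < n \<Longrightarrow> filt M k \<subseteq> filt M (Suc k)" and "filt M 0 = {\<zero>\<^bsub>M\<^esub>}" "filt M n = carrier M"
  shows "E_object R n M"
proof -
  interpret right_module R M using R ab rm by (simp add: right_module_def)
  have "submodule (filt M k) R M" if "k \<le> n" for k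
    by (rule right_submoduleI) (use sub[OF that] in blast)+
  then show ?thesis
    using right_module_axioms assms(5-7) by (simp add: E_object_def E_object_axioms_def)
qed

lemma E_object_pair:
  assumes "E_object R n P" "E_object R n Q"
  shows "E_object R n (E_pair P Q)"
proof -
  interpret P: E_object R n P by fact
  interpret Q: E_object R n Q by fact
  show ?thesis
  proof (rule E_objectI)
    show "ring R" by (rule P.R.ring_axioms)
    show "abelian_group (E_pair P Q)"
    proof (rule abelian_groupI)
      fix x assume "x \<in> carrier (E_pair P Q)"
      then show "\<exists>y\<in>carrier (E_pair P Q). y \<oplus>\<^bsub>E_pair P Q\<^esub> x = \<zero>\<^bsub>E_pair P Q\<^esub>"
        by (intro bexI[of _ "(\<ominus>\<^bsub>P\<^esub> fst x, \<ominus>\<^bsub>Q\<^esub> snd x)"]) (auto simp: E_pair_simps P.M.l_neg Q.M.l_neg)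
    qed (auto simp: E_pair_simps P.M.a_ac Q.M.a_ac)
    show "right_module_axioms R (E_pair P Q)"
      by unfold_locales
        (auto simp: E_pair_simps P.rsmult_closed Q.rsmult_closed P.rsmult_distr_ring Q.rsmult_distr_ring
          P.rsmult_distr_module Q.rsmult_distr_module P.rsmult_assoc Q.rsmult_assoc P.rsmult_one Q.rsmult_one)
    show "filt (E_pair P Q) k \<subseteq> carrier (E_pair P Q) \<and> \<zero>\<^bsub>E_pair P Q\<^esub> \<in> filt (E_pair P Q) k \<and>
        (\<forall>x\<in>filt (E_pair P Q) k. \<forall>y\<in>filt (E_pair P Q) k. x \<oplus>\<^bsub>E_pair P Q\<^esub> y \<in> filt (E_pair P Q) k) \<and>
        (\<forall>a\<in>carrier R. \<forall>x\<in>filt (E_pair P Q) k. a \<odot>\<^bsub>E_pair P Q\<^esub> x \<in> filt (E_pair P Q) k)"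
      if "k \<le> n" for k
      using P.filt_closed[OF that] Q.filt_closed[OF that] by (auto simp: E_pair_simps)
    show "filt (E_pair P Q) k \<subseteq> filt (E_pair P Q) (Suc k)" if "k < n" for k
      using P.filt_mono[OF that] Q.filt_mono[OF that] by (auto simp: E_pair_simps)
    show "filt (E_pair P Q) 0 = {\<zero>\<^bsub>E_pair P Q\<^esub>}" by (simp add: E_pair_simps P.filt_0 Q.filt_0)
    show "filt (E_pair P Q) n = carrier (E_pair P Q)" by (simp add: E_pair_simps P.filt_n Q.filt_n)
  qed
qed

lemma E_object_dsum:
  assumes R: "ring R" and M: "\<And>k. k \<in> {1..r} \<Longrightarrow> E_object R n (M k)"
  shows "E_object R n (E_dsum r M)"
proof (rule E_objectI)
  have rm: "right_module R (M k)" if "k \<in> {1..r}" for k using M[OF that] by (simp add: E_object_def)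
  have ab: "abelian_group (M k)" if "k \<in> {1..r}" for k using rm[OF that] by (simp add: right_module_def)
  have am: "abelian_monoid (M k)" if "k \<in> {1..r}" for k using ab[OF that] by (simp add: abelian_group_def)
  show "ring R" by fact
  show "abelian_group (E_dsum r M)"
  proof (rule abelian_groupI)
    fix x y z assume x: "x \<in> carrier (E_dsum r M)" and y: "y \<in> carrier (E_dsum r M)"
    show "x \<oplus>\<^bsub>E_dsum r M\<^esub> y \<in> carrier (E_dsum r M)"
      using x y abelian_monoid.a_closed[OF am] by (auto simp: E_dsum_simps PiE_iff)
    show "x \<oplus>\<^bsub>E_dsum r M\<^esub> y = y \<oplus>\<^bsub>E_dsum r M\<^esub> x"
      using x y abelian_monoid.a_comm[OF am] by (auto simp: E_dsum_simps PiE_iff restrict_def fun_eq_iff)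
    assume z: "z \<in> carrier (E_dsum r M)"
    show "(x \<oplus>\<^bsub>E_dsum r M\<^esub> y) \<oplus>\<^bsub>E_dsum r M\<^esub> z = x \<oplus>\<^bsub>E_dsum r M\<^esub> (y \<oplus>\<^bsub>E_dsum r M\<^esub> z)"
      using x y z abelian_monoid.a_assoc[OF am] by (auto simp: E_dsum_simps PiE_iff restrict_def fun_eq_iff)
  next
    show "\<zero>\<^bsub>E_dsum r M\<^esub> \<in> carrier (E_dsum r M)"
      using abelian_monoid.zero_closed[OF am] by (auto simp: E_dsum_simps)
    fix x assume x: "x \<in> carrier (E_dsum r M)"
    show "\<zero>\<^bsub>E_dsum r M\<^esub> \<oplus>\<^bsub>E_dsum r M\<^esub> x = x"
      using x abelian_monoid.l_zero[OF am] by (auto simp: E_dsum_simps PiE_iff restrict_def fun_eq_iff extensional_def)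
    show "\<exists>y\<in>carrier (E_dsum r M). y \<oplus>\<^bsub>E_dsum r M\<^esub> x = \<zero>\<^bsub>E_dsum r M\<^esub>"
      using x abelian_group.a_inv_closed[OF ab] abelian_group.l_neg[OF ab]
      by (intro bexI[of _ "\<lambda>k\<in>{1..r}. \<ominus>\<^bsub>M k\<^esub> x k"]) (auto simp: E_dsum_simps PiE_iff restrict_def fun_eq_iff extensional_def)
  qed
  show "right_module_axioms R (E_dsum r M)"
    using right_module.rsmult_closed[OF rm] right_module.rsmult_distr_ring[OF rm]
      right_module.rsmult_distr_module[OF rm] right_module.rsmult_assoc[OF rm] right_module.rsmult_one[OF rm]
    by unfold_locales (auto simp: E_dsum_simps PiE_iff restrict_def fun_eq_iff extensional_def)
  show "filt (E_dsum r M) k \<subseteq> carrier (E_dsum r M) \<and> \<zero>\<^bsub>E_dsum r M\<^esub> \<in> filt (E_dsum r M) k \<and>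
      (\<forall>x\<in>filt (E_dsum r M) k. \<forall>y\<in>filt (E_dsum r M) k. x \<oplus>\<^bsub>E_dsum r M\<^esub> y \<in> filt (E_dsum r M) k) \<and>
      (\<forall>a\<in>carrier R. \<forall>x\<in>filt (E_dsum r M) k. a \<odot>\<^bsub>E_dsum r M\<^esub> x \<in> filt (E_dsum r M) k)" if "k \<le> n" for k
    using E_object.filt_closed[OF M that] by (auto simp: E_dsum_simps PiE_iff)
  show "filt (E_dsum r M) k \<subseteq> filt (E_dsum r M) (Suc k)" if "k < n" for k
    using subsetD[OF E_object.filt_mono[OF M that]] by (auto simp: E_dsum_simps PiE_iff)
  show "filt (E_dsum r M) 0 = {\<zero>\<^bsub>E_dsum r M\<^esub>}"
    using E_object.filt_0[OF M] by (auto simp: E_dsum_simps PiE_iff restrict_def fun_eq_iff extensional_def)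
  show "filt (E_dsum r M) n = carrier (E_dsum r M)"
    using E_object.filt_n[OF M] by (auto simp: E_dsum_simps PiE_iff)
qed

text \<open>The inclusion of the \<open>k\<close>-th summand.\<close>

definition dsum_inj :: "nat \<Rightarrow> (nat \<Rightarrow> ('a, 'b, 'y) filtered_module_scheme) \<Rightarrow> nat \<Rightarrow> 'b \<Rightarrow> nat \<Rightarrow> 'b"
  where "dsum_inj r M k a = (\<lambda>k'\<in>{1..r}. if k' = k then a else \<zero>\<^bsub>M k'\<^esub>)"

lemma dsum_inj_hom:
  assumes R: "ring R" and M: "\<And>k. k \<in> {1..r} \<Longrightarrow> E_object R n (M k)" and k: "k \<in> {1..r}"
  shows "dsum_inj r M k \<in> E_hom R n (M k) (E_dsum r M)" "(\<lambda>x. x k) \<in> E_hom R n (E_dsum r M) (M k)"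
proof -
  have rm: "right_module R (M k)" if "k \<in> {1..r}" for k using M[OF that] by (simp add: E_object_def)
  have am: "abelian_monoid (M k)" if "k \<in> {1..r}" for k
    using rm[OF that] by (simp add: right_module_def abelian_group_def)
  show "dsum_inj r M k \<in> E_hom R n (M k) (E_dsum r M)"
    using abelian_monoid.zero_closed[OF am] abelian_monoid.l_zero[OF am] right_module.smult_zero_right[OF rm]
      E_object.filt_closed(2)[OF M]
    by (intro E_homI[OF M[OF k] E_object_dsum[OF R M]])
      (auto simp: dsum_inj_def E_dsum_simps PiE_iff restrict_def fun_eq_iff extensional_def)
  show "(\<lambda>x. x k) \<in> E_hom R n (E_dsum r M) (M k)"
    using k by (intro E_homI[OF E_object_dsum[OF R M] M[OF k]]) (auto simp: E_dsum_simps PiE_iff)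
qed

lemma E_pair_homs:
  assumes P: "E_object R n P" and Q: "E_object R n Q"
  shows "(\<lambda>x. (x, \<zero>\<^bsub>Q\<^esub>)) \<in> E_hom R n P (E_pair P Q)" "(\<lambda>y. (\<zero>\<^bsub>P\<^esub>, y)) \<in> E_hom R n Q (E_pair P Q)"
    "fst \<in> E_hom R n (E_pair P Q) P" "snd \<in> E_hom R n (E_pair P Q) Q"
proof -
  interpret P: E_object R n P by fact
  interpret Q: E_object R n Q by fact
  note PQ = E_object_pair[OF P Q]
  show "(\<lambda>x. (x, \<zero>\<^bsub>Q\<^esub>)) \<in> E_hom R n P (E_pair P Q)"
    using Q.filt_closed(2) by (intro E_homI[OF P PQ]) (auto simp: E_pair_simps Q.smult_zero_right)
  show "(\<lambda>y. (\<zero>\<^bsub>P\<^esub>, y)) \<in> E_hom R n Q (E_pair P Q)"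
    using P.filt_closed(2) by (intro E_homI[OF Q PQ]) (auto simp: E_pair_simps P.smult_zero_right)
  show "fst \<in> E_hom R n (E_pair P Q) P" by (intro E_homI[OF PQ P]) (auto simp: E_pair_simps)
  show "snd \<in> E_hom R n (E_pair P Q) Q" by (intro E_homI[OF PQ Q]) (auto simp: E_pair_simps)
qed

lemma dsum_zero_eval: "k \<in> {1..r} \<Longrightarrow> \<zero>\<^bsub>E_dsum r M\<^esub> k = \<zero>\<^bsub>M k\<^esub>"
  by (simp add: E_dsum_simps)

lemma dsum_inj_zero: "dsum_inj r M k \<zero>\<^bsub>M k\<^esub> = \<zero>\<^bsub>E_dsum r M\<^esub>"
  by (auto simp: dsum_inj_def E_dsum_simps restrict_def)

lemma dsum_inj_eval: "k' \<in> {1..r} \<Longrightarrow> dsum_inj r M k a k' = (if k' = k then a else \<zero>\<^bsub>M k'\<^esub>)"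
  by (simp add: dsum_inj_def)

section \<open>The two direct sums inside their sum\<close>

text \<open>
  Two finite families of objects with uniserial factors. The colour of a summand of the sum of all
  of them, \<open>isl\<close>, tells to which family it belongs.
\<close>

locale two_direct_sums =
  fixes R :: "('a, 'x) ring_scheme" and n r s :: nat
    and M :: "nat \<Rightarrow> ('a, 'b) filtered_module" and N :: "nat \<Rightarrow> ('a, 'c) filtered_module"
  assumes ring_R: "ring R"
    and M_object: "\<And>k. k \<in> {1..r} \<Longrightarrow> E_object R n (M k)"
    and N_object: "\<And>l. l \<in> {1..s} \<Longrightarrow> E_object R n (N l)"
    and M_uniserial: "\<And>k i. k \<in> {1..r} \<Longrightarrow> i \<in> {1..n} \<Longrightarrow> uniserial R (factor_module (M k) i)"
    and N_uniserial: "\<And>l i. l \<in> {1..s} \<Longrightarrow> i \<in> {1..n} \<Longrightarrow> uniserial R (factor_module (N l) i)"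
begin

abbreviation "S1 \<equiv> E_dsum r M"
abbreviation "S2 \<equiv> E_dsum s N"

lemma S1_object: "E_object R n S1" using E_object_dsum[OF ring_R M_object] by simp
lemma S2_object: "E_object R n S2" using E_object_dsum[OF ring_R N_object] by simp

text \<open>The direct sum of all the objects involved, with its $r + s$ summands.\<close>

definition whole :: "('a, (nat \<Rightarrow> 'b) \<times> (nat \<Rightarrow> 'c)) filtered_module"
  where "whole = E_pair S1 S2"

text \<open>The index set of the summands: \<open>Inl\<close> for the first direct sum, \<open>Inr\<close> for the second.\<close>

definition parts :: "(nat + nat) set"
  where "parts = Inl ` {1..r} \<union> Inr ` {1..s}"

text \<open>The inclusions of the summands.\<close>

definition injl :: "nat \<Rightarrow> 'b \<Rightarrow> (nat \<Rightarrow> 'b) \<times> (nat \<Rightarrow> 'c)"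
  where "injl k a = (dsum_inj r M k a, \<zero>\<^bsub>S2\<^esub>)"

definition injr :: "nat \<Rightarrow> 'c \<Rightarrow> (nat \<Rightarrow> 'b) \<times> (nat \<Rightarrow> 'c)"
  where "injr l b = (\<zero>\<^bsub>S1\<^esub>, dsum_inj s N l b)"

text \<open>The idempotent that belongs to a summand of the first (\<open>Inl\<close>) or second (\<open>Inr\<close>) direct sum.\<close>

definition part_proj :: "nat + nat \<Rightarrow> (nat \<Rightarrow> 'b) \<times> (nat \<Rightarrow> 'c) \<Rightarrow> (nat \<Rightarrow> 'b) \<times> (nat \<Rightarrow> 'c)"
  where "part_proj x = (case x of Inl k \<Rightarrow> summand_idem whole (injl k) (\<lambda>t. fst t k)
    | Inr l \<Rightarrow> summand_idem whole (injr l) (\<lambda>t. snd t l))"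

lemma whole_object: "E_object R n whole"
  unfolding whole_def using E_object_pair[OF S1_object S2_object] .

lemma summand_left:
  assumes k: "k \<in> {1..r}" shows "E_summand R n whole (M k) (injl k) (\<lambda>t. fst t k)"
proof -
  note ph = E_pair_homs[OF S1_object S2_object, folded whole_def]
  note dh = dsum_inj_hom[OF ring_R M_object k]
  have 1: "injl k \<in> E_hom R n (M k) whole"
    using E_hom_comp[OF M_object[OF k] S1_object whole_object dh(1) ph(1)]
    by (simp add: comp_def injl_def[abs_def])
  have 2: "(\<lambda>t. fst t k) \<in> E_hom R n whole (M k)"
    using E_hom_comp[OF whole_object S1_object M_object[OF k] ph(3) dh(2)] by (simp add: comp_def)
  show ?thesis
    using 1 2 whole_object M_object[OF k] k
    by (simp add: E_summand_def E_summand_axioms_def injl_def dsum_inj_eval)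
qed

lemma summand_right:
  assumes l: "l \<in> {1..s}" shows "E_summand R n whole (N l) (injr l) (\<lambda>t. snd t l)"
proof -
  note ph = E_pair_homs[OF S1_object S2_object, folded whole_def]
  note dh = dsum_inj_hom[OF ring_R N_object l]
  have 1: "injr l \<in> E_hom R n (N l) whole"
    using E_hom_comp[OF N_object[OF l] S2_object whole_object dh(1) ph(2)]
    by (simp add: comp_def injr_def[abs_def])
  have 2: "(\<lambda>t. snd t l) \<in> E_hom R n whole (N l)"
    using E_hom_comp[OF whole_object S2_object N_object[OF l] ph(4) dh(2)] by (simp add: comp_def)
  show ?thesis
    using 1 2 whole_object N_object[OF l] l
    by (simp add: E_summand_def E_summand_axioms_def injr_def dsum_inj_eval)
qed

lemma part_proj_eval:
  assumes "t \<in> carrier whole"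
  shows "part_proj (Inl k) t = (dsum_inj r M k (fst t k), \<zero>\<^bsub>S2\<^esub>)"
    "part_proj (Inr l) t = (\<zero>\<^bsub>S1\<^esub>, dsum_inj s N l (snd t l))"
  using assms by (simp_all add: part_proj_def summand_idem_def injl_def injr_def)

lemma whole_simps:
  "carrier whole = carrier S1 \<times> carrier S2" "\<zero>\<^bsub>whole\<^esub> = (\<zero>\<^bsub>S1\<^esub>, \<zero>\<^bsub>S2\<^esub>)"
  "filt whole i = filt S1 i \<times> filt S2 i"
  by (simp_all add: whole_def E_pair_simps)

lemma parts_cases:
  assumes "x \<in> parts"
  obtains k where "k \<in> {1..r}" "x = Inl k" | l where "l \<in> {1..s}" "x = Inr l"
  using assms by (auto simp: parts_def)

lemma part_proj_end: "x \<in> parts \<Longrightarrow> part_proj x \<in> carrier (E_end_ring R n whole)"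
  by (erule parts_cases) (simp_all add: part_proj_def E_summand.idem_end[OF summand_left]
      E_summand.idem_end[OF summand_right])

lemma part_proj_closed: "\<lbrakk>x \<in> parts; t \<in> carrier whole\<rbrakk> \<Longrightarrow> part_proj x t \<in> carrier whole"
  using E_object.endD(1)[OF whole_object part_proj_end] .

lemma part_proj_zero:
  assumes "k \<in> {1..r}" shows "t \<in> carrier whole \<Longrightarrow> fst t k = \<zero>\<^bsub>M k\<^esub> \<Longrightarrow> part_proj (Inl k) t = \<zero>\<^bsub>whole\<^esub>"
  by (simp add: part_proj_eval whole_simps dsum_inj_zero)

lemma part_proj_zero':
  assumes "l \<in> {1..s}" shows "t \<in> carrier whole \<Longrightarrow> snd t l = \<zero>\<^bsub>N l\<^esub> \<Longrightarrow> part_proj (Inr l) t = \<zero>\<^bsub>whole\<^esub>"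
  by (simp add: part_proj_eval whole_simps dsum_inj_zero)

sublocale D: decomposed_object R n whole parts part_proj
proof -
  interpret whole: E_object R n whole by (rule whole_object)
  show "decomposed_object R n whole parts part_proj"
  proof
    show "finite parts" by (simp add: parts_def)
    show "\<And>x. x \<in> parts \<Longrightarrow> part_proj x \<in> carrier (E_end_ring R n whole)" by (rule part_proj_end)
    show "part_proj x (part_proj x t) = part_proj x t" if x: "x \<in> parts" and t: "t \<in> carrier whole" for x t
      using x by (cases rule: parts_cases)
        (simp_all add: part_proj_def E_summand.idem_idem[OF summand_left _] E_summand.idem_idem[OF summand_right _] t)
    show "part_proj x (part_proj y t) = \<zero>\<^bsub>whole\<^esub>"
      if x: "x \<in> parts" and y: "y \<in> parts" and xy: "x \<noteq> y" and t: "t \<in> carrier whole" for x y t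
    proof -
      have c: "part_proj y t \<in> carrier whole" using part_proj_closed y t by blast
      from x show ?thesis
      proof (cases rule: parts_cases)
        case (1 k)
        have "fst (part_proj y t) k = \<zero>\<^bsub>M k\<^esub>"
          using y xy 1 t by (cases rule: parts_cases) (auto simp: part_proj_eval dsum_inj_eval dsum_zero_eval)
        then show ?thesis using part_proj_zero[OF 1(1) c] 1 by simp
      next
        case (2 k)
        have "snd (part_proj y t) k = \<zero>\<^bsub>N k\<^esub>"
          using y xy 2 t by (cases rule: parts_cases) (auto simp: part_proj_eval dsum_inj_eval dsum_zero_eval)
        then show ?thesis using part_proj_zero'[OF 2(1) c] 2 by simp
      qed
    qed
    show "t = \<zero>\<^bsub>whole\<^esub>" if t: "t \<in> carrier whole" and z: "\<And>x. x \<in> parts \<Longrightarrow> part_proj x t = \<zero>\<^bsub>whole\<^esub>" for t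
    proof -
      have "fst t k = \<zero>\<^bsub>M k\<^esub>" if k: "k \<in> {1..r}" for k
      proof -
        have "fst (part_proj (Inl k) t) k = \<zero>\<^bsub>S1\<^esub> k" using z[of "Inl k"] k by (simp add: parts_def whole_simps)
        then show ?thesis using k t by (simp add: part_proj_eval dsum_inj_eval dsum_zero_eval)
      qed
      moreover have "snd t l = \<zero>\<^bsub>N l\<^esub>" if l: "l \<in> {1..s}" for l
      proof -
        have "snd (part_proj (Inr l) t) l = \<zero>\<^bsub>S2\<^esub> l" using z[of "Inr l"] l by (simp add: parts_def whole_simps)
        then show ?thesis using l t by (simp add: part_proj_eval dsum_inj_eval dsum_zero_eval)
      qed
      moreover have "fst t \<in> extensional {1..r}" "snd t \<in> extensional {1..s}"
        using t by (auto simp: whole_simps E_dsum_simps PiE_iff)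
      ultimately have "fst t = \<zero>\<^bsub>S1\<^esub>" "snd t = \<zero>\<^bsub>S2\<^esub>"
        by (auto intro!: extensionalityI simp: E_dsum_simps)
      then show ?thesis by (simp add: whole_simps prod_eq_iff)
    qed
    show "(\<exists>a\<in>carrier R. part_proj x u \<ominus>\<^bsub>whole\<^esub> a \<odot>\<^bsub>whole\<^esub> part_proj x v \<in> filt whole (i - 1)) \<or>
      (\<exists>a\<in>carrier R. part_proj x v \<ominus>\<^bsub>whole\<^esub> a \<odot>\<^bsub>whole\<^esub> part_proj x u \<in> filt whole (i - 1))"
      if x: "x \<in> parts" and i: "i \<in> {1..n}" and uv: "u \<in> filt whole i" "v \<in> filt whole i" for x i u v
      using x
    proof (cases rule: parts_cases)
      case (1 k)
      show ?thesis
        using E_summand.idem_uniserial[OF summand_left[OF 1(1)] i M_uniserial[OF 1(1) i] uv]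
        unfolding 1(2) part_proj_def sum.case .
    next
      case (2 k)
      show ?thesis
        using E_summand.idem_uniserial[OF summand_right[OF 2(1)] i N_uniserial[OF 2(1) i] uv]
        unfolding 2(2) part_proj_def sum.case .
    qed
  qed
qed

lemma part_nonzero_left: "\<lbrakk>k \<in> {1..r}; i \<in> {1..n}\<rbrakk> \<Longrightarrow> D.part_nonzero i (Inl k) \<longleftrightarrow> k \<in> nonzero_factors r M i"
  unfolding D.part_nonzero_def part_proj_def sum.case E_summand.idem_nonzero_iff[OF summand_left]
    nonzero_factors_def mem_Collect_eq
  using E_object.factor_nonzero_iff[OF M_object] by blast

lemma part_nonzero_right: "\<lbrakk>l \<in> {1..s}; i \<in> {1..n}\<rbrakk> \<Longrightarrow> D.part_nonzero i (Inr l) \<longleftrightarrow> l \<in> nonzero_factors s N i"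
  unfolding D.part_nonzero_def part_proj_def sum.case E_summand.idem_nonzero_iff[OF summand_right]
    nonzero_factors_def mem_Collect_eq
  using E_object.factor_nonzero_iff[OF N_object] by blast

lemma nonzero_factors_sub: "k \<in> nonzero_factors r M i \<Longrightarrow> k \<in> {1..r}" "l \<in> nonzero_factors s N i \<Longrightarrow> l \<in> {1..s}"
  by (auto simp: nonzero_factors_def)

lemma layer_cases:
  assumes "j \<in> layer_indices n" obtains i where "i \<in> {1..n}" "j = 2 * i" | i where "i \<in> {1..n}" "j = Suc (2 * i)"
proof (cases "even j")
  case True
  then obtain i where "j = 2 * i" by blast
  then show ?thesis using that(1)[of i] assms layer_indices_iff(1)[of i n] by simp
next
  case False
  then obtain i where "j = Suc (2 * i)" by (metis oddE Suc_eq_plus1)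
  then show ?thesis using that(2)[of i] assms layer_indices_iff(2)[of i n] by simp
qed

lemma rel_sets:
  assumes j: "j \<in> layer_indices n"
  shows "{x \<in> parts. D.PS.rel j x \<and> isl x} = Inl ` nonzero_factors r M (j div 2)"
    "{x \<in> parts. D.PS.rel j x \<and> \<not> isl x} = Inr ` nonzero_factors s N (j div 2)"
proof -
  have i: "j div 2 \<in> {1..n}" using j by (auto simp: layer_indices_def)
  have rel: "D.PS.rel j x \<longleftrightarrow> D.part_nonzero (j div 2) x" if "x \<in> parts" for x
    using j by (cases rule: layer_cases) (use D.rel_iff[OF _ that] in auto)
  show "{x \<in> parts. D.PS.rel j x \<and> isl x} = Inl ` nonzero_factors r M (j div 2)"
  proof (intro equalityI subsetI)
    fix x assume "x \<in> {x \<in> parts. D.PS.rel j x \<and> isl x}"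
    then have x: "x \<in> parts" "D.PS.rel j x" "isl x" by auto
    from x(1) show "x \<in> Inl ` nonzero_factors r M (j div 2)"
      by (cases rule: parts_cases) (use x rel part_nonzero_left[OF _ i] in auto)
  next
    fix x :: "nat + nat" assume "x \<in> Inl ` nonzero_factors r M (j div 2)"
    then obtain k where k: "k \<in> nonzero_factors r M (j div 2)" "x = Inl k" by blast
    have kr: "k \<in> {1..r}" using nonzero_factors_sub k by blast
    then have "x \<in> parts" using k by (simp add: parts_def)
    then show "x \<in> {x \<in> parts. D.PS.rel j x \<and> isl x}" using rel part_nonzero_left[OF kr i] k by simp
  qed
  show "{x \<in> parts. D.PS.rel j x \<and> \<not> isl x} = Inr ` nonzero_factors s N (j div 2)"
  proof (intro equalityI subsetI)
    fix x assume "x \<in> {x \<in> parts. D.PS.rel j x \<and> \<not> isl x}"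
    then have x: "x \<in> parts" "D.PS.rel j x" "\<not> isl x" by auto
    from x(1) show "x \<in> Inr ` nonzero_factors s N (j div 2)"
      by (cases rule: parts_cases) (use x rel part_nonzero_right[OF _ i] in auto)
  next
    fix x :: "nat + nat" assume "x \<in> Inr ` nonzero_factors s N (j div 2)"
    then obtain k where k: "k \<in> nonzero_factors s N (j div 2)" "x = Inr k" by blast
    have kr: "k \<in> {1..s}" using nonzero_factors_sub k by blast
    then have "x \<in> parts" using k by (simp add: parts_def)
    then show "x \<in> {x \<in> parts. D.PS.rel j x \<and> \<not> isl x}" using rel part_nonzero_right[OF kr i] k by simp
  qed
qed

lemma sim_classes:
  assumes i: "i \<in> {1..n}" and k: "k \<in> nonzero_factors r M i" and l: "l \<in> nonzero_factors s N i"
  shows "D.PS.sim (2 * i) (Inl k) (Inr l) \<longleftrightarrow> same_monogeny_class R n i (M k) (N l)"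
    "D.PS.sim (Suc (2 * i)) (Inl k) (Inr l) \<longleftrightarrow> same_epigeny_class R n i (M k) (N l)"
proof -
  have kr: "k \<in> {1..r}" and ls: "l \<in> {1..s}" using nonzero_factors_sub k l by auto
  have x: "Inl k \<in> parts" "Inr l \<in> parts" using kr ls by (auto simp: parts_def)
  have e: "part_proj (Inl k) = summand_idem whole (injl k) (\<lambda>t. fst t k)"
    "part_proj (Inr l) = summand_idem whole (injr l) (\<lambda>t. snd t l)" by (simp_all add: part_proj_def)
  have nz: "D.part_nonzero i (Inl k)" "D.part_nonzero i (Inr l)"
    using part_nonzero_left[OF kr i] part_nonzero_right[OF ls i] k l by auto
  note c = D.sim_iff_same_class[OF x i summand_left[OF kr] e(1) summand_right[OF ls] e(2) nz]
  show "D.PS.sim (2 * i) (Inl k) (Inr l) \<longleftrightarrow> same_monogeny_class R n i (M k) (N l)" by (rule c(1))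
  show "D.PS.sim (Suc (2 * i)) (Inl k) (Inr l) \<longleftrightarrow> same_epigeny_class R n i (M k) (N l)" by (rule c(2))
qed

lemma bijections_of_iso:
  assumes iso: "E_iso R n S1 S2" and j: "j \<in> layer_indices n"
  shows "\<exists>\<phi>. bij_betw \<phi> (nonzero_factors r M (j div 2)) (nonzero_factors s N (j div 2)) \<and>
    (\<forall>k\<in>nonzero_factors r M (j div 2). D.PS.sim j (Inl k) (Inr (\<phi> k)))"
proof -
  obtain f g where f: "f \<in> E_hom R n S1 S2" and g: "g \<in> E_hom R n S2 S1"
    and gf: "\<And>x. x \<in> carrier S1 \<Longrightarrow> g (f x) = x" and fg: "\<And>y. y \<in> carrier S2 \<Longrightarrow> f (g y) = y"
    using iso by (auto simp: E_iso_def)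
  note fD = E_homD[OF S1_object S2_object f] and gD = E_homD[OF S2_object S1_object g]
  \<comment> \<open>An isomorphism and its inverse together form an involution that exchanges the halves.\<close>
  define \<sigma> where "\<sigma> = (\<lambda>t\<in>carrier whole. (g (snd t), f (fst t)))"
  have \<sigma>E: "\<sigma> \<in> carrier D.EE"
    unfolding \<sigma>_def
    by (rule D.endI) (use fD(1-3,7) gD(1-3,7) in \<open>auto simp: whole_def E_pair_simps\<close>)
  have ev: "\<sigma> t = (g (snd t), f (fst t))" if "t \<in> carrier whole" for t using that by (simp add: \<sigma>_def)
  have \<sigma>\<sigma>: "\<sigma> \<otimes>\<^bsub>D.EE\<^esub> \<sigma> = \<one>\<^bsub>D.EE\<^esub>"
  proof (rule D.end_eqI)
    show "\<sigma> \<otimes>\<^bsub>D.EE\<^esub> \<sigma> \<in> carrier D.EE" "\<one>\<^bsub>D.EE\<^esub> \<in> carrier D.EE" using \<sigma>E D.end_closed by auto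
    fix t assume t: "t \<in> carrier whole"
    have c: "\<sigma> t \<in> carrier whole" using D.endD(1)[OF \<sigma>E t] .
    have "\<sigma> (\<sigma> t) = t" using ev[OF c] ev[OF t] t gf fg by (auto simp: whole_simps)
    then show "(\<sigma> \<otimes>\<^bsub>D.EE\<^esub> \<sigma>) t = \<one>\<^bsub>D.EE\<^esub> t" using t by (simp add: D.end_eval)
  qed
  have odd: "part_proj y \<otimes>\<^bsub>D.EE\<^esub> \<sigma> \<otimes>\<^bsub>D.EE\<^esub> part_proj x = \<zero>\<^bsub>D.EE\<^esub>"
    if x: "x \<in> parts" and y: "y \<in> parts" and xy: "isl x = isl y" for x y
  proof (rule D.end_eqI)
    note E = part_proj_end[OF x] part_proj_end[OF y] \<sigma>E
    show "part_proj y \<otimes>\<^bsub>D.EE\<^esub> \<sigma> \<otimes>\<^bsub>D.EE\<^esub> part_proj x \<in> carrier D.EE" "\<zero>\<^bsub>D.EE\<^esub> \<in> carrier D.EE"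
      using E D.end_closed by auto
    fix t assume t: "t \<in> carrier whole"
    have c: "part_proj x t \<in> carrier whole" "\<sigma> (part_proj x t) \<in> carrier whole"
      using D.endD(1) E t by auto
    have "part_proj y (\<sigma> (part_proj x t)) = \<zero>\<^bsub>whole\<^esub>"
      using y
    proof (cases rule: parts_cases)
      case (1 k)
      then obtain k' where "x = Inl k'" using xy by (cases x) auto
      then have "fst (\<sigma> (part_proj x t)) = \<zero>\<^bsub>S1\<^esub>" using ev[OF c(1)] t gD(4) by (simp add: part_proj_eval)
      then show ?thesis using part_proj_zero[OF 1(1) c(2)] 1(2) by (simp add: dsum_zero_eval[OF 1(1)])
    next
      case (2 k)
      then obtain k' where "x = Inr k'" using xy by (cases x) auto
      then have "snd (\<sigma> (part_proj x t)) = \<zero>\<^bsub>S2\<^esub>" using ev[OF c(1)] t fD(4) by (simp add: part_proj_eval)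
      then show ?thesis using part_proj_zero'[OF 2(1) c(2)] 2(2) by (simp add: dsum_zero_eval[OF 2(1)])
    qed
    then show "(part_proj y \<otimes>\<^bsub>D.EE\<^esub> \<sigma> \<otimes>\<^bsub>D.EE\<^esub> part_proj x) t = \<zero>\<^bsub>D.EE\<^esub> t"
      using t c by (simp add: D.end_eval)
  qed
  let ?X = "nonzero_factors r M (j div 2)" and ?Y = "nonzero_factors s N (j div 2)"
  obtain \<psi> where \<psi>: "bij_betw \<psi> (Inl ` ?X) (Inr ` ?Y)" "\<And>x. x \<in> Inl ` ?X \<Longrightarrow> D.PS.sim j x (\<psi> x)"
    using D.class_bijection[OF \<sigma>E \<sigma>\<sigma>, of isl, OF odd j] unfolding rel_sets[OF j] by blast
  define \<phi> where "\<phi> k = projr (\<psi> (Inl k))" for k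
  have \<phi>: "\<psi> (Inl k) = Inr (\<phi> k)" if "k \<in> ?X" for k
    using bij_betw_apply[OF \<psi>(1), of "Inl k"] that by (auto simp: \<phi>_def)
  have "bij_betw \<phi> ?X ?Y"
  proof -
    have 1: "bij_betw Inl ?X (Inl ` ?X)" by (simp add: bij_betw_def)
    have 2: "bij_betw projr (Inr ` ?Y) ?Y" by (simp add: bij_betw_def inj_on_def image_image)
    have "bij_betw (projr \<circ> (\<psi> \<circ> Inl)) ?X ?Y" using bij_betw_trans[OF bij_betw_trans[OF 1 \<psi>(1)] 2] .
    then show ?thesis by (simp add: \<phi>_def[abs_def] comp_def)
  qed
  then show ?thesis using \<psi>(2) \<phi> by (intro exI[of _ \<phi>]) force
qed

text \<open>
  The unit \<open>\<sigma>\<close> maps each half into the other one. That its inverse \<open>\<tau>\<close> does so too needs a word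
  (\<open>\<tau>right\<close>): a component of $\tau(0, y)$ in the second half would be mapped to zero by \<open>\<sigma>\<close>.
\<close>

lemma iso_of_bijections:
  assumes \<phi>: "\<And>j. j \<in> layer_indices n \<Longrightarrow>
    bij_betw (\<phi> j) (nonzero_factors r M (j div 2)) (nonzero_factors s N (j div 2)) \<and>
    (\<forall>k\<in>nonzero_factors r M (j div 2). D.PS.sim j (Inl k) (Inr (\<phi> j k)))"
  shows "E_iso R n S1 S2"
proof -
  have "bij_betw (\<lambda>x. Inr (\<phi> j (projl x))) {x \<in> parts. D.PS.rel j x \<and> isl x} {x \<in> parts. D.PS.rel j x \<and> \<not> isl x} \<and>
      (\<forall>x\<in>{x \<in> parts. D.PS.rel j x \<and> isl x}. D.PS.sim j x (Inr (\<phi> j (projl x))))"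
    if j: "j \<in> layer_indices n" for j
  proof -
    let ?X = "nonzero_factors r M (j div 2)" and ?Y = "nonzero_factors s N (j div 2)"
    have 1: "bij_betw projl (Inl ` ?X) ?X" by (simp add: bij_betw_def inj_on_def image_image)
    have 2: "bij_betw Inr ?Y (Inr ` ?Y)" by (simp add: bij_betw_def)
    have "bij_betw (Inr \<circ> (\<phi> j \<circ> projl)) (Inl ` ?X) (Inr ` ?Y)"
      using bij_betw_trans[OF bij_betw_trans[OF 1] 2, of "\<phi> j"] \<phi>[OF j] by blast
    then show ?thesis using \<phi>[OF j] unfolding rel_sets[OF j] by (auto simp: comp_def)
  qed
  then obtain \<sigma> where \<sigma>: "\<sigma> \<in> Units D.EE"
    "\<And>x y. \<lbrakk>x \<in> parts; y \<in> parts; isl x = isl y\<rbrakk> \<Longrightarrow> part_proj y \<otimes>\<^bsub>D.EE\<^esub> \<sigma> \<otimes>\<^bsub>D.EE\<^esub> part_proj x = \<zero>\<^bsub>D.EE\<^esub>"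
    using D.odd_unit[of "\<lambda>j x. Inr (\<phi> j (projl x))" isl] by blast
  have \<sigma>E: "\<sigma> \<in> carrier D.EE" using \<sigma>(1) by (simp add: D.EE.Units_closed)
  obtain \<tau> where \<tau>: "\<tau> \<in> carrier D.EE" "\<tau> \<otimes>\<^bsub>D.EE\<^esub> \<sigma> = \<one>\<^bsub>D.EE\<^esub>" "\<sigma> \<otimes>\<^bsub>D.EE\<^esub> \<tau> = \<one>\<^bsub>D.EE\<^esub>"
    using \<sigma>(1) by (auto simp: Units_def)
  have \<tau>\<sigma>: "\<tau> (\<sigma> t) = t" "\<sigma> (\<tau> t) = t" if t: "t \<in> carrier whole" for t
    using fun_cong[OF \<tau>(2), of t] fun_cong[OF \<tau>(3), of t] t by (simp_all add: D.end_eval)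
  interpret S1: E_object R n S1 by (rule S1_object)
  interpret S2: E_object R n S2 by (rule S2_object)
  have ext: "x = \<zero>\<^bsub>S1\<^esub>" if "x \<in> carrier S1" "\<And>k. k \<in> {1..r} \<Longrightarrow> x k = \<zero>\<^bsub>M k\<^esub>" for x
    using that by (intro extensionalityI[of x "{1..r}"]) (auto simp: E_dsum_simps PiE_iff)
  have ext': "x = \<zero>\<^bsub>S2\<^esub>" if "x \<in> carrier S2" "\<And>k. k \<in> {1..s} \<Longrightarrow> x k = \<zero>\<^bsub>N k\<^esub>" for x
    using that by (intro extensionalityI[of x "{1..s}"]) (auto simp: E_dsum_simps PiE_iff)
  have left: "fst (\<sigma> (x, \<zero>\<^bsub>S2\<^esub>)) = \<zero>\<^bsub>S1\<^esub>" if x: "x \<in> carrier S1" for x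
  proof (rule ext)
    let ?t = "(x, \<zero>\<^bsub>S2\<^esub>)"
    have t: "?t \<in> carrier whole" using x by (simp add: whole_simps)
    have c: "\<sigma> ?t \<in> carrier whole" using D.endD(1)[OF \<sigma>E t] .
    then show "fst (\<sigma> ?t) \<in> carrier S1" by (auto simp: whole_simps)
    have 0: "part_proj z ?t = \<zero>\<^bsub>whole\<^esub>" if "z \<in> parts" "isl z \<noteq> True" for z
      using that(1) by (cases rule: parts_cases) (use that t in \<open>auto intro!: part_proj_zero' simp: dsum_zero_eval\<close>)
    fix k assume k: "k \<in> {1..r}"
    have kp: "Inl k \<in> parts" using k by (simp add: parts_def)
    have "part_proj (Inl k) (\<sigma> ?t) = \<zero>\<^bsub>whole\<^esub>"
      by (rule D.odd_maps[OF \<sigma>E \<sigma>(2) t 0 kp]) auto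
    then have "fst (part_proj (Inl k) (\<sigma> ?t)) k = \<zero>\<^bsub>S1\<^esub> k" by (simp add: whole_simps)
    then show "fst (\<sigma> ?t) k = \<zero>\<^bsub>M k\<^esub>" using c k by (simp add: part_proj_eval dsum_inj_eval dsum_zero_eval)
  qed
  have right: "snd (\<sigma> (\<zero>\<^bsub>S1\<^esub>, y)) = \<zero>\<^bsub>S2\<^esub>" if y: "y \<in> carrier S2" for y
  proof (rule ext')
    let ?t = "(\<zero>\<^bsub>S1\<^esub>, y)"
    have t: "?t \<in> carrier whole" using y by (simp add: whole_simps)
    have c: "\<sigma> ?t \<in> carrier whole" using D.endD(1)[OF \<sigma>E t] .
    then show "snd (\<sigma> ?t) \<in> carrier S2" by (auto simp: whole_simps)
    have 0: "part_proj z ?t = \<zero>\<^bsub>whole\<^esub>" if "z \<in> parts" "isl z \<noteq> False" for z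
      using that(1) by (cases rule: parts_cases) (use that t in \<open>auto intro!: part_proj_zero simp: dsum_zero_eval\<close>)
    fix k assume k: "k \<in> {1..s}"
    have kp: "Inr k \<in> parts" using k by (simp add: parts_def)
    have "part_proj (Inr k) (\<sigma> ?t) = \<zero>\<^bsub>whole\<^esub>"
      by (rule D.odd_maps[OF \<sigma>E \<sigma>(2) t 0 kp]) auto
    then have "snd (part_proj (Inr k) (\<sigma> ?t)) k = \<zero>\<^bsub>S2\<^esub> k" by (simp add: whole_simps)
    then show "snd (\<sigma> ?t) k = \<zero>\<^bsub>N k\<^esub>" using c k by (simp add: part_proj_eval dsum_inj_eval dsum_zero_eval)
  qed
  have \<tau>right: "snd (\<tau> (\<zero>\<^bsub>S1\<^esub>, y)) = \<zero>\<^bsub>S2\<^esub>" if y: "y \<in> carrier S2" for y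
  proof -
    have t: "(\<zero>\<^bsub>S1\<^esub>, y) \<in> carrier whole" using y by (simp add: whole_simps)
    obtain a b where ab: "\<tau> (\<zero>\<^bsub>S1\<^esub>, y) = (a, b)" by fastforce
    have c: "a \<in> carrier S1" "b \<in> carrier S2" using D.endD(1)[OF \<tau>(1) t] ab by (auto simp: whole_simps)
    have ct: "(a, \<zero>\<^bsub>S2\<^esub>) \<in> carrier whole" "(\<zero>\<^bsub>S1\<^esub>, b) \<in> carrier whole" using c by (auto simp: whole_simps)
    have sum: "(a, b) = (a, \<zero>\<^bsub>S2\<^esub>) \<oplus>\<^bsub>whole\<^esub> (\<zero>\<^bsub>S1\<^esub>, b)" using c by (simp add: whole_def E_pair_simps)
    have "(\<zero>\<^bsub>S1\<^esub>, y) = \<sigma> (a, \<zero>\<^bsub>S2\<^esub>) \<oplus>\<^bsub>whole\<^esub> \<sigma> (\<zero>\<^bsub>S1\<^esub>, b)"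
      using \<tau>\<sigma>(2)[OF t] D.endD(2)[OF \<sigma>E ct] unfolding ab sum[symmetric] by simp
    then have "\<zero>\<^bsub>S1\<^esub> = fst (\<sigma> (a, \<zero>\<^bsub>S2\<^esub>)) \<oplus>\<^bsub>S1\<^esub> fst (\<sigma> (\<zero>\<^bsub>S1\<^esub>, b))" by (simp add: whole_def E_pair_simps)
    moreover have sc: "fst (\<sigma> (\<zero>\<^bsub>S1\<^esub>, b)) \<in> carrier S1" using D.endD(1)[OF \<sigma>E ct(2)] by (auto simp: whole_simps)
    ultimately have "fst (\<sigma> (\<zero>\<^bsub>S1\<^esub>, b)) = \<zero>\<^bsub>S1\<^esub>" using left[OF c(1)] by simp
    then have "\<sigma> (\<zero>\<^bsub>S1\<^esub>, b) = \<zero>\<^bsub>whole\<^esub>" using right[OF c(2)] by (simp add: whole_simps prod_eq_iff)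
    then have "(\<zero>\<^bsub>S1\<^esub>, b) = \<zero>\<^bsub>whole\<^esub>" using \<tau>\<sigma>(1)[OF ct(2)] D.endD(4)[OF \<tau>(1)] by simp
    then show ?thesis using ab by (simp add: whole_simps)
  qed
  note ph = E_pair_homs[OF S1_object S2_object, folded whole_def]
  have hom: "\<sigma> \<in> E_hom R n whole whole" "\<tau> \<in> E_hom R n whole whole" using \<sigma>E \<tau>(1) D.end_carrier by auto
  define f where "f = snd \<circ> (\<sigma> \<circ> (\<lambda>x. (x, \<zero>\<^bsub>S2\<^esub>)))"
  define g where "g = fst \<circ> (\<tau> \<circ> (\<lambda>y. (\<zero>\<^bsub>S1\<^esub>, y)))"
  have f: "f \<in> E_hom R n S1 S2" unfolding f_def
    using E_hom_comp[OF S1_object whole_object S2_object E_hom_comp[OF S1_object whole_object whole_object ph(1) hom(1)] ph(4)] .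
  have g: "g \<in> E_hom R n S2 S1" unfolding g_def
    using E_hom_comp[OF S2_object whole_object S1_object E_hom_comp[OF S2_object whole_object whole_object ph(2) hom(2)] ph(3)] .
  have "g (f x) = x" if x: "x \<in> carrier S1" for x
  proof -
    have t: "(x, \<zero>\<^bsub>S2\<^esub>) \<in> carrier whole" using x by (simp add: whole_simps)
    have "(\<zero>\<^bsub>S1\<^esub>, f x) = \<sigma> (x, \<zero>\<^bsub>S2\<^esub>)" using left[OF x] by (simp add: f_def prod_eq_iff)
    then show ?thesis using \<tau>\<sigma>(1)[OF t] by (simp add: g_def)
  qed
  moreover have "f (g y) = y" if y: "y \<in> carrier S2" for y
  proof -
    have t: "(\<zero>\<^bsub>S1\<^esub>, y) \<in> carrier whole" using y by (simp add: whole_simps)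
    have "(g y, \<zero>\<^bsub>S2\<^esub>) = \<tau> (\<zero>\<^bsub>S1\<^esub>, y)" using \<tau>right[OF y] by (simp add: g_def prod_eq_iff)
    then show ?thesis using \<tau>\<sigma>(2)[OF t] by (simp add: f_def)
  qed
  ultimately show ?thesis using f g unfolding E_iso_def by blast
qed

end

theorem theorem5p2:
  fixes R :: "('a, 'x) ring_scheme"
    and n r s :: nat
    and M :: "nat \<Rightarrow> ('a, 'b) filtered_module"
    and N :: "nat \<Rightarrow> ('a, 'c) filtered_module"
  assumes "ring R"
    and "n \<ge> 1"
    and "\<And>k. k \<in> {1..r} \<Longrightarrow> E_object R n (M k)"
    and "\<And>l. l \<in> {1..s} \<Longrightarrow> E_object R n (N l)"
    and "\<And>k. k \<in> {1..r} \<Longrightarrow> carrier (M k) \<noteq> {\<zero>\<^bsub>M k\<^esub>}"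
    and "\<And>l. l \<in> {1..s} \<Longrightarrow> carrier (N l) \<noteq> {\<zero>\<^bsub>N l\<^esub>}"
    and "\<And>k i. k \<in> {1..r} \<Longrightarrow> i \<in> {1..n} \<Longrightarrow> uniserial R (factor_module (M k) i)"
    and "\<And>l i. l \<in> {1..s} \<Longrightarrow> i \<in> {1..n} \<Longrightarrow> uniserial R (factor_module (N l) i)"
  shows "E_iso R n (E_dsum r M) (E_dsum s N) \<longleftrightarrow>
    (\<exists>\<phi>m \<phi>e :: nat \<Rightarrow> nat \<Rightarrow> nat.
      \<forall>i\<in>{1..n}.
        bij_betw (\<phi>m i) (nonzero_factors r M i) (nonzero_factors s N i) \<and>
        bij_betw (\<phi>e i) (nonzero_factors r M i) (nonzero_factors s N i) \<and>
        (\<forall>k\<in>nonzero_factors r M i.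
          same_monogeny_class R n i (M k) (N (\<phi>m i k)) \<and>
          same_epigeny_class R n i (M k) (N (\<phi>e i k))))"
proof -
  interpret two_direct_sums R n r s M N
    by (rule two_direct_sums.intro) (fact assms)+
  have mem: "\<phi> k \<in> nonzero_factors s N i" if "bij_betw \<phi> (nonzero_factors r M i) (nonzero_factors s N i)"
    "k \<in> nonzero_factors r M i" for \<phi> k i using bij_betw_apply[OF that] .
  show ?thesis
  proof
    assume iso: "E_iso R n (E_dsum r M) (E_dsum s N)"
    have "\<exists>\<phi>. bij_betw \<phi> (nonzero_factors r M i) (nonzero_factors s N i) \<and>
        (\<forall>k\<in>nonzero_factors r M i. same_monogeny_class R n i (M k) (N (\<phi> k)))" if i: "i \<in> {1..n}" for i
      using bijections_of_iso[OF iso, of "2 * i"] layer_indices_iff(1)[of i n] i sim_classes(1)[OF i] mem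
      by fastforce
    then obtain \<phi>m where m: "\<And>i. i \<in> {1..n} \<Longrightarrow> bij_betw (\<phi>m i) (nonzero_factors r M i) (nonzero_factors s N i) \<and>
        (\<forall>k\<in>nonzero_factors r M i. same_monogeny_class R n i (M k) (N (\<phi>m i k)))" by metis
    have "\<exists>\<phi>. bij_betw \<phi> (nonzero_factors r M i) (nonzero_factors s N i) \<and>
        (\<forall>k\<in>nonzero_factors r M i. same_epigeny_class R n i (M k) (N (\<phi> k)))" if i: "i \<in> {1..n}" for i
      using bijections_of_iso[OF iso, of "Suc (2 * i)"] layer_indices_iff(2)[of i n] i sim_classes(2)[OF i] mem
      by fastforce
    then obtain \<phi>e where e: "\<And>i. i \<in> {1..n} \<Longrightarrow> bij_betw (\<phi>e i) (nonzero_factors r M i) (nonzero_factors s N i) \<and>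
        (\<forall>k\<in>nonzero_factors r M i. same_epigeny_class R n i (M k) (N (\<phi>e i k)))" by metis
    show "\<exists>\<phi>m \<phi>e :: nat \<Rightarrow> nat \<Rightarrow> nat. \<forall>i\<in>{1..n}.
        bij_betw (\<phi>m i) (nonzero_factors r M i) (nonzero_factors s N i) \<and>
        bij_betw (\<phi>e i) (nonzero_factors r M i) (nonzero_factors s N i) \<and>
        (\<forall>k\<in>nonzero_factors r M i.
          same_monogeny_class R n i (M k) (N (\<phi>m i k)) \<and>
          same_epigeny_class R n i (M k) (N (\<phi>e i k)))"
      by (intro exI[of _ \<phi>m] exI[of _ \<phi>e]) (use m e in blast)
  next
    assume "\<exists>\<phi>m \<phi>e :: nat \<Rightarrow> nat \<Rightarrow> nat. \<forall>i\<in>{1..n}.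
        bij_betw (\<phi>m i) (nonzero_factors r M i) (nonzero_factors s N i) \<and>
        bij_betw (\<phi>e i) (nonzero_factors r M i) (nonzero_factors s N i) \<and>
        (\<forall>k\<in>nonzero_factors r M i.
          same_monogeny_class R n i (M k) (N (\<phi>m i k)) \<and>
          same_epigeny_class R n i (M k) (N (\<phi>e i k)))"
    then obtain \<phi>m \<phi>e :: "nat \<Rightarrow> nat \<Rightarrow> nat" where \<phi>: "\<And>i. i \<in> {1..n} \<Longrightarrow>
        bij_betw (\<phi>m i) (nonzero_factors r M i) (nonzero_factors s N i) \<and>
        bij_betw (\<phi>e i) (nonzero_factors r M i) (nonzero_factors s N i) \<and>
        (\<forall>k\<in>nonzero_factors r M i.
          same_monogeny_class R n i (M k) (N (\<phi>m i k)) \<and>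
          same_epigeny_class R n i (M k) (N (\<phi>e i k)))" by metis
    let ?\<phi> = "\<lambda>j. if even j then \<phi>m (j div 2) else \<phi>e (j div 2)"
    show "E_iso R n (E_dsum r M) (E_dsum s N)"
    proof (rule iso_of_bijections[of ?\<phi>])
      fix j assume "j \<in> layer_indices n"
      then show "bij_betw (?\<phi> j) (nonzero_factors r M (j div 2)) (nonzero_factors s N (j div 2)) \<and>
          (\<forall>k\<in>nonzero_factors r M (j div 2). D.PS.sim j (Inl k) (Inr (?\<phi> j k)))"
      proof (cases rule: layer_cases)
        case (1 i)
        then show ?thesis using \<phi>[OF 1(1)] sim_classes(1)[OF 1(1)] mem[of "\<phi>m i" i] by simp
      next
        case (2 i)
        then show ?thesis using \<phi>[OF 2(1)] sim_classes(2)[OF 2(1)] mem[of "\<phi>e i" i] by simp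
      qed
    qed
  qed
qed

end
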